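(* Let $d\ge 2$ and $M>0$, and let $\mathcal{F}_{d,M}=\{f\in\mathbb{D}([0,1]^d):\|f\|_v\le M\}$ be the class of càdlàg functions on $[0,1]^d$ with sectional variation norm at most $M$. Suppose that $P_0$ is such that, for all $1\le r<\infty$ and for every real-valued function $f$ on $[0,1]^d$, $\|f\|_{P_0,r}\le c(r)\|f\|_{\mu,r}$ for some $c(r)>0$, where $\mu$ is the Lebesgue measure. Then for all $1\le r<\infty$ and all $0<\epsilon<1$, the bracketing entropy of $\mathcal{F}_{d,M}$ with respect to the $\|\cdot\|_{P_0,r}$ norm satisfies $$\log N_{[]}(\epsilon,\mathcal{F}_{d,M},\|\cdot\|_{P_0,r})\lesssim C(r,d)\,M\,\epsilon^{-1}\,|\log(\epsilon/M)|^{2(d-1)},$$ where $C(r,d)$ is a constant that depends only on $r$ and $d$. This implies the following bound on the bracketing entropy integral of $\mathcal{F}_{d,M}$ with respect to the $\|\cdot\|_{P_0,r}$ norm: for all $0<\delta<1$, $$J_{[]}(\delta,\mathcal{F}_{d,M},\|\cdot\|_{P_0,r})\lesssim \sqrt{C(r,d)}\,\sqrt{M}\,\delta^{1/2}\,|\log(\delta/M)|^{d-1}.$$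
   Context: $\mathbb{D}([0,1]^d)$ is the set of real-valued càdlàg functions on $[0,1]^d$ (continuous from the upper-right quadrant at each point, with limits from all quadrants). For $\emptyset\ne s\subseteq[d]=\{1,\dots,d\}$ and $x\in[0,1]^d$ write $x_s=(x_j:j\in s)$, $x_{-s}=(x_j:j\notin s)$, and let $f_s:x_s\mapsto f(x_s,0_{-s})$ be the $s$-section of $f$. The sectional variation norm is $\|f\|_v=|f(0)|+\sum_{\emptyset\neq s\subseteq[d]}\int|f_s(dx_s)|$, where $f_s(dx_s)$ is the signed measure on $(0_s,1_s]$ generated by $f_s$ (the measure of a box $(a,b]$ is the iterated difference of $f_s$ over its vertices) and $|f_s(dx_s)|$ its total variation measure; $\|f\|_v=\infty$ if some $f_s$ does not generate a finite signed measure. $P_0$ is a probability distribution; for a function $f$ on $[0,1]^d$, $\|f\|_{P_0,r}=(\int|f|^r\,dP_0)^{1/r}$ (with respect to the distribution under $P_0$ of the $[0,1]^d$-valued variable $X$), and $\|f\|_{\mu,r}=(\int|f|^r\,d\mu)^{1/r}$, with $\mu$ the Lebesgue measure on $[0,1]^d$. For a norm $\|\cdot\|$, an $(\epsilon,\|\cdot\|)$-bracket is a set $[l,u]=\{f:l\le f\le u\}$ with $\|u-l\|\le\epsilon$ ($l,u$ need not belong to the class); $N_{[]}(\epsilon,\mathcal{F},\|\cdot\|)$ is the minimal number of such brackets covering $\mathcal{F}$, its logarithm is the bracketing entropy, and $J_{[]}(\delta,\mathcal{F},\|\cdot\|)=\int_0^\delta\sqrt{\log N_{[]}(\epsilon,\mathcal{F},\|\cdot\|)}\,d\epsilon$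 is the bracketing entropy integral. The notation $a\lesssim b$ means $a\le Kb$ for a constant $K$ not depending on $\epsilon$, $\delta$ or $M$ (it may depend on $d$, $r$ and $c(r)$).
   Formalization: As stated the bounds fail at ε=M (or δ=M), where the logarithm vanishes but the entropy is positive; they are proved, for every η>0, for ε (resp. δ) with |log(ε/M)|≥η (resp. |log(δ/M)|≥η), the constant in ≲ depending also on η. *)

theory Defs
  imports "HOL-Probability.Probability"
begin

text \<open>Points of $[0,1]^d$ are extensional functions on \<open>{1..d}\<close>, so that faces and sections for
  every \<open>s \<subseteq> {1..d}\<close> live in the same type. The values of a function \<open>f :: (nat \<Rightarrow> real) \<Rightarrow> real\<close>
  outside the cube are irrelevant.\<close>

definition unit_cube :: "nat \<Rightarrow> (nat \<Rightarrow> real) set" where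
  "unit_cube d = (\<Pi>\<^sub>E j\<in>{1..d}. {0..1})"

definition lebesgue_cube :: "nat \<Rightarrow> (nat \<Rightarrow> real) measure" where
  "lebesgue_cube d = (\<Pi>\<^sub>M j\<in>{1..d}. restrict_space lborel {0..1})"

definition quadrant :: "nat \<Rightarrow> (nat \<Rightarrow> real) \<Rightarrow> nat set \<Rightarrow> (nat \<Rightarrow> real) set" where
  "quadrant d x t = {y \<in> unit_cube d. \<forall>j\<in>{1..d}. if j \<in> t then y j < x j else x j \<le> y j}"

text \<open>The filter \<open>at x within _\<close> is that of the product topology on \<open>nat \<Rightarrow> real\<close>; on the cube,
  whose points agree outside \<open>{1..d}\<close>, this is the Euclidean topology. The quadrant for
  \<open>t = {}\<close> is the upper-right one. Empty quadrants impose nothing.\<close>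

definition cadlag :: "nat \<Rightarrow> ((nat \<Rightarrow> real) \<Rightarrow> real) \<Rightarrow> bool" where
  "cadlag d f \<longleftrightarrow> (\<forall>x\<in>unit_cube d.
     (f \<longlongrightarrow> f x) (at x within quadrant d x {}) \<and>
     (\<forall>t\<subseteq>{1..d}. \<exists>L. (f \<longlongrightarrow> L) (at x within quadrant d x t)))"

definition signed_measure :: "'a measure \<Rightarrow> ('a set \<Rightarrow> real) \<Rightarrow> bool" where
  "signed_measure \<Omega> \<nu> \<longleftrightarrow>
     (\<forall>A :: nat \<Rightarrow> 'a set. range A \<subseteq> sets \<Omega> \<longrightarrow> disjoint_family A \<longrightarrow>
        (\<lambda>i. \<nu> (A i)) sums \<nu> (\<Union>i. A i))"

definition total_variation :: "'a measure \<Rightarrow> ('a set \<Rightarrow> real) \<Rightarrow> ennreal" where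
  "total_variation \<Omega> \<nu> =
     (SUP P \<in> {P. finite P \<and> P \<subseteq> sets \<Omega> \<and> partition_on (space \<Omega>) P}. \<Sum>A\<in>P. ennreal \<bar>\<nu> A\<bar>)"

text \<open>The half-open face $(0_s,1_s]$ with its Borel sets.\<close>

definition face :: "nat set \<Rightarrow> (nat \<Rightarrow> real) measure" where
  "face s = (\<Pi>\<^sub>M j\<in>s. restrict_space borel {0<..1})"

definition sect :: "nat \<Rightarrow> nat set \<Rightarrow> ((nat \<Rightarrow> real) \<Rightarrow> real) \<Rightarrow> (nat \<Rightarrow> real) \<Rightarrow> real" where
  "sect d s f x = f (\<lambda>j\<in>{1..d}. if j \<in> s then x j else 0)"

definition box_increment :: "nat set \<Rightarrow> ((nat \<Rightarrow> real) \<Rightarrow> real) \<Rightarrow> (nat \<Rightarrow> real) \<Rightarrow> (nat \<Rightarrow> real) \<Rightarrow> real" where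
  "box_increment s g a b = (\<Sum>t\<in>Pow s. (- 1) ^ card t * g (\<lambda>j\<in>s. if j \<in> t then a j else b j))"

definition generates :: "nat set \<Rightarrow> ((nat \<Rightarrow> real) \<Rightarrow> real) \<Rightarrow> ((nat \<Rightarrow> real) set \<Rightarrow> real) \<Rightarrow> bool" where
  "generates s g \<nu> \<longleftrightarrow> signed_measure (face s) \<nu> \<and>
     (\<forall>a\<in>(\<Pi>\<^sub>E j\<in>s. {0..1}). \<forall>b\<in>(\<Pi>\<^sub>E j\<in>s. {0..1}). (\<forall>j\<in>s. a j \<le> b j) \<longrightarrow>
        \<nu> (\<Pi>\<^sub>E j\<in>s. {a j<..b j}) = box_increment s g a b)"

text \<open>The generated measure is unique on \<open>sets (face s)\<close>, so the infimum selects its total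
  variation; if there is none, it is the infimum of the empty set, \<open>\<infinity>\<close>.\<close>

definition variation :: "nat set \<Rightarrow> ((nat \<Rightarrow> real) \<Rightarrow> real) \<Rightarrow> ennreal" where
  "variation s g = (INF \<nu> \<in> {\<nu>. generates s g \<nu>}. total_variation (face s) \<nu>)"

definition sectional_variation_norm :: "nat \<Rightarrow> ((nat \<Rightarrow> real) \<Rightarrow> real) \<Rightarrow> ennreal" where
  "sectional_variation_norm d f =
     ennreal \<bar>f (\<lambda>j\<in>{1..d}. 0)\<bar> + (\<Sum>s \<in> Pow {1..d} - {{}}. variation s (sect d s f))"

definition cadlag_class :: "nat \<Rightarrow> real \<Rightarrow> ((nat \<Rightarrow> real) \<Rightarrow> real) set" where
  "cadlag_class d M = {f. cadlag d f \<and> sectional_variation_norm d f \<le> ennreal M}"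

definition ennreal_power :: "ennreal \<Rightarrow> real \<Rightarrow> ennreal" where
  "ennreal_power x p = (if x = \<infinity> then \<infinity> else ennreal (enn2real x powr p))"

definition Lr_norm :: "'a measure \<Rightarrow> real \<Rightarrow> ('a \<Rightarrow> real) \<Rightarrow> ennreal" where
  "Lr_norm P r f = ennreal_power (\<integral>\<^sup>+ x. ennreal (\<bar>f x\<bar> powr r) \<partial>P) (1 / r)"

text \<open>The endpoints of a bracket are measurable, so that the norm of their difference makes sense.
  The bracketing number is \<open>\<infinity>\<close> if no finite family of brackets covers the class.\<close>

definition bracketing_number ::
  "'a measure \<Rightarrow> real \<Rightarrow> real \<Rightarrow> ('a \<Rightarrow> real) set \<Rightarrow> enat" where
  "bracketing_number P r \<epsilon> F = Inf {enat n | n. \<exists>l u :: nat \<Rightarrow> 'a \<Rightarrow> real.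
     (\<forall>i<n. l i \<in> borel_measurable P \<and> u i \<in> borel_measurable P \<and>
        (\<forall>x\<in>space P. l i x \<le> u i x) \<and> Lr_norm P r (\<lambda>x. u i x - l i x) \<le> ennreal \<epsilon>) \<and>
     (\<forall>f\<in>F. \<exists>i<n. \<forall>x\<in>space P. l i x \<le> f x \<and> f x \<le> u i x)}"

definition bracketing_entropy ::
  "'a measure \<Rightarrow> real \<Rightarrow> real \<Rightarrow> ('a \<Rightarrow> real) set \<Rightarrow> ennreal" where
  "bracketing_entropy P r \<epsilon> F =
     (case bracketing_number P r \<epsilon> F of enat n \<Rightarrow> ennreal (ln (real n)) | \<infinity> \<Rightarrow> \<infinity>)"

definition bracketing_integral ::
  "'a measure \<Rightarrow> real \<Rightarrow> real \<Rightarrow> ('a \<Rightarrow> real) set \<Rightarrow> ennreal" where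
  "bracketing_integral P r \<delta> F =
     (\<integral>\<^sup>+ \<epsilon>\<in>{0<..\<delta>}. ennreal_power (bracketing_entropy P r \<epsilon> F) (1 / 2) \<partial>lborel)"

end

theory Submission
  imports Defs
begin

text \<open>By inclusion-exclusion over the sections, a function \<open>f\<close> of the class is
  \<open>x \<mapsto> \<nu>\<^sub>1 [0, x] - \<nu>\<^sub>2 [0, x]\<close> for two finitely additive set functions on the cube of mass
  \<open>O(M)\<close>, so it suffices to bracket \<open>x \<mapsto> \<nu> [0, x]\<close> for \<open>\<nu>\<close> of mass at most \<open>1\<close>.

  Binary expansion of the coordinates of \<open>x\<close> splits \<open>[0, x]\<close> into dyadic boxes. The splitting treats
  one coordinate at a time, and is recorded by a word: at each halving one either stays with the
  half that contains the current coordinate of \<open>x\<close>, or takes the half to its left and advances to the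
  next coordinate. There are \<open>O(n ^ (d - 1))\<close> words of length \<open>n\<close>, and each of them gives at most
  \<open>2 ^ n\<close> boxes, which are disjoint. Round the mass of every box of level \<open>n\<close> down to a multiple of
  \<open>t n = 2 powr ((n - k) / (2 * r) - k)\<close>, and do not refine boxes whose rounded mass is \<open>0\<close>. The rounded
  masses determine a bracket. At each level they are nonnegative integer vectors of bounded sum;
  counting these bounds the logarithm of the number of brackets by \<open>O(k ^ (d - 1) * 2 ^ k)\<close>, while the
  \<open>L\<^sup>r\<close> size of a bracket is \<open>O(k ^ (d - 1) / 2 ^ k)\<close>, both sums being dominated by the levels \<open>n\<close>
  near \<open>k\<close>. Choosing \<open>2 ^ k\<close> of order \<open>(M / \<epsilon>) * \<bar>ln (\<epsilon> / M)\<bar> ^ (d - 1)\<close> gives the entropy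
  bound.\<close>

subsection \<open>Counting integer vectors of bounded sum\<close>

text \<open>The obstacle is that \<open>[0, x]\<close> is split into boxes of many shapes, whose
  rounding errors add up. Volume controls them: a word of length \<open>n\<close> fixes a shape of
  volume \<open>1 / 2 ^ n\<close>, and knowing which box of that shape arises confines
  \<open>x\<close> to a set of at most this measure. At most \<open>1 / t n\<close> boxes of one
  word have nonzero rounded mass, so the error made in refining them lives on a set of measure at
  most \<open>1 / (2 ^ n * t n)\<close>. The \<open>L\<^sup>r\<close> norm profits from this small
  support; the supremum norm would not.

  Where the exponent in \<open>t n\<close> comes from: let \<open>n = k + m\<close> and let
  \<open>t n\<close> be \<open>1 / 2 ^ k\<close> times \<open>2 powr (\<beta> * m)\<close>. One word
  of level \<open>n\<close> contributes at most \<open>2 powr ((\<beta> - 1 / r) * m)\<close> times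
  \<open>1 / 2 ^ k\<close> to the size, up to a constant, and \<open>2 powr (- \<beta> * m)\<close>
  times \<open>2 ^ k * (m + 1)\<close> to the entropy. Both decay if
  \<open>0 < \<beta> < 1 / r\<close>, and \<open>\<beta> = 1 / (2 * r)\<close> gives them the same
  rate. Below level \<open>k\<close> the support is bounded by \<open>1\<close>: there the
  decreasing thresholds keep the size small, and the number \<open>2 ^ n\<close> of boxes limits the
  entropy.\<close>

text \<open>Generating function bound: summed over all \<open>h\<close>, \<open>z ^ sum h K\<close>
  gives \<open>1 / (1 - z) ^ card K\<close>, and every counted \<open>h\<close> contributes at least
  \<open>z ^ S\<close>. The induction on \<open>K\<close> does this with finite sums only.\<close>

lemma card_bounded_sum_functions:
  fixes z :: real
  assumes "finite K" and z: "0 < z" "z < 1"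
  shows "finite {h \<in> K \<rightarrow>\<^sub>E (UNIV :: nat set). sum h K \<le> S} \<and>
    real (card {h \<in> K \<rightarrow>\<^sub>E (UNIV :: nat set). sum h K \<le> S}) * z ^ S * (1 - z) ^ card K \<le> 1"
  using assms(1)
proof (induction K arbitrary: S rule: finite_induct)
  case empty
  have "{h \<in> {} \<rightarrow>\<^sub>E (UNIV :: nat set). sum h {} \<le> S} = {\<lambda>_. undefined}" by auto
  then show ?case using z by (simp add: power_le_one)
next
  case (insert a K)
  let ?H = "\<lambda>K S. {h \<in> K \<rightarrow>\<^sub>E (UNIV :: nat set). sum h K \<le> S}"
  let ?U = "\<Union>i\<le>S. (\<lambda>h. h(a := i)) ` ?H K (S - i)"
  have sub: "?H (insert a K) S \<subseteq> ?U"
  proof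
    fix h assume "h \<in> ?H (insert a K) S"
    then have h: "h \<in> insert a K \<rightarrow>\<^sub>E UNIV" "h a + sum h K \<le> S" using insert by auto
    have s: "sum (h(a := undefined)) K = sum h K" using insert by (intro sum.cong) auto
    have hK: "h(a := undefined) \<in> ?H K (S - h a)"
      using h insert s by (auto simp: PiE_def extensional_def)
    have "h \<in> (\<lambda>g. g(a := h a)) ` ?H K (S - h a)"
      by (rule image_eqI[OF _ hK]) simp
    then show "h \<in> ?U" using h by (intro UN_I[of "h a"]) auto
  qed
  have finU: "finite ?U" using insert.IH by auto
  have "card (?H (insert a K) S) \<le> card ?U" by (rule card_mono[OF finU sub])
  also have "\<dots> \<le> (\<Sum>i\<le>S. card ((\<lambda>h. h(a := i)) ` ?H K (S - i)))" by (rule card_UN_le) simp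
  also have "\<dots> \<le> (\<Sum>i\<le>S. card (?H K (S - i)))"
    by (intro sum_mono card_image_le) (use insert.IH in auto)
  finally have "real (card (?H (insert a K) S)) \<le> (\<Sum>i\<le>S. real (card (?H K (S - i))))"
    unfolding of_nat_sum[symmetric] of_nat_le_iff .
  then have "real (card (?H (insert a K) S)) * (z ^ S * (1 - z) ^ card (insert a K))
      \<le> (\<Sum>i\<le>S. real (card (?H K (S - i)))) * (z ^ S * (1 - z) ^ card (insert a K))"
    using z by (intro mult_right_mono) auto
  also have "\<dots> = (\<Sum>i\<le>S. (real (card (?H K (S - i))) * z ^ (S - i) * (1 - z) ^ card K) * (z ^ i * (1 - z)))"
    unfolding sum_distrib_right
    by (intro sum.cong refl) (use insert in \<open>simp add: power_add[symmetric] mult_ac\<close>)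
  also have "\<dots> \<le> (\<Sum>i\<le>S. 1 * (z ^ i * (1 - z)))"
    by (intro sum_mono mult_right_mono) (use insert.IH z in auto)
  also have "\<dots> = 1 - z ^ Suc S"
    using z by (simp add: sum_distrib_right[symmetric] sum_gp0 del: power_Suc)
  also have "\<dots> \<le> 1" using z by simp
  finally show ?case using finite_subset[OF sub finU] by (simp add: mult.assoc)
qed

text \<open>The weight \<open>z = \<sigma> / (\<sigma> + N)\<close> minimises
  \<open>z powr (- \<sigma>) * (1 - z) powr (- N)\<close>. A positive real \<open>\<sigma>\<close>
  replaces \<open>S\<close>, which may be \<open>0\<close> and would then force
  \<open>z = 0\<close>.\<close>

lemma ln_card_bounded_sum_functions:
  fixes \<sigma> :: real and S N :: nat
  assumes K: "finite K" "card K \<le> N" and N: "0 < N" and \<sigma>: "real S \<le> \<sigma>" "0 < \<sigma>"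
  shows "ln (real (card {h \<in> K \<rightarrow>\<^sub>E (UNIV :: nat set). sum h K \<le> S}))
    \<le> \<sigma> * ln (1 + N / \<sigma>) + N * ln (1 + \<sigma> / N)"
proof -
  let ?c = "real (card {h \<in> K \<rightarrow>\<^sub>E (UNIV :: nat set). sum h K \<le> S})"
  define z where "z = \<sigma> / (\<sigma> + N)"
  have z: "0 < z" "z < 1" using N \<sigma> by (auto simp: z_def field_simps)
  have fin: "finite {h \<in> K \<rightarrow>\<^sub>E (UNIV :: nat set). sum h K \<le> S}" and
    le: "?c * z ^ S * (1 - z) ^ card K \<le> 1"
    using card_bounded_sum_functions[OF K(1) z, of S] by auto
  have "(\<lambda>x\<in>K. 0) \<in> {h \<in> K \<rightarrow>\<^sub>E (UNIV :: nat set). sum h K \<le> S}" by auto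
  then have c: "?c > 0" using fin by (metis card_gt_0_iff empty_iff of_nat_0_less_iff)
  have "ln (?c * z ^ S * (1 - z) ^ card K) \<le> 0" using le c z by simp
  then have "ln ?c \<le> S * ln (1 / z) + card K * ln (1 / (1 - z))"
    using c z by (simp add: ln_mult ln_realpow ln_div)
  also have "\<dots> \<le> \<sigma> * ln (1 / z) + N * ln (1 / (1 - z))"
    using z K \<sigma> by (intro add_mono mult_right_mono) auto
  also have "1 / z = 1 + N / \<sigma>" using N \<sigma> by (simp add: z_def field_simps)
  also have "1 / (1 - z) = 1 + \<sigma> / N" using N \<sigma> by (simp add: z_def field_simps)
  finally show ?thesis .
qed

subsection \<open>Dyadic cells\<close>

text \<open>The minimum puts the point \<open>1\<close> into the last of the \<open>2 ^ m\<close> intervals.\<close>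

definition dyadic_index :: "nat \<Rightarrow> real \<Rightarrow> nat" where
  "dyadic_index m y = min (nat \<lfloor>2 ^ m * y\<rfloor>) (2 ^ m - 1)"

lemma dyadic_index_0 [simp]: "dyadic_index 0 y = 0"
  by (simp add: dyadic_index_def)

lemma dyadic_index_less: "dyadic_index m y < 2 ^ m"
proof -
  have "dyadic_index m y \<le> 2 ^ m - 1" by (simp add: dyadic_index_def)
  also have "\<dots> < 2 ^ m" by simp
  finally show ?thesis .
qed

lemma dyadic_index_Suc_div2: "dyadic_index (Suc m) y div 2 = dyadic_index m y"
proof -
  have "nat \<lfloor>2 ^ Suc m * y\<rfloor> div 2 = nat \<lfloor>2 ^ m * y\<rfloor>"
  proof -
    have "\<lfloor>2 ^ Suc m * y\<rfloor> div 2 = \<lfloor>2 ^ m * y\<rfloor>"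
      using floor_divide_real_eq_div[of 2 "2 ^ Suc m * y"] by simp
    then show ?thesis using nat_div_distrib'[of 2 "\<lfloor>2 ^ Suc m * y\<rfloor>"] by simp
  qed
  moreover have half: "(2 * k - 1) div 2 = k - 1" for k :: nat by arith
  \<comment> \<open>The last index of one level is halved to the last index of the level before, so
    the cap at the point \<open>1\<close> is compatible with refinement.\<close>
  have "(2 ^ Suc m - 1) div 2 = (2 ^ m - 1 :: nat)"
    using half[of "2 ^ m"] by simp
  moreover have "min a b div 2 = min (a div 2) (b div 2)" for a b :: nat
    by (auto simp: min_def div_le_mono)
  ultimately show ?thesis by (simp add: dyadic_index_def del: power_Suc)
qed

lemma dyadic_index_mono: "x \<le> y \<Longrightarrow> dyadic_index m x \<le> dyadic_index m y"
  unfolding dyadic_index_def by (intro min.mono nat_mono floor_mono mult_left_mono) auto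

lemma dyadic_index_measurable [measurable]: "dyadic_index m \<in> borel \<rightarrow>\<^sub>M count_space UNIV"
  unfolding dyadic_index_def by measurable

lemma dyadic_index_bounds:
  assumes "0 \<le> y" "y \<le> 1"
  shows "real (dyadic_index m y) / 2 ^ m \<le> y" "y \<le> (real (dyadic_index m y) + 1) / 2 ^ m"
proof -
  have lo: "real (nat \<lfloor>2 ^ m * y\<rfloor>) \<le> 2 ^ m * y" using assms by simp
  have "real (dyadic_index m y) \<le> real (nat \<lfloor>2 ^ m * y\<rfloor>)" by (simp add: dyadic_index_def)
  with lo have "real (dyadic_index m y) \<le> 2 ^ m * y" by linarith
  then show "real (dyadic_index m y) / 2 ^ m \<le> y" by (simp add: field_simps)
  have "2 ^ m * y \<le> real (dyadic_index m y) + 1"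
  proof (cases "nat \<lfloor>2 ^ m * y\<rfloor> \<le> 2 ^ m - 1")
    case True
    have "2 ^ m * y \<le> real (nat \<lfloor>2 ^ m * y\<rfloor>) + 1" using assms by simp
    then show ?thesis using True by (simp add: dyadic_index_def min_def)
  next
    case False
    have "2 ^ m * y \<le> 2 ^ m" using assms by simp
    moreover have "real (2 ^ m - 1 :: nat) = 2 ^ m - 1" by (simp add: of_nat_diff)
    ultimately show ?thesis using False by (simp add: dyadic_index_def min_def)
  qed
  then show "y \<le> (real (dyadic_index m y) + 1) / 2 ^ m" by (simp add: field_simps)
qed

text \<open>Words are lists with the most recent letter first, and \<open>True\<close> stands for an advance to
  the next coordinate. \<open>active w\<close> is the coordinate that is halved next, and \<open>depth w j\<close> counts the
  halvings of coordinate \<open>j\<close>. A word is complete once \<open>active w = d + 1\<close>.\<close>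

primrec active :: "bool list \<Rightarrow> nat" where
  "active [] = 1"
| "active (b # w) = (if b then Suc (active w) else active w)"

primrec depth :: "bool list \<Rightarrow> nat \<Rightarrow> nat" where
  "depth [] = (\<lambda>_. 0)"
| "depth (b # w) = (depth w)(active w := Suc (depth w (active w)))"

text \<open>At a \<open>True\<close> letter the earlier halvings have put \<open>y j\<close> and
  \<open>x j\<close> into the same interval, so a strictly smaller index means the left half. The
  cell is empty if \<open>x j\<close> lies in the left half itself.\<close>

primrec cell :: "nat \<Rightarrow> bool list \<Rightarrow> (nat \<Rightarrow> real) \<Rightarrow> (nat \<Rightarrow> real) set" where
  "cell d [] x = unit_cube d"
| "cell d (b # w) x = {y \<in> cell d w x.
     let j = active w; m = Suc (depth w j) in
       if b then dyadic_index m (y j) < dyadic_index m (x j) else dyadic_index m (y j) = dyadic_index m (x j)}"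

text \<open>This is all that the splitting along \<open>w\<close> reads of \<open>x\<close>: it
  determines the cell, and distinct keys have disjoint cells.\<close>

definition key :: "nat \<Rightarrow> bool list \<Rightarrow> (nat \<Rightarrow> real) \<Rightarrow> nat \<Rightarrow> nat" where
  "key d w x = (\<lambda>j\<in>{1..d}. dyadic_index (depth w j) (x j))"

definition partial_words :: "nat \<Rightarrow> nat \<Rightarrow> bool list set" where
  "partial_words d n = {w. length w = n \<and> active w \<le> d}"

text \<open>The condition is on \<open>tl w\<close> because the most recent letter may complete the
  word; a complete word is not extended further.\<close>

definition words :: "nat \<Rightarrow> nat \<Rightarrow> bool list set" where
  "words d n = {w. length w = n \<and> active (tl w) \<le> d}"

definition lower_box :: "nat \<Rightarrow> (nat \<Rightarrow> real) \<Rightarrow> (nat \<Rightarrow> real) set" where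
  "lower_box d x = {y \<in> unit_cube d. \<forall>j\<in>{1..d}. y j \<le> x j}"

lemma active_pos: "1 \<le> active w"
  by (induction w) auto

lemma depth_above: "active w < j \<Longrightarrow> depth w j = 0"
  by (induction w) (auto split: if_splits)

lemma active_tl_le: "active w \<le> d \<Longrightarrow> active (tl w) \<le> d"
  by (cases w) (auto split: if_splits)

lemma partial_words_subset: "partial_words d n \<subseteq> words d n"
  using active_tl_le by (auto simp: partial_words_def words_def)

lemma words_Suc: "words d (Suc n) = (\<lambda>(b, w). b # w) ` (UNIV \<times> partial_words d n)"
  by (auto simp: words_def partial_words_def length_Suc_conv image_iff)

lemma finite_words: "finite (words d n)"
  by (rule finite_subset[OF _ finite_lists_length_eq[of UNIV n]]) (auto simp: words_def)

lemma finite_partial_words: "finite (partial_words d n)"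
  using finite_subset[OF partial_words_subset finite_words] .

lemma sum_words_Suc:
  "(\<Sum>w\<in>words d (Suc n). h w) = (\<Sum>w\<in>partial_words d n. h (False # w) + h (True # w))"
proof -
  have "(\<Sum>w\<in>words d (Suc n). h w) = (\<Sum>(b, w)\<in>UNIV \<times> partial_words d n. h (b # w))"
    unfolding words_Suc by (subst sum.reindex) (auto simp: inj_on_def case_prod_beta)
  also have "\<dots> = (\<Sum>b\<in>UNIV. \<Sum>w\<in>partial_words d n. h (b # w))"
    by (simp add: sum.cartesian_product)
  finally show ?thesis by (simp add: UNIV_bool sum.distrib)
qed

text \<open>The induction removes the oldest letter, which is the last one of the list: if it is
  an advance, one coordinate fewer remains.\<close>

lemma card_partial_words_le: "card (partial_words (Suc d) n) \<le> (n + 1) ^ d"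
proof (induction n arbitrary: d)
  case 0
  have "partial_words (Suc d) 0 = {[]}" by (auto simp: partial_words_def)
  then show ?case by simp
next
  case (Suc n)
  have act: "active (w @ [True]) = Suc (active w)" "active (w @ [False]) = active w" for w
    by (induction w) auto
  show ?case
  proof (cases d)
    case 0
    have rep: "active w \<le> 1 \<Longrightarrow> w = replicate (length w) False" for w
    proof (induction w)
      case (Cons b w)
      then show ?case using active_pos[of w] by (cases b) (auto simp: le_Suc_eq)
    qed simp
    have "partial_words (Suc 0) (Suc n) \<subseteq> {replicate (Suc n) False}"
      using rep by (force simp: partial_words_def)
    from card_mono[OF _ this] have "card (partial_words (Suc 0) (Suc n)) \<le> 1" by simp
    then show ?thesis using 0 by simp
  next
    case (Suc e)
    have "partial_words (Suc d) (Suc n) \<subseteq> (\<lambda>w. w @ [False]) ` partial_words (Suc d) n \<union> (\<lambda>w. w @ [True]) ` partial_words (Suc e) n"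
    proof
      fix w assume w: "w \<in> partial_words (Suc d) (Suc n)"
      then obtain v b where v: "w = v @ [b]" by (cases w rule: rev_cases) (auto simp: partial_words_def)
      show "w \<in> (\<lambda>w. w @ [False]) ` partial_words (Suc d) n \<union> (\<lambda>w. w @ [True]) ` partial_words (Suc e) n"
        using w v act Suc by (cases b) (auto simp: partial_words_def)
    qed
    then have "card (partial_words (Suc d) (Suc n)) \<le> card ((\<lambda>w. w @ [False]) ` partial_words (Suc d) n \<union> (\<lambda>w. w @ [True]) ` partial_words (Suc e) n)"
      by (intro card_mono) (auto simp: finite_partial_words)
    also have "\<dots> \<le> card ((\<lambda>w. w @ [False]) ` partial_words (Suc d) n) + card ((\<lambda>w. w @ [True]) ` partial_words (Suc e) n)"
      by (rule card_Un_le)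
    also have "\<dots> \<le> card (partial_words (Suc d) n) + card (partial_words (Suc e) n)"
      by (intro add_mono card_image_le finite_partial_words)
    also have "\<dots> \<le> (n + 1) ^ d + (n + 1) ^ e" using Suc.IH by (intro add_mono) auto
    also have "\<dots> = (n + 1) ^ e * (n + 2)" using Suc by simp
    also have "\<dots> \<le> (n + 2) ^ e * (n + 2)" by (intro mult_right_mono power_mono) auto
    finally show ?thesis using Suc by (simp add: mult.commute)
  qed
qed

lemma card_words_le: "card (words (Suc d) n) \<le> 2 * (n + 1) ^ d"
proof (cases n)
  case 0
  have "words (Suc d) 0 = {[]}" by (auto simp: words_def)
  then show ?thesis using 0 by simp
next
  case (Suc m)
  have "card (words (Suc d) n) \<le> card ((UNIV :: bool set) \<times> partial_words (Suc d) m)"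
    unfolding Suc words_Suc by (rule card_image_le) (simp add: finite_partial_words)
  also have "\<dots> = 2 * card (partial_words (Suc d) m)" by (simp add: card_cartesian_product)
  also have "\<dots> \<le> 2 * (m + 1) ^ d" using card_partial_words_le[of d m] by simp
  also have "\<dots> \<le> 2 * (n + 1) ^ d" using Suc by (simp add: power_mono)
  finally show ?thesis .
qed

lemma sum_depth:
  assumes "w \<in> words d n"
  shows "(\<Sum>j\<in>{1..d}. depth w j) = n"
proof -
  have "active (tl w) \<le> d \<Longrightarrow> (\<Sum>j\<in>{1..d}. depth w j) = length w"
  proof (induction w)
    case (Cons b w)
    have "active w \<in> {1..d}" using Cons.prems active_pos by simp
    then have "(\<Sum>j\<in>{1..d}. depth (b # w) j) = Suc (\<Sum>j\<in>{1..d}. depth w j)"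
      by (subst (1 2) sum.remove[of _ "active w"]) auto
    moreover have "active (tl w) \<le> d" using Cons.prems active_tl_le by simp
    ultimately show ?case using Cons.IH by simp
  qed simp
  then show ?thesis using assms by (auto simp: words_def)
qed

lemma key_in: "key d w x \<in> (\<Pi>\<^sub>E j\<in>{1..d}. {..<2 ^ depth w j})"
  by (auto simp: key_def dyadic_index_less)

lemma card_keys:
  assumes "w \<in> words d n"
  shows "card (\<Pi>\<^sub>E j\<in>{1..d}. {..<2 ^ depth w j :: nat}) = 2 ^ n"
  using sum_depth[OF assms] by (simp add: card_PiE power_sum[symmetric])

lemma key_tl:
  assumes "key d (b # w) x = key d (b # w) x'"
  shows "key d w x = key d w x'"
proof -
  have "dyadic_index (depth w j) (x j) = dyadic_index (depth w j) (x' j)" if "j \<in> {1..d}" for j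
  proof -
    have "dyadic_index (depth (b # w) j) (x j) = dyadic_index (depth (b # w) j) (x' j)"
      using fun_cong[OF assms, of j] that by (simp add: key_def)
    then show ?thesis
      using dyadic_index_Suc_div2[of "depth w j" "x j"] dyadic_index_Suc_div2[of "depth w j" "x' j"]
      by (auto split: if_splits)
  qed
  then show ?thesis by (auto simp: key_def)
qed

lemma cell_key_cong:
  assumes "active (tl w) \<le> d" "key d w x = key d w x'"
  shows "cell d w x = cell d w x'"
  using assms
proof (induction w)
  case (Cons b w)
  have "active w \<in> {1..d}" using Cons.prems active_pos by simp
  then have "dyadic_index (Suc (depth w (active w))) (x (active w)) = dyadic_index (Suc (depth w (active w))) (x' (active w))"
    using fun_cong[OF Cons.prems(2), of "active w"] by (auto simp: key_def)
  moreover have "cell d w x = cell d w x'"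
    using Cons.IH key_tl[OF Cons.prems(2)] active_tl_le[of w d] Cons.prems(1) by simp
  ultimately show ?case by (simp add: Let_def)
qed simp

lemma cell_subset: "cell d w x \<subseteq> unit_cube d"
  by (induction w) auto

text \<open>The active coordinate has so far only been narrowed to the half that contains
  \<open>x\<close>, and the later ones have not been halved at all.\<close>

lemma cell_dyadic_index_active:
  assumes "y \<in> cell d w x" "active w \<le> j"
  shows "dyadic_index (depth w j) (y j) = dyadic_index (depth w j) (x j)"
  using assms
proof (induction w)
  case (Cons b w)
  show ?case
  proof (cases b)
    case True
    then show ?thesis using Cons depth_above[of w j] by (auto simp: Let_def)
  next
    case False
    then show ?thesis using Cons by (auto simp: Let_def)
  qed
qed simp

text \<open>One point of a cell recovers the key. At a \<open>True\<close> letter the indices of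
  \<open>y\<close> and \<open>x\<close> have the same half and that of \<open>y\<close> is smaller,
  so the index of \<open>x\<close> is the successor of that of \<open>y\<close>.\<close>

lemma cell_disjoint:
  assumes "y \<in> cell d w x" "y \<in> cell d w x'"
  shows "key d w x = key d w x'"
  using assms
proof (induction w)
  case (Cons b w)
  let ?j = "active w" and ?m = "depth w (active w)"
  have "dyadic_index (Suc ?m) (x ?j) = dyadic_index (Suc ?m) (x' ?j)"
  proof (cases b)
    case True
    have "dyadic_index ?m (y ?j) = dyadic_index ?m (x ?j)" "dyadic_index ?m (y ?j) = dyadic_index ?m (x' ?j)"
      using Cons.prems cell_dyadic_index_active[of y d w _ "active w"] by (simp_all add: Let_def)
    then have "dyadic_index (Suc ?m) (y ?j) div 2 = dyadic_index (Suc ?m) (x ?j) div 2" "dyadic_index (Suc ?m) (y ?j) div 2 = dyadic_index (Suc ?m) (x' ?j) div 2"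
      by (simp_all add: dyadic_index_Suc_div2)
    moreover have "dyadic_index (Suc ?m) (y ?j) < dyadic_index (Suc ?m) (x ?j)" "dyadic_index (Suc ?m) (y ?j) < dyadic_index (Suc ?m) (x' ?j)"
      using Cons.prems True by (auto simp: Let_def)
    ultimately show ?thesis by linarith
  next
    case False
    then show ?thesis using Cons.prems by (auto simp: Let_def)
  qed
  moreover have eq: "key d w x = key d w x'" using Cons by (auto simp: Let_def)
  have "dyadic_index (depth w j) (x j) = dyadic_index (depth w j) (x' j)" if "j \<in> {1..d}" for j
    using fun_cong[OF eq, of j] that by (simp add: key_def)
  ultimately show ?case by (auto simp: key_def)
qed (simp add: key_def)

lemma cell_Cons_lower_box:
  assumes "active w \<le> d"
  shows "cell d w x \<inter> lower_box d x =
      (cell d (False # w) x \<inter> lower_box d x) \<union> (cell d (True # w) x \<inter> lower_box d x)"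
    "(cell d (False # w) x \<inter> lower_box d x) \<inter> (cell d (True # w) x \<inter> lower_box d x) = {}"
proof -
  have "dyadic_index m (y (active w)) \<le> dyadic_index m (x (active w))" if "y \<in> lower_box d x" for m y
    using that assms active_pos[of w] by (intro dyadic_index_mono) (auto simp: lower_box_def)
  then show "cell d w x \<inter> lower_box d x =
      (cell d (False # w) x \<inter> lower_box d x) \<union> (cell d (True # w) x \<inter> lower_box d x)"
    by (auto simp: Let_def le_less)
qed (auto simp: Let_def)

lemma cell_below_active:
  assumes "y \<in> cell d w x" "1 \<le> j" "j < active w"
  shows "y j \<le> x j"
  using assms
proof (induction w)
  case (Cons b w)
  show ?case
  proof (cases "j < active w")
    case False
    then have "b" "j = active w" using Cons.prems by (auto split: if_splits)
    then have "dyadic_index (Suc (depth w j)) (y j) < dyadic_index (Suc (depth w j)) (x j)"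
      using Cons.prems by (auto simp: Let_def)
    then show ?thesis using dyadic_index_mono[of "x j" "y j" "Suc (depth w j)"] by linarith
  qed (use Cons in \<open>auto simp: Let_def\<close>)
qed simp

lemma cell_complete_subset:
  assumes "d < active w"
  shows "cell d w x \<subseteq> lower_box d x"
  using cell_subset cell_below_active assms by (fastforce simp: lower_box_def)

section \<open>Measurability and volume of the dyadic cells\<close>

lemma space_lebesgue_cube: "space (lebesgue_cube d) = unit_cube d"
  by (simp add: lebesgue_cube_def unit_cube_def space_PiM space_restrict_space)

lemma coordinate_measurable:
  assumes "j \<in> {1..d}"
  shows "(\<lambda>x. x j) \<in> borel_measurable (lebesgue_cube d)"
proof -
  have "(\<lambda>x. x j) \<in> lebesgue_cube d \<rightarrow>\<^sub>M restrict_space lborel {0..1}"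
    unfolding lebesgue_cube_def using assms by (rule measurable_component_singleton)
  then have "(\<lambda>x. x j) \<in> lebesgue_cube d \<rightarrow>\<^sub>M lborel"
    by (simp add: measurable_restrict_space2_iff)
  then show ?thesis by simp
qed

lemma lower_box_sets: "lower_box d x \<in> sets (lebesgue_cube d)"
proof -
  have [measurable]: "(\<lambda>y. y j) \<in> borel_measurable (lebesgue_cube d)" if "j \<in> {1..d}" for j
    using that by (rule coordinate_measurable)
  show ?thesis unfolding lower_box_def space_lebesgue_cube[symmetric] by measurable
qed

lemma cell_sets:
  assumes "active (tl w) \<le> d"
  shows "cell d w x \<in> sets (lebesgue_cube d)"
  using assms
proof (induction w)
  case Nil
  then show ?case using sets.top[of "lebesgue_cube d"] by (simp add: space_lebesgue_cube)
next
  case (Cons b w)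
  let ?M = "lebesgue_cube d"
  have j: "active w \<in> {1..d}" using Cons.prems active_pos by simp
  have [measurable]: "(\<lambda>y. y (active w)) \<in> borel_measurable ?M" by (rule coordinate_measurable[OF j])
  have "{y \<in> space ?M. if b then dyadic_index m (y (active w)) < c else dyadic_index m (y (active w)) = c} \<in> sets ?M" for m c
    by measurable
  moreover have "cell d w x \<in> sets ?M" using Cons active_tl_le by simp
  moreover have "cell d (b # w) x = cell d w x \<inter> {y \<in> space ?M.
      if b then dyadic_index (Suc (depth w (active w))) (y (active w)) < dyadic_index (Suc (depth w (active w))) (x (active w))
      else dyadic_index (Suc (depth w (active w))) (y (active w)) = dyadic_index (Suc (depth w (active w))) (x (active w))}"
    using cell_subset[of d w x] by (auto simp: Let_def space_lebesgue_cube)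
  ultimately show ?case by (simp only: sets.Int)
qed

lemma key_fiber_sets: "{x \<in> unit_cube d. key d w x = \<kappa>} \<in> sets (lebesgue_cube d)"
proof (cases "\<kappa> \<in> extensional {1..d}")
  case True
  have [measurable]: "(\<lambda>y. y j) \<in> borel_measurable (lebesgue_cube d)" if "j \<in> {1..d}" for j
    using that by (rule coordinate_measurable)
  have "{x \<in> space (lebesgue_cube d). \<forall>j\<in>{1..d}. dyadic_index (depth w j) (x j) = \<kappa> j} \<in> sets (lebesgue_cube d)"
    by measurable
  also have "{x \<in> space (lebesgue_cube d). \<forall>j\<in>{1..d}. dyadic_index (depth w j) (x j) = \<kappa> j}
      = {x \<in> unit_cube d. key d w x = \<kappa>}"
    using True by (auto simp: key_def space_lebesgue_cube extensional_def)
  finally show ?thesis .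
next
  case False
  then have "{x \<in> unit_cube d. key d w x = \<kappa>} = {}" by (auto simp: key_def)
  then show ?thesis by (metis sets.empty_sets)
qed

text \<open>The fibre lies in a box with sides \<open>1 / 2 ^ depth w j\<close>, and the depths add
  up to \<open>n\<close> for every shape. Closed intervals are used because the last one of a level
  contains the point \<open>1\<close>.\<close>

lemma emeasure_key_fiber_le:
  assumes "w \<in> words d n"
  shows "emeasure (lebesgue_cube d) {x \<in> unit_cube d. key d w x = \<kappa>} \<le> ennreal ((1 / 2) ^ n)"
proof -
  let ?L = "restrict_space lborel {0..1} :: real measure"
  have prob: "prob_space ?L"
    by (rule prob_spaceI) (simp add: space_restrict_space emeasure_restrict_space)
  interpret product_sigma_finite "\<lambda>_::nat. ?L"
    unfolding product_sigma_finite_def using prob_space_imp_sigma_finite[OF prob] by simp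
  let ?I = "\<lambda>j. {real (\<kappa> j) / 2 ^ depth w j .. (real (\<kappa> j) + 1) / 2 ^ depth w j} \<inter> {0..1}"
  have I: "?I j \<in> sets ?L" for j by (subst sets_restrict_space_iff) auto
  have sub: "{x \<in> unit_cube d. key d w x = \<kappa>} \<subseteq> (\<Pi>\<^sub>E j\<in>{1..d}. ?I j)"
  proof
    fix x assume x: "x \<in> {x \<in> unit_cube d. key d w x = \<kappa>}"
    show "x \<in> (\<Pi>\<^sub>E j\<in>{1..d}. ?I j)"
    proof (rule PiE_I)
      fix j assume j: "j \<in> {1..d}"
      have "dyadic_index (depth w j) (x j) = \<kappa> j" using x j by (auto simp: key_def)
      moreover have "0 \<le> x j" "x j \<le> 1" using x j by (auto simp: unit_cube_def)
      ultimately show "x j \<in> ?I j" using dyadic_index_bounds[of "x j" "depth w j"] by simp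
    qed (use x in \<open>auto simp: unit_cube_def\<close>)
  qed
  have box: "(\<Pi>\<^sub>E j\<in>{1..d}. ?I j) \<in> sets (\<Pi>\<^sub>M j\<in>{1..d}. ?L)"
    by (rule sets_PiM_I_finite[OF _ I]) simp
  have "emeasure (lebesgue_cube d) {x \<in> unit_cube d. key d w x = \<kappa>} \<le> emeasure (lebesgue_cube d) (\<Pi>\<^sub>E j\<in>{1..d}. ?I j)"
    using emeasure_mono[OF sub box] by (simp only: lebesgue_cube_def)
  also have "\<dots> = (\<Prod>j\<in>{1..d}. emeasure ?L (?I j))"
    unfolding lebesgue_cube_def by (rule emeasure_PiM[OF _ I]) simp
  also have "\<dots> \<le> (\<Prod>j\<in>{1..d}. ennreal ((1 / 2) ^ depth w j))"
  proof (intro prod_mono_ennreal)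
    fix j
    have "emeasure ?L (?I j) = emeasure lborel (?I j)" by (intro emeasure_restrict_space) auto
    also have "\<dots> \<le> emeasure lborel {real (\<kappa> j) / 2 ^ depth w j .. (real (\<kappa> j) + 1) / 2 ^ depth w j}"
      by (intro emeasure_mono) auto
    also have "\<dots> = ennreal ((1 / 2) ^ depth w j)"
      by (simp add: divide_right_mono add_divide_distrib power_divide)
    finally show "emeasure ?L (?I j) \<le> ennreal ((1 / 2) ^ depth w j)" .
  qed
  also have "\<dots> = ennreal (\<Prod>j\<in>{1..d}. (1 / 2) ^ depth w j)" by (rule prod_ennreal) auto
  also have "(\<Prod>j\<in>{1..d}. (1 / 2) ^ depth w j :: real) = (1 / 2) ^ n"
    using sum_depth[OF assms] by (simp add: power_sum[symmetric])
  finally show ?thesis .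
qed

subsection \<open>Brackets from rounded masses\<close>

definition subprob_content :: "nat \<Rightarrow> ((nat \<Rightarrow> real) set \<Rightarrow> real) \<Rightarrow> bool" where
  "subprob_content d \<nu> \<longleftrightarrow> (\<forall>A\<in>sets (lebesgue_cube d). 0 \<le> \<nu> A) \<and>
     (\<forall>A\<in>sets (lebesgue_cube d). \<forall>B\<in>sets (lebesgue_cube d). A \<inter> B = {} \<longrightarrow> \<nu> (A \<union> B) = \<nu> A + \<nu> B) \<and>
     \<nu> (unit_cube d) \<le> 1"

context
  fixes d :: nat and \<nu> :: "(nat \<Rightarrow> real) set \<Rightarrow> real"
  assumes content: "subprob_content d \<nu>"
begin

lemma content_nonneg: "A \<in> sets (lebesgue_cube d) \<Longrightarrow> 0 \<le> \<nu> A"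
  using content by (simp add: subprob_content_def)

lemma content_Un: "A \<in> sets (lebesgue_cube d) \<Longrightarrow> B \<in> sets (lebesgue_cube d) \<Longrightarrow> A \<inter> B = {} \<Longrightarrow>
    \<nu> (A \<union> B) = \<nu> A + \<nu> B"
  using content by (simp add: subprob_content_def)

lemma content_empty: "\<nu> {} = 0"
  using content_Un[of "{}" "{}"] by simp

lemma content_mono:
  assumes "A \<in> sets (lebesgue_cube d)" "B \<in> sets (lebesgue_cube d)" "A \<subseteq> B"
  shows "\<nu> A \<le> \<nu> B"
proof -
  have "\<nu> (A \<union> (B - A)) = \<nu> A + \<nu> (B - A)" using assms by (intro content_Un) auto
  moreover have "0 \<le> \<nu> (B - A)" using assms by (intro content_nonneg) auto
  moreover have "A \<union> (B - A) = B" using assms(3) by auto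
  ultimately show ?thesis by simp
qed

lemma content_le_1:
  assumes "A \<in> sets (lebesgue_cube d)"
  shows "\<nu> A \<le> 1"
proof -
  have "\<nu> A \<le> \<nu> (unit_cube d)"
    using assms sets.sets_into_space[OF assms] sets.top[of "lebesgue_cube d"]
    by (intro content_mono) (auto simp: space_lebesgue_cube)
  then show ?thesis using content by (simp add: subprob_content_def)
qed

lemma content_sum_disjoint:
  assumes "finite I" "\<And>i. i \<in> I \<Longrightarrow> A i \<in> sets (lebesgue_cube d)" "disjoint_family_on A I"
  shows "(\<Sum>i\<in>I. \<nu> (A i)) = \<nu> (\<Union>i\<in>I. A i)"
  using assms
proof (induction I rule: finite_induct)
  case (insert i I)
  have "\<nu> (A i \<union> (\<Union>i\<in>I. A i)) = \<nu> (A i) + \<nu> (\<Union>i\<in>I. A i)"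
    using insert by (intro content_Un) (auto simp: disjoint_family_on_def)
  then show ?case using insert by (auto simp: disjoint_family_on_def)
qed (simp add: content_empty)

end

definition complete_words :: "nat \<Rightarrow> nat \<Rightarrow> bool list set" where
  "complete_words d n = {w \<in> words d n. d < active w}"

definition keys :: "nat \<Rightarrow> bool list \<Rightarrow> (nat \<Rightarrow> nat) set" where
  "keys d w = (\<Pi>\<^sub>E j\<in>{1..d}. {..<2 ^ depth w j})"

text \<open>All points with the same key have the same cell, so the union merely re-indexes cells by
  keys; it is empty where no point has the key.\<close>

definition key_cell :: "nat \<Rightarrow> bool list \<Rightarrow> (nat \<Rightarrow> nat) \<Rightarrow> (nat \<Rightarrow> real) set" where
  "key_cell d w \<kappa> = (\<Union>x\<in>{x. key d w x = \<kappa>}. cell d w x)"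

lemma finite_keys: "finite (keys d w)"
  unfolding keys_def by (intro finite_PiE) auto

lemma words_split: "words d n = partial_words d n \<union> complete_words d n" "partial_words d n \<inter> complete_words d n = {}"
  using partial_words_subset by (auto simp: complete_words_def partial_words_def words_def)

lemma sum_words_split: "sum h (words d n) = sum h (partial_words d n) + sum h (complete_words d n)"
  using finite_words[of d n] words_split[of d n] by (simp add: sum.union_disjoint)

lemma key_cell_key:
  assumes "active (tl w) \<le> d"
  shows "key_cell d w (key d w x) = cell d w x"
proof -
  have "cell d w x' = cell d w x" if "key d w x' = key d w x" for x'
    using cell_key_cong[OF assms that] .
  then show ?thesis unfolding key_cell_def by blast
qed

lemma key_cell_sets:
  assumes "active (tl w) \<le> d"
  shows "key_cell d w \<kappa> \<in> sets (lebesgue_cube d)"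
proof (cases "\<exists>x. key d w x = \<kappa>")
  case True
  then obtain x where "key d w x = \<kappa>" by blast
  then show ?thesis using key_cell_key[OF assms, of x] cell_sets[OF assms, of x] by simp
qed (simp add: key_cell_def)

lemma key_cell_disjoint: "disjoint_family_on (key_cell d w) K"
  using cell_disjoint unfolding disjoint_family_on_def key_cell_def by blast

definition low :: "nat \<Rightarrow> (nat \<Rightarrow> real) \<Rightarrow> nat \<Rightarrow> (bool list \<Rightarrow> (nat \<Rightarrow> nat) \<Rightarrow> nat) \<Rightarrow> (nat \<Rightarrow> real) \<Rightarrow> real" where
  "low d t N p x = (\<Sum>n\<le>N. \<Sum>w\<in>complete_words d n. t n * real (p w (key d w x)))"

text \<open>The empty word is alive whatever its rounded mass: the whole of \<open>[0, x]\<close> is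
  pending when the upper estimate starts.\<close>

definition alive :: "nat \<Rightarrow> (bool list \<Rightarrow> (nat \<Rightarrow> nat) \<Rightarrow> nat) \<Rightarrow> bool list \<Rightarrow> (nat \<Rightarrow> real) set" where
  "alive d p w = {x \<in> unit_cube d. w = [] \<or> 1 \<le> p w (key d w x)}"

text \<open>Each refined word of length \<open>n\<close> has two children, and each of them loses at
  most \<open>t (Suc n)\<close>: by rounding if it is complete, by being dropped if it is partial
  with rounded mass \<open>0\<close>.\<close>

definition gap :: "nat \<Rightarrow> (nat \<Rightarrow> real) \<Rightarrow> nat \<Rightarrow> (bool list \<Rightarrow> (nat \<Rightarrow> nat) \<Rightarrow> nat) \<Rightarrow> (nat \<Rightarrow> real) \<Rightarrow> real" where
  "gap d t N p x = (\<Sum>n<N. \<Sum>w\<in>partial_words d n. 2 * t (Suc n) * indicator (alive d p w) x)"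

definition profiles :: "nat \<Rightarrow> (nat \<Rightarrow> nat) \<Rightarrow> nat \<Rightarrow> (bool list \<Rightarrow> (nat \<Rightarrow> nat) \<Rightarrow> nat) set" where
  "profiles d S N = (\<Pi>\<^sub>E w\<in>(\<Union>n\<le>N. words d n). {h \<in> keys d w \<rightarrow>\<^sub>E UNIV. sum h (keys d w) \<le> S (length w)})"

context
  fixes d :: nat and \<nu> :: "(nat \<Rightarrow> real) set \<Rightarrow> real" and t :: "nat \<Rightarrow> real"
    and p :: "bool list \<Rightarrow> (nat \<Rightarrow> nat) \<Rightarrow> nat" and x :: "nat \<Rightarrow> real"
  assumes content: "subprob_content d \<nu>" and t: "\<And>n. 0 < t n" and x: "x \<in> unit_cube d"
    and d: "1 \<le> d"
begin

text \<open>Each step splits every partial cell by its two letters. A child that becomes complete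
  lies inside \<open>lower_box d x\<close>, so it enters the first sum with its full mass.\<close>

lemma content_lower_box_eq:
  "\<nu> (lower_box d x) = (\<Sum>n\<le>N. \<Sum>w\<in>complete_words d n. \<nu> (cell d w x))
     + (\<Sum>w\<in>partial_words d N. \<nu> (cell d w x \<inter> lower_box d x))"
proof (induction N)
  case 0
  have "partial_words d 0 = {[]}" "complete_words d 0 = {}" using d by (auto simp: partial_words_def complete_words_def words_def)
  moreover have "unit_cube d \<inter> lower_box d x = lower_box d x" by (auto simp: lower_box_def)
  ultimately show ?case by simp
next
  case (Suc N)
  have "(\<Sum>w\<in>partial_words d N. \<nu> (cell d w x \<inter> lower_box d x)) = (\<Sum>w\<in>words d (Suc N). \<nu> (cell d w x \<inter> lower_box d x))"
    unfolding sum_words_Suc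
  proof (intro sum.cong refl)
    fix w assume "w \<in> partial_words d N"
    then have w: "active w \<le> d" by (simp add: partial_words_def)
    show "\<nu> (cell d w x \<inter> lower_box d x)
        = \<nu> (cell d (False # w) x \<inter> lower_box d x) + \<nu> (cell d (True # w) x \<inter> lower_box d x)"
      unfolding cell_Cons_lower_box(1)[OF w]
      using w by (intro content_Un[OF content] sets.Int cell_sets lower_box_sets cell_Cons_lower_box(2)) auto
  qed
  also have "\<dots> = (\<Sum>w\<in>partial_words d (Suc N). \<nu> (cell d w x \<inter> lower_box d x))
      + (\<Sum>w\<in>complete_words d (Suc N). \<nu> (cell d w x \<inter> lower_box d x))"
    by (rule sum_words_split)
  also have "(\<Sum>w\<in>complete_words d (Suc N). \<nu> (cell d w x \<inter> lower_box d x)) = (\<Sum>w\<in>complete_words d (Suc N). \<nu> (cell d w x))"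
    by (intro sum.cong refl arg_cong[where f = \<nu>]) (use cell_complete_subset in \<open>auto simp: complete_words_def\<close>)
  finally show ?case using Suc.IH by simp
qed

lemma low_le_content:
  assumes p: "\<And>n w. n \<le> N \<Longrightarrow> w \<in> words d n \<Longrightarrow> t n * real (p w (key d w x)) \<le> \<nu> (cell d w x)"
  shows "low d t N p x \<le> \<nu> (lower_box d x)"
proof -
  have "low d t N p x \<le> (\<Sum>n\<le>N. \<Sum>w\<in>complete_words d n. \<nu> (cell d w x))"
    unfolding low_def by (intro sum_mono p) (auto simp: complete_words_def)
  moreover have "0 \<le> (\<Sum>w\<in>partial_words d N. \<nu> (cell d w x \<inter> lower_box d x))"
    using active_tl_le by (intro sum_nonneg content_nonneg[OF content] sets.Int cell_sets lower_box_sets) (auto simp: partial_words_def)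
  ultimately show ?thesis using content_lower_box_eq[of N] by linarith
qed

text \<open>The last sum is the mass still pending at level \<open>N\<close>: partial cells that are
  alive. Going one level deeper either passes mass on, or books it in \<open>low\<close>, or pays
  for it in \<open>gap\<close>.\<close>

lemma content_le_low_gap_aux:
  assumes p: "\<And>n w. n \<le> N \<Longrightarrow> w \<in> words d n \<Longrightarrow> \<nu> (cell d w x) \<le> t n * (real (p w (key d w x)) + 1)"
  shows "\<nu> (lower_box d x) \<le> low d t N p x + gap d t N p x
     + (\<Sum>w\<in>partial_words d N. indicator (alive d p w) x * \<nu> (cell d w x \<inter> lower_box d x))"
  using p
proof (induction N)
  case 0
  have "partial_words d 0 = {[]}" "complete_words d 0 = {}" using d by (auto simp: partial_words_def complete_words_def words_def)
  moreover have "unit_cube d \<inter> lower_box d x = lower_box d x" by (auto simp: lower_box_def)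
  ultimately show ?case using x by (simp add: low_def gap_def alive_def)
next
  case (Suc N)
  \<comment> \<open>\<open>g c\<close> is what survives in the child \<open>c\<close>: its pending
    mass if it is partial and alive, its rounded mass if it is complete.\<close>
  define g where "g c = (if active c \<le> d then indicator (alive d p c) x * \<nu> (cell d c x \<inter> lower_box d x)
    else t (Suc N) * real (p c (key d c x)))" for c
  have child: "\<nu> (cell d c x \<inter> lower_box d x) \<le> t (Suc N) + g c" "0 \<le> g c" if c: "c \<in> words d (Suc N)" for c
  proof -
    have tl: "active (tl c) \<le> d" using c by (simp add: words_def)
    have cQ: "cell d c x \<inter> lower_box d x \<in> sets (lebesgue_cube d)"
      using tl by (intro sets.Int cell_sets lower_box_sets)
    have le: "\<nu> (cell d c x \<inter> lower_box d x) \<le> \<nu> (cell d c x)"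
      by (rule content_mono[OF content cQ cell_sets[OF tl]]) auto
    also have "\<dots> \<le> t (Suc N) * (real (p c (key d c x)) + 1)" by (rule Suc.prems[OF _ c]) simp
    finally have le: "\<nu> (cell d c x \<inter> lower_box d x) \<le> t (Suc N) + t (Suc N) * real (p c (key d c x))"
      by (simp add: algebra_simps)
    have nn: "0 \<le> \<nu> (cell d c x \<inter> lower_box d x)" by (rule content_nonneg[OF content cQ])
    show "\<nu> (cell d c x \<inter> lower_box d x) \<le> t (Suc N) + g c"
    proof (cases "active c \<le> d \<and> x \<in> alive d p c")
      case True
      then show ?thesis using t[of "Suc N"] by (simp add: g_def)
    next
      case False
      then have "p c (key d c x) = 0 \<or> d < active c" using x by (auto simp: alive_def)
      then show ?thesis using le False by (auto simp: g_def)
    qed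
    show "0 \<le> g c" using nn t[of "Suc N"] by (simp add: g_def)
  qed
  have "(\<Sum>w\<in>partial_words d N. indicator (alive d p w) x * \<nu> (cell d w x \<inter> lower_box d x))
      \<le> (\<Sum>w\<in>partial_words d N. 2 * t (Suc N) * indicator (alive d p w) x + (g (False # w) + g (True # w)))"
  proof (intro sum_mono)
    fix w assume w: "w \<in> partial_words d N"
    then have act: "active w \<le> d" by (simp add: partial_words_def)
    have ch: "False # w \<in> words d (Suc N)" "True # w \<in> words d (Suc N)"
      using w by (auto simp: words_def partial_words_def)
    have "\<nu> (cell d w x \<inter> lower_box d x)
        = \<nu> (cell d (False # w) x \<inter> lower_box d x) + \<nu> (cell d (True # w) x \<inter> lower_box d x)"
      unfolding cell_Cons_lower_box(1)[OF act]
      using act by (intro content_Un[OF content] sets.Int cell_sets lower_box_sets cell_Cons_lower_box(2)) auto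
    then show "indicator (alive d p w) x * \<nu> (cell d w x \<inter> lower_box d x)
        \<le> 2 * t (Suc N) * indicator (alive d p w) x + (g (False # w) + g (True # w))"
      using child[OF ch(1)] child[OF ch(2)] by (cases "x \<in> alive d p w") auto
  qed
  also have "\<dots> = (\<Sum>w\<in>partial_words d N. 2 * t (Suc N) * indicator (alive d p w) x) + (\<Sum>w\<in>words d (Suc N). g w)"
    by (simp only: sum.distrib sum_words_Suc)
  also have "(\<Sum>w\<in>words d (Suc N). g w)
      = (\<Sum>w\<in>partial_words d (Suc N). indicator (alive d p w) x * \<nu> (cell d w x \<inter> lower_box d x))
        + (\<Sum>w\<in>complete_words d (Suc N). t (Suc N) * real (p w (key d w x)))"
    unfolding sum_words_split by (intro arg_cong2[where f = "(+)"] sum.cong refl)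
      (auto simp: g_def partial_words_def complete_words_def)
  finally show ?case using Suc.IH Suc.prems by (force simp: low_def gap_def)
qed

end

text \<open>As the total mass is at most \<open>1\<close>, the condition \<open>1 < t N\<close>
  makes every rounded mass of level \<open>N\<close> zero, so nothing is left pending there.
  \<open>1 \<le> N\<close> excludes the empty word, which is alive by convention.\<close>

lemma profile_cover:
  assumes content: "subprob_content d \<nu>" and t: "\<And>n. 0 < t n" and d: "1 \<le> d"
    and N: "1 \<le> N" "1 < t N"
  shows "\<exists>p\<in>profiles d (\<lambda>n. nat \<lfloor>1 / t n\<rfloor>) N. \<forall>x\<in>unit_cube d.
    low d t N p x \<le> \<nu> (lower_box d x) \<and> \<nu> (lower_box d x) \<le> low d t N p x + gap d t N p x"
proof -
  define p where "p = (\<lambda>w\<in>(\<Union>n\<le>N. words d n). \<lambda>\<kappa>\<in>keys d w. nat \<lfloor>\<nu> (key_cell d w \<kappa>) / t (length w)\<rfloor>)"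
  have p: "p w (key d w x) = nat \<lfloor>\<nu> (cell d w x) / t n\<rfloor>" "0 \<le> \<nu> (cell d w x)"
    if "w \<in> words d n" "n \<le> N" for w n x
    using that key_in[of d w x] key_cell_key[of w d x] content_nonneg[OF content cell_sets]
    by (auto simp: p_def keys_def words_def)
  have "sum (p w) (keys d w) \<le> nat \<lfloor>1 / t n\<rfloor>" if w: "w \<in> words d n" "n \<le> N" for w n
  proof -
    have tl: "active (tl w) \<le> d" "length w = n" using w by (auto simp: words_def)
    have "real (sum (p w) (keys d w)) \<le> (\<Sum>\<kappa>\<in>keys d w. \<nu> (key_cell d w \<kappa>) / t n)"
      unfolding of_nat_sum
    proof (rule sum_mono)
      fix \<kappa> assume "\<kappa> \<in> keys d w"
      then have "p w \<kappa> = nat \<lfloor>\<nu> (key_cell d w \<kappa>) / t n\<rfloor>" using w tl by (auto simp: p_def)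
      then show "real (p w \<kappa>) \<le> \<nu> (key_cell d w \<kappa>) / t n"
        using content_nonneg[OF content key_cell_sets[OF tl(1), of \<kappa>]] t[of n] by simp
    qed
    also have "\<dots> = \<nu> (\<Union>\<kappa>\<in>keys d w. key_cell d w \<kappa>) / t n"
      by (simp add: sum_divide_distrib[symmetric]
        content_sum_disjoint[OF content finite_keys key_cell_sets[OF tl(1)] key_cell_disjoint])
    also have "\<dots> \<le> 1 / t n"
      using tl by (intro divide_right_mono content_le_1[OF content] sets.finite_UN finite_keys key_cell_sets less_imp_le[OF t])
    finally show ?thesis by (rule le_nat_floor)
  qed
  then have prof: "p \<in> profiles d (\<lambda>n. nat \<lfloor>1 / t n\<rfloor>) N"
    unfolding profiles_def by (auto simp: p_def words_def)
  have "low d t N p x \<le> \<nu> (lower_box d x) \<and> \<nu> (lower_box d x) \<le> low d t N p x + gap d t N p x"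
    if x: "x \<in> unit_cube d" for x
  proof
    have "t n * real (p w (key d w x)) \<le> \<nu> (cell d w x)" if "n \<le> N" "w \<in> words d n" for n w
    proof -
      have "real (p w (key d w x)) \<le> \<nu> (cell d w x) / t n"
        using p[OF that(2,1)] t[of n] by simp
      then show ?thesis using t[of n] by (simp add: field_simps)
    qed
    then show "low d t N p x \<le> \<nu> (lower_box d x)"
      by (rule low_le_content[OF content t x d])
    have up: "\<nu> (cell d w x) \<le> t n * (real (p w (key d w x)) + 1)" if "n \<le> N" "w \<in> words d n" for n w
    proof -
      have "\<nu> (cell d w x) / t n \<le> real (p w (key d w x)) + 1"
        using p[OF that(2,1)] t[of n] by simp
      then show ?thesis using t[of n] by (simp add: field_simps)
    qed
    have "(\<Sum>w\<in>partial_words d N. indicator (alive d p w) x * \<nu> (cell d w x \<inter> lower_box d x)) = 0"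
    proof (intro sum.neutral ballI)
      fix w assume w: "w \<in> partial_words d N"
      then have ww: "w \<in> words d N" using partial_words_subset by auto
      have "\<nu> (cell d w x) \<le> 1"
        using ww by (intro content_le_1[OF content] cell_sets) (simp add: words_def)
      then have "\<nu> (cell d w x) / t N < 1" using N(2) by (simp add: field_simps)
      then have "\<lfloor>\<nu> (cell d w x) / t N\<rfloor> \<le> 0" by linarith
      then have "p w (key d w x) = 0" using p(1)[OF ww] by simp
      moreover have "w \<noteq> []" using w N by (auto simp: partial_words_def)
      ultimately show "indicator (alive d p w) x * \<nu> (cell d w x \<inter> lower_box d x) = 0"
        by (simp add: alive_def)
    qed
    moreover have "\<nu> (lower_box d x) \<le> low d t N p x + gap d t N p x
        + (\<Sum>w\<in>partial_words d N. indicator (alive d p w) x * \<nu> (cell d w x \<inter> lower_box d x))"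
      by (rule content_le_low_gap_aux[OF content t x d]) (rule up)
    ultimately show "\<nu> (lower_box d x) \<le> low d t N p x + gap d t N p x" by simp
  qed
  then show ?thesis using prof by blast
qed

section \<open>Measurability, support and number of the brackets\<close>

lemma measurable_key_fun:
  "(\<lambda>x. g (key d w x)) \<in> lebesgue_cube d \<rightarrow>\<^sub>M count_space UNIV"
proof -
  have "key d w \<in> lebesgue_cube d \<rightarrow>\<^sub>M count_space (keys d w)"
  proof (subst measurable_count_space_eq2[OF finite_keys], intro conjI ballI)
    show "key d w \<in> space (lebesgue_cube d) \<rightarrow> keys d w" using key_in by (auto simp: keys_def)
    fix \<kappa>
    have "key d w -` {\<kappa>} \<inter> space (lebesgue_cube d) = {x \<in> unit_cube d. key d w x = \<kappa>}"
      by (auto simp: space_lebesgue_cube)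
    then show "key d w -` {\<kappa>} \<inter> space (lebesgue_cube d) \<in> sets (lebesgue_cube d)"
      using key_fiber_sets by simp
  qed
  then show ?thesis by (rule measurable_compose) simp
qed

lemma alive_sets: "alive d p w \<in> sets (lebesgue_cube d)"
proof -
  have "{x \<in> space (lebesgue_cube d). (\<lambda>\<kappa>. w = [] \<or> 1 \<le> p w \<kappa>) (key d w x)} \<in> sets (lebesgue_cube d)"
    by (intro predE) (rule measurable_key_fun)
  then show ?thesis by (simp add: alive_def space_lebesgue_cube)
qed

lemma low_measurable: "low d t N p \<in> borel_measurable (lebesgue_cube d)"
proof -
  have [measurable]: "(\<lambda>x. real (p w (key d w x))) \<in> borel_measurable (lebesgue_cube d)" for w
    using measurable_compose[OF measurable_key_fun[of "p w" d w], of real borel] by simp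
  show ?thesis unfolding low_def by measurable
qed

lemma gap_measurable: "gap d t N p \<in> borel_measurable (lebesgue_cube d)"
proof -
  note [measurable] = alive_sets
  show ?thesis unfolding gap_def by measurable
qed

lemma prob_space_lebesgue_cube: "prob_space (lebesgue_cube d)"
proof -
  have "prob_space (restrict_space lborel {0..1} :: real measure)"
    by (rule prob_spaceI) (simp add: space_restrict_space emeasure_restrict_space)
  then show ?thesis unfolding lebesgue_cube_def by (intro prob_space_PiM)
qed

lemma emeasure_alive_le_1: "emeasure (lebesgue_cube d) (alive d p w) \<le> 1"
  using prob_space.measure_le_1[OF prob_space_lebesgue_cube] by simp

text \<open>The values \<open>p w \<kappa>\<close> are natural numbers of sum at most
  \<open>S n\<close>, so at most \<open>S n\<close> of them are positive, and each such key has a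
  fibre of measure at most \<open>(1 / 2) ^ n\<close>.\<close>

lemma emeasure_alive_le:
  assumes p: "p \<in> profiles d S N" and w: "w \<in> words d n" "n \<le> N" "1 \<le> n"
  shows "emeasure (lebesgue_cube d) (alive d p w) \<le> ennreal (real (S n) * (1 / 2) ^ n)"
proof -
  let ?K = "{\<kappa> \<in> keys d w. 1 \<le> p w \<kappa>}"
  have fin: "finite ?K" using finite_keys by simp
  have "w \<noteq> []" "length w = n" using w by (auto simp: words_def)
  then have sub: "alive d p w \<subseteq> (\<Union>\<kappa>\<in>?K. {x \<in> unit_cube d. key d w x = \<kappa>})"
    using key_in by (auto simp: alive_def keys_def)
  have "p w \<in> {h \<in> keys d w \<rightarrow>\<^sub>E UNIV. sum h (keys d w) \<le> S (length w)}"
    using PiE_mem[OF p[unfolded profiles_def], of w] w by auto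
  then have S: "sum (p w) (keys d w) \<le> S n" using \<open>length w = n\<close> by simp
  have "card ?K = (\<Sum>\<kappa>\<in>?K. 1)" by simp
  also have "\<dots> \<le> (\<Sum>\<kappa>\<in>?K. p w \<kappa>)" by (intro sum_mono) auto
  also have "\<dots> \<le> sum (p w) (keys d w)" by (intro sum_mono2 finite_keys) auto
  finally have card: "card ?K \<le> S n" using S by simp
  have "emeasure (lebesgue_cube d) (alive d p w)
      \<le> emeasure (lebesgue_cube d) (\<Union>\<kappa>\<in>?K. {x \<in> unit_cube d. key d w x = \<kappa>})"
    by (intro emeasure_mono sub sets.finite_UN fin key_fiber_sets)
  also have "\<dots> \<le> (\<Sum>\<kappa>\<in>?K. emeasure (lebesgue_cube d) {x \<in> unit_cube d. key d w x = \<kappa>})"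
    using key_fiber_sets by (intro emeasure_subadditive_finite fin) auto
  also have "\<dots> \<le> (\<Sum>\<kappa>\<in>?K. ennreal ((1 / 2) ^ n))"
    by (intro sum_mono emeasure_key_fiber_le w)
  also have "\<dots> = ennreal (real (card ?K) * (1 / 2) ^ n)"
    by (subst sum_ennreal) auto
  also have "\<dots> \<le> ennreal (real (S n) * (1 / 2) ^ n)"
    using card by (intro ennreal_leI mult_right_mono) auto
  finally show ?thesis .
qed

lemma finite_profiles: "finite (profiles d S N)"
  unfolding profiles_def
  using finite_words card_bounded_sum_functions[OF finite_keys, of "1 / 2"] by (intro finite_PiE) auto

text \<open>The profiles form a product over words, so logarithms add. A word of length
  \<open>n\<close> is an instance of the counting bound with \<open>2 ^ n\<close> entries of sum at
  most \<open>1 / t n\<close>.\<close>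

lemma ln_card_profiles:
  assumes t: "\<And>n. 0 < t n"
  shows "ln (real (card (profiles (Suc e) (\<lambda>n. nat \<lfloor>1 / t n\<rfloor>) N)))
    \<le> (\<Sum>n\<le>N. 2 * (real n + 1) ^ e * (1 / t n * ln (1 + 2 ^ n * t n) + 2 ^ n * ln (1 + 1 / (2 ^ n * t n))))"
proof -
  let ?d = "Suc e" and ?S = "\<lambda>n. nat \<lfloor>1 / t n\<rfloor>"
  let ?H = "\<lambda>w. {h \<in> keys ?d w \<rightarrow>\<^sub>E (UNIV :: nat set). sum h (keys ?d w) \<le> ?S (length w)}"
  let ?B = "\<lambda>n. 1 / t n * ln (1 + 2 ^ n * t n) + 2 ^ n * ln (1 + 1 / (2 ^ n * t n))"
  have pos: "0 < card (?H w)" for w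
  proof -
    have "(\<lambda>\<kappa>\<in>keys ?d w. 0) \<in> ?H w" by simp
    moreover have "finite (?H w)"
      using card_bounded_sum_functions[OF finite_keys, of "1 / 2" ?d w] by simp
    ultimately show ?thesis unfolding card_gt_0_iff by blast
  qed
  have le: "ln (real (card (?H w))) \<le> ?B n" if w: "w \<in> words ?d n" for n w
  proof -
    have "length w = n" using w by (simp add: words_def)
    moreover have "card (keys ?d w) \<le> 2 ^ n" using card_keys[OF w] by (simp add: keys_def)
    moreover have "real (?S n) \<le> 1 / t n" using t[of n] by simp
    ultimately show ?thesis
      using ln_card_bounded_sum_functions[OF finite_keys, of ?d w "2 ^ n" "?S n" "1 / t n"] t[of n] by (simp add: mult.commute)
  qed
  have B: "0 \<le> ?B n" for n using t[of n] by (intro add_nonneg_nonneg mult_nonneg_nonneg) auto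
  have disj: "disjoint_family_on (words ?d) {..N}" by (auto simp: disjoint_family_on_def words_def)
  have "card (profiles ?d ?S N) = (\<Prod>w\<in>(\<Union>n\<le>N. words ?d n). card (?H w))"
    unfolding profiles_def by (rule card_PiE) (simp add: finite_words)
  then have "ln (real (card (profiles ?d ?S N))) = (\<Sum>w\<in>(\<Union>n\<le>N. words ?d n). ln (real (card (?H w))))"
    using pos finite_words by (subst ln_prod[symmetric]) (auto simp: of_nat_prod)
  also have "\<dots> = (\<Sum>n\<le>N. \<Sum>w\<in>words ?d n. ln (real (card (?H w))))"
    by (rule sum.UNION_disjoint_family) (simp_all add: finite_words disj)
  also have "\<dots> \<le> (\<Sum>n\<le>N. \<Sum>w\<in>words ?d n. ?B n)" by (intro sum_mono le)
  also have "\<dots> = (\<Sum>n\<le>N. real (card (words ?d n)) * ?B n)" by simp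
  also have "\<dots> \<le> (\<Sum>n\<le>N. 2 * (real n + 1) ^ e * ?B n)"
  proof (intro sum_mono mult_right_mono B)
    fix n
    show "real (card (words ?d n)) \<le> 2 * (real n + 1) ^ e"
      using of_nat_mono[OF card_words_le[of e n], where 'a = real] by (simp add: add.commute)
  qed
  finally show ?thesis .
qed

subsection \<open>Minkowski and geometric sums\<close>

text \<open>Jensen's inequality for the convex function \<open>powr r\<close>, with the weights
  \<open>a i\<close> normalised.\<close>

lemma powr_sum_le:
  fixes a y :: "'i \<Rightarrow> real"
  assumes I: "finite I" and a: "\<And>i. i \<in> I \<Longrightarrow> 0 < a i" and y: "\<And>i. i \<in> I \<Longrightarrow> 0 \<le> y i" and r: "1 \<le> r"
  shows "(\<Sum>i\<in>I. a i * y i) powr r \<le> (\<Sum>i\<in>I. a i) powr (r - 1) * (\<Sum>i\<in>I. a i * y i powr r)"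
proof -
  \<comment> \<open>\<open>powr_convex\<close> speaks of the open half-line, so the indices with
    \<open>y i = 0\<close> are removed first.\<close>
  define J where "J = {i \<in> I. 0 < y i}"
  have J: "finite J" "J \<subseteq> I" using I by (auto simp: J_def)
  have sumJ: "(\<Sum>i\<in>I. a i * y i) = (\<Sum>i\<in>J. a i * y i)"
    using I y by (intro sum.mono_neutral_right) (auto simp: J_def less_le)
  have nn: "0 \<le> (\<Sum>i\<in>I. a i * y i powr r)" "0 \<le> (\<Sum>i\<in>J. a i * y i powr r)"
    using a J by (auto intro!: sum_nonneg simp: less_imp_le)
  show ?thesis
  proof (cases "J = {}")
    case True
    then show ?thesis using sumJ nn by simp
  next
    case False
    define A where "A = (\<Sum>i\<in>J. a i)"
    have A: "0 < A" unfolding A_def using J a False by (intro sum_pos) auto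
    have "(\<Sum>i\<in>J. (a i / A) *\<^sub>R y i) powr r \<le> (\<Sum>i\<in>J. (a i / A) * y i powr r)"
    proof (rule convex_on_sum[OF J(1) False powr_convex[OF r]])
      show "(\<Sum>i\<in>J. a i / A) = 1" using A by (simp add: sum_divide_distrib[symmetric] A_def[symmetric])
      show "0 \<le> a i / A" if "i \<in> J" for i using that a J A by (auto simp: less_imp_le)
      show "y i \<in> {0<..}" if "i \<in> J" for i using that by (simp add: J_def)
    qed
    then have "((\<Sum>i\<in>J. a i * y i) / A) powr r \<le> (\<Sum>i\<in>J. a i * y i powr r) / A"
      by (simp add: sum_divide_distrib)
    moreover have "0 \<le> (\<Sum>i\<in>J. a i * y i)" using a y J by (intro sum_nonneg mult_nonneg_nonneg) (auto simp: less_imp_le subset_iff)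
    ultimately have "(\<Sum>i\<in>J. a i * y i) powr r \<le> A powr r * ((\<Sum>i\<in>J. a i * y i powr r) / A)"
      using A by (simp add: powr_divide field_simps)
    also have "\<dots> = A powr (r - 1) * (\<Sum>i\<in>J. a i * y i powr r)"
      using A by (simp add: powr_diff)
    also have "\<dots> \<le> (\<Sum>i\<in>I. a i) powr (r - 1) * (\<Sum>i\<in>I. a i * y i powr r)"
    proof (intro mult_mono powr_mono2)
      show "A \<le> (\<Sum>i\<in>I. a i)" unfolding A_def using a by (intro sum_mono2 I J) (auto simp: less_imp_le)
      show "(\<Sum>i\<in>J. a i * y i powr r) \<le> (\<Sum>i\<in>I. a i * y i powr r)"
        using a by (intro sum_mono2 I J) (auto simp: less_imp_le)
    qed (use r A nn in auto)
    finally show ?thesis using sumJ by simp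
  qed
qed

text \<open>Minkowski's inequality: \<open>bm\<close> says that the \<open>i\<close>-th summand has \<open>L\<^sup>r\<close> norm at most \<open>a i\<close>.\<close>

lemma nn_integral_powr_sum_indicator_le:
  fixes a b m :: "'i \<Rightarrow> real"
  assumes I: "finite I" and r: "1 \<le> r" and A: "\<And>i. i \<in> I \<Longrightarrow> A i \<in> sets M"
    and ab: "\<And>i. i \<in> I \<Longrightarrow> 0 < a i" "\<And>i. i \<in> I \<Longrightarrow> 0 \<le> b i"
    and m: "\<And>i. i \<in> I \<Longrightarrow> 0 \<le> m i" "\<And>i. i \<in> I \<Longrightarrow> emeasure M (A i) \<le> ennreal (m i)"
    and bm: "\<And>i. i \<in> I \<Longrightarrow> b i powr r * m i \<le> a i powr r"
  shows "(\<integral>\<^sup>+x. ennreal ((\<Sum>i\<in>I. b i * indicator (A i) x) powr r) \<partial>M) \<le> ennreal ((\<Sum>i\<in>I. a i) powr r)"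
proof -
  let ?s = "\<Sum>i\<in>I. a i"
  have s: "0 \<le> ?s" using ab by (intro sum_nonneg) (auto simp: less_imp_le)
  have c: "0 \<le> a i * (b i / a i) powr r" if "i \<in> I" for i using ab that by (simp add: less_imp_le)
  have "(\<integral>\<^sup>+x. ennreal ((\<Sum>i\<in>I. b i * indicator (A i) x) powr r) \<partial>M)
      \<le> (\<integral>\<^sup>+x. ennreal (?s powr (r - 1)) * (\<Sum>i\<in>I. ennreal (a i * (b i / a i) powr r) * indicator (A i) x) \<partial>M)"
  proof (rule nn_integral_mono)
    fix x
    \<comment> \<open>Weighting the \<open>i\<close>-th term by its own norm bound
      \<open>a i\<close> makes Jensen lossless here: after integration the \<open>i\<close>-th term
      is at most \<open>a i\<close>, and the total \<open>?s powr (r - 1) * ?s\<close> is the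
      claimed bound.\<close>
    have "(\<Sum>i\<in>I. b i * indicator (A i) x) = (\<Sum>i\<in>I. a i * (b i / a i * indicator (A i) x))"
      using ab by (intro sum.cong) (auto simp: less_imp_neq[symmetric])
    also have "\<dots> powr r \<le> ?s powr (r - 1) * (\<Sum>i\<in>I. a i * (b i / a i * indicator (A i) x) powr r)"
      using ab by (intro powr_sum_le I r) (auto simp: less_imp_le)
    also have "(\<Sum>i\<in>I. a i * (b i / a i * indicator (A i) x) powr r) = (\<Sum>i\<in>I. a i * (b i / a i) powr r * indicator (A i) x)"
      by (intro sum.cong) (auto simp: indicator_def)
    finally have "ennreal ((\<Sum>i\<in>I. b i * indicator (A i) x) powr r)
        \<le> ennreal (?s powr (r - 1) * (\<Sum>i\<in>I. a i * (b i / a i) powr r * indicator (A i) x))"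
      by (rule ennreal_leI)
    also have "\<dots> = ennreal (?s powr (r - 1)) * (\<Sum>i\<in>I. ennreal (a i * (b i / a i) powr r * indicator (A i) x))"
      using c by (subst sum_ennreal) (auto intro!: ennreal_mult sum_nonneg)
    also have "(\<Sum>i\<in>I. ennreal (a i * (b i / a i) powr r * indicator (A i) x))
        = (\<Sum>i\<in>I. ennreal (a i * (b i / a i) powr r) * indicator (A i) x)"
      by (intro sum.cong) (auto simp: indicator_def)
    finally show "ennreal ((\<Sum>i\<in>I. b i * indicator (A i) x) powr r)
        \<le> ennreal (?s powr (r - 1)) * (\<Sum>i\<in>I. ennreal (a i * (b i / a i) powr r) * indicator (A i) x)" .
  qed
  also have "\<dots> = ennreal (?s powr (r - 1)) * (\<Sum>i\<in>I. ennreal (a i * (b i / a i) powr r) * emeasure M (A i))"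
    using A by (subst nn_integral_cmult, measurable) (subst nn_integral_sum, auto simp: nn_integral_cmult_indicator)
  also have "\<dots> \<le> ennreal (?s powr (r - 1)) * (\<Sum>i\<in>I. ennreal (a i))"
  proof (intro mult_left_mono sum_mono)
    fix i assume i: "i \<in> I"
    have "ennreal (a i * (b i / a i) powr r) * emeasure M (A i) \<le> ennreal (a i * (b i / a i) powr r) * ennreal (m i)"
      using m i by (intro mult_left_mono) auto
    also have "\<dots> = ennreal (a i * (b i / a i) powr r * m i)"
      using c m i by (simp add: ennreal_mult'')
    also have "a i * (b i / a i) powr r * m i = a i * ((b i powr r * m i) / a i powr r)"
      using ab[OF i] by (simp add: powr_divide)
    also have "\<dots> \<le> a i * 1"
      using bm[OF i] ab[OF i] by (intro mult_left_mono) auto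
    finally show "ennreal (a i * (b i / a i) powr r) * emeasure M (A i) \<le> ennreal (a i)"
      by (simp add: ennreal_leI)
  qed simp
  also have "\<dots> = ennreal (?s powr (r - 1) * ?s)"
    using ab s by (subst sum_ennreal) (auto simp: less_imp_le ennreal_mult'')
  also have "?s powr (r - 1) * ?s = ?s powr r"
    using s by (cases "?s = 0") (auto simp: powr_diff)
  finally show ?thesis .
qed

lemma summable_poly_geometric:
  fixes q :: real
  assumes q: "0 < q" "q < 1"
  shows "summable (\<lambda>m. (real m + 1) ^ e * q ^ m)"
proof -
  have "(\<lambda>m. (real m + 2) / (real m + 1)) \<longlonglongrightarrow> 1" by real_asymp
  then have "(\<lambda>m. ((real m + 2) / (real m + 1)) ^ e * q) \<longlonglongrightarrow> 1 ^ e * q"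
    by (intro tendsto_mult tendsto_power tendsto_const)
  moreover have "1 ^ e * q < (1 + q) / 2" using q by simp
  ultimately have "\<forall>\<^sub>F m in sequentially. ((real m + 2) / (real m + 1)) ^ e * q < (1 + q) / 2"
    by (rule order_tendstoD(2))
  then obtain N where N: "\<And>m. m \<ge> N \<Longrightarrow> ((real m + 2) / (real m + 1)) ^ e * q < (1 + q) / 2"
    by (auto simp: eventually_sequentially)
  show ?thesis
  proof (rule summable_ratio_test[of "(1 + q) / 2" N])
    fix m assume m: "N \<le> m"
    have "(real (Suc m) + 1) ^ e * q ^ Suc m = ((real m + 2) / (real m + 1)) ^ e * q * ((real m + 1) ^ e * q ^ m)"
      by (simp add: power_divide add.commute)
    also have "\<dots> \<le> (1 + q) / 2 * ((real m + 1) ^ e * q ^ m)"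
      using N[OF m] q by (intro mult_right_mono) auto
    finally show "norm ((real (Suc m) + 1) ^ e * q ^ Suc m) \<le> (1 + q) / 2 * norm ((real m + 1) ^ e * q ^ m)"
      using q by (simp add: abs_mult power_abs)
  qed (use q in auto)
qed

abbreviation nat_dist :: "nat \<Rightarrow> nat \<Rightarrow> nat" where
  "nat_dist n m \<equiv> (n - m) + (m - n)"

lemma sum_nat_dist_le:
  fixes g :: "nat \<Rightarrow> real"
  assumes g: "summable g" "\<And>m. 0 \<le> g m"
  shows "(\<Sum>n<N. g (nat_dist n k)) \<le> 2 * suminf g"
proof -
  have "(\<Sum>n<N. g (nat_dist n k)) = (\<Sum>n\<in>{..<N} \<inter> {k..}. g (nat_dist n k)) + (\<Sum>n\<in>{..<N} \<inter> {..<k}. g (nat_dist n k))"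
    by (subst sum.union_disjoint[symmetric]) (auto intro!: sum.cong)
  also have "(\<Sum>n\<in>{..<N} \<inter> {k..}. g (nat_dist n k)) = (\<Sum>n\<in>(\<lambda>n. n - k) ` ({..<N} \<inter> {k..}). g n)"
    by (subst sum.reindex) (auto simp: inj_on_def)
  also have "\<dots> \<le> suminf g" by (intro sum_le_suminf g) auto
  also have "(\<Sum>n\<in>{..<N} \<inter> {..<k}. g (nat_dist n k)) = (\<Sum>n\<in>(\<lambda>n. k - n) ` ({..<N} \<inter> {..<k}). g n)"
    by (subst sum.reindex) (auto simp: inj_on_def)
  also have "\<dots> \<le> suminf g" by (intro sum_le_suminf g) auto
  finally show ?thesis by simp
qed

text \<open>\<open>n + 1 \<le> (k + 1) * (nat_dist n k + 1)\<close> moves the polynomial factor from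
  \<open>n\<close> to \<open>k\<close>, and the geometric decay absorbs what is left. The extra
  factor \<open>nat_dist n k + 1\<close> allows for the logarithm in the entropy of a level.\<close>

lemma sum_poly_geometric_dist_le:
  fixes q :: real
  assumes q: "0 < q" "q < 1"
  shows "\<exists>C>0. \<forall>k N. (\<Sum>n<N. (real n + 1) ^ e * ((real (nat_dist n k) + 1) * q ^ nat_dist n k)) \<le> C * (real k + 1) ^ e"
proof -
  define g where "g m = (real m + 1) ^ Suc e * q ^ m" for m
  have g: "summable g" unfolding g_def by (rule summable_poly_geometric[OF q])
  have nonneg: "0 \<le> g m" for m
    unfolding g_def using q by (intro mult_nonneg_nonneg zero_le_power) auto
  have pos: "0 < suminf g"
    by (rule suminf_pos2[OF g nonneg, of 0]) (simp add: g_def)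
  have "(\<Sum>n<N. (real n + 1) ^ e * ((real (nat_dist n k) + 1) * q ^ nat_dist n k)) \<le> 2 * suminf g * (real k + 1) ^ e" for k N
  proof -
    have "(\<Sum>n<N. (real n + 1) ^ e * ((real (nat_dist n k) + 1) * q ^ nat_dist n k))
        \<le> (\<Sum>n<N. (real k + 1) ^ e * g (nat_dist n k))"
    proof (rule sum_mono)
      fix n
      have "n + 1 \<le> (k + 1) * (nat_dist n k + 1)" by (cases "n \<le> k") auto
      then have "real (n + 1) \<le> real ((k + 1) * (nat_dist n k + 1))" by (rule of_nat_mono)
      then have "real n + 1 \<le> (real k + 1) * (real (nat_dist n k) + 1)"
        by (simp only: of_nat_add of_nat_mult of_nat_1)
      then have "(real n + 1) ^ e \<le> ((real k + 1) * (real (nat_dist n k) + 1)) ^ e"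
        by (intro power_mono) auto
      then have "(real n + 1) ^ e * ((real (nat_dist n k) + 1) * q ^ nat_dist n k)
          \<le> ((real k + 1) * (real (nat_dist n k) + 1)) ^ e * ((real (nat_dist n k) + 1) * q ^ nat_dist n k)"
        using q by (intro mult_right_mono) auto
      then show "(real n + 1) ^ e * ((real (nat_dist n k) + 1) * q ^ nat_dist n k) \<le> (real k + 1) ^ e * g (nat_dist n k)"
        by (simp only: g_def power_mult_distrib power_Suc mult_ac)
    qed
    also have "\<dots> = (real k + 1) ^ e * (\<Sum>n<N. g (nat_dist n k))" by (simp only: sum_distrib_left)
    also have "\<dots> \<le> (real k + 1) ^ e * (2 * suminf g)"
      by (intro mult_left_mono sum_nat_dist_le g nonneg) auto
    finally show ?thesis by (simp add: mult_ac)
  qed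
  then show ?thesis using pos by (intro exI[of _ "2 * suminf g"]) auto
qed

subsection \<open>Size and number of the brackets\<close>

text \<open>At \<open>n = k\<close> this is \<open>1 / 2 ^ k\<close>, the average mass of
  \<open>2 ^ k\<close> boxes of total mass \<open>1\<close>.\<close>

definition threshold :: "real \<Rightarrow> nat \<Rightarrow> nat \<Rightarrow> real" where
  "threshold r k n = 2 powr ((real n - real k) / (2 * r) - real k)"

lemma threshold_pos: "0 < threshold r k n"
  by (simp add: threshold_def)

context
  fixes r q :: real
  assumes r: "1 \<le> r" and q_def: "q = 2 powr (- 1 / (2 * r))"
begin

lemma q_bounds: "0 < q" "q < 1" "1 / 2 \<le> q"
proof -
  show "0 < q" by (simp add: q_def)
  have "2 powr (- 1 / (2 * r)) < 2 powr 0" using r by (intro powr_less_mono) auto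
  then show "q < 1" by (simp add: q_def)
  have "2 powr (- 1) \<le> 2 powr (- 1 / (2 * r))" using r by (intro powr_mono) (auto simp: field_simps)
  then show "1 / 2 \<le> q" by (simp add: q_def powr_minus_divide)
qed

lemma q_power: "q ^ m = 2 powr (- real m / (2 * r))"
  by (simp add: q_def powr_realpow[symmetric] powr_powr)

lemma threshold_above: "threshold r k (k + m) = (1 / 2) ^ k / q ^ m"
proof -
  have "threshold r k (k + m) = 2 powr (real m / (2 * r) - real k)"
    by (simp add: threshold_def)
  also have "\<dots> = 2 powr (real m / (2 * r)) / 2 ^ k"
    by (simp only: powr_diff powr_realpow zero_less_numeral)
  also have "2 powr (real m / (2 * r)) = 1 / q ^ m"
    by (simp add: q_power powr_minus_divide)
  finally show ?thesis by (simp add: power_divide)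
qed

lemma threshold_below: "threshold r (n + m) n = (1 / 2) ^ (n + m) * q ^ m"
proof -
  have "threshold r (n + m) n = 2 powr (- real m / (2 * r) - real (n + m))"
    by (simp add: threshold_def)
  also have "\<dots> = q ^ m / 2 ^ (n + m)"
    by (simp only: powr_diff q_power powr_realpow zero_less_numeral)
  finally show ?thesis by (simp add: power_divide)
qed

text \<open>The ratio of boxes to mass units, \<open>2 ^ n * threshold r k n\<close>, has this form
  above level \<open>k\<close>, and its inverse has it below.\<close>

lemma ln_one_plus_le:
  assumes "u = 2 ^ m / q ^ m"
  shows "ln (1 + u) \<le> 1 + 2 * real m"
proof -
  have "1 / q \<le> 2" using q_bounds by (simp add: field_simps)
  then have "(1 / q) ^ m \<le> 2 ^ m" using q_bounds by (intro power_mono) auto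
  then have u: "u \<le> 4 ^ m" using assms q_bounds mult_left_mono[of "(1 / q) ^ m" "2 ^ m" "2 ^ m"]
    by (simp add: power_divide power_mult_distrib[symmetric])
  have "0 < u" using assms q_bounds by simp
  moreover have "1 + u \<le> 2 * 4 ^ m" using u one_le_power[of "4::real" m] by linarith
  ultimately have "ln (1 + u) \<le> ln (2 * 4 ^ m)" by simp
  also have "\<dots> = (1 + 2 * real m) * ln 2"
    using ln_realpow[of 2 2] by (simp add: ln_mult ln_realpow algebra_simps)
  also have "\<dots> \<le> (1 + 2 * real m) * 1" using ln_2_less_1 by (intro mult_left_mono) auto
  finally show ?thesis by simp
qed

text \<open>From level \<open>k\<close> on, the mass units \<open>1 / threshold r k n\<close> do not
  outnumber the \<open>2 ^ n\<close> boxes; below it the boxes are the fewer. In each case the term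
  led by the smaller number keeps its logarithm, of order \<open>nat_dist n k + 1\<close>, and
  \<open>ln (1 + u) \<le> u\<close> reduces the other term to that number.\<close>

lemma entropy_term_le:
  "1 / threshold r k n * ln (1 + 2 ^ n * threshold r k n) + 2 ^ n * ln (1 + 1 / (2 ^ n * threshold r k n))
    \<le> 2 * 2 ^ k * ((real (nat_dist n k) + 1) * q ^ nat_dist n k)"
proof -
  have ln1: "ln (1 + u) \<le> u" if "0 < u" for u :: real using ln_add_one_self_le_self[of u] that by simp
  show ?thesis
  proof (cases "k \<le> n")
    case True
    then obtain m where n: "n = k + m" using le_Suc_ex by blast
    have u: "2 ^ n * threshold r k n = 2 ^ m / q ^ m" unfolding n threshold_above by (simp add: power_add power_divide)
    have it: "1 / threshold r k n = 2 ^ k * q ^ m" unfolding n threshold_above by (simp add: power_divide)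
    have "2 ^ n * ln (1 + 1 / (2 ^ n * threshold r k n)) \<le> 2 ^ n * (1 / (2 ^ n * threshold r k n))"
      using threshold_pos[of r k n] by (intro mult_left_mono ln1) auto
    also have "\<dots> = 2 ^ k * q ^ m" using it by simp
    finally have "1 / threshold r k n * ln (1 + 2 ^ n * threshold r k n) + 2 ^ n * ln (1 + 1 / (2 ^ n * threshold r k n))
        \<le> 2 ^ k * q ^ m * (1 + 2 * real m) + 2 ^ k * q ^ m"
      unfolding it using q_bounds ln_one_plus_le[OF u] by (intro add_mono mult_left_mono) auto
    then show ?thesis using n by (simp add: algebra_simps)
  next
    case False
    then obtain m where k: "k = n + m" using le_Suc_ex[of n k] by auto
    have u: "1 / (2 ^ n * threshold r k n) = 2 ^ m / q ^ m" unfolding k threshold_below by (simp add: power_add power_divide)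
    \<comment> \<open>Below level \<open>k\<close> the true decay is \<open>(1 / 2) ^ m\<close>; it
      is weakened to \<open>q ^ m\<close> so that both sides of \<open>k\<close> share one
      rate.\<close>
    have qm: "2 ^ n \<le> 2 ^ k * q ^ m"
    proof -
      have "1 \<le> 2 ^ m * q ^ m" unfolding power_mult_distrib[symmetric] using q_bounds by (intro one_le_power) simp
      then have "2 ^ n * 1 \<le> 2 ^ n * (2 ^ m * q ^ m)" by (intro mult_left_mono) auto
      then show ?thesis by (simp add: k power_add mult.assoc)
    qed
    have "1 / threshold r k n * ln (1 + 2 ^ n * threshold r k n) \<le> 1 / threshold r k n * (2 ^ n * threshold r k n)"
      using threshold_pos[of r k n] by (intro mult_left_mono ln1) auto
    also have "\<dots> = 2 ^ n" using threshold_pos[of r k n] by simp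
    finally have "1 / threshold r k n * ln (1 + 2 ^ n * threshold r k n) + 2 ^ n * ln (1 + 1 / (2 ^ n * threshold r k n))
        \<le> 2 ^ n + 2 ^ n * (1 + 2 * real m)"
      using ln_one_plus_le[OF u] by (intro add_mono mult_left_mono) auto
    also have "\<dots> = 2 ^ n * (2 * (real m + 1))" by (simp add: algebra_simps)
    also have "\<dots> \<le> 2 ^ k * q ^ m * (2 * (real m + 1))" using qm by (intro mult_right_mono) auto
    finally show ?thesis using k by (simp add: algebra_simps)
  qed
qed

text \<open>Up to level \<open>k\<close> the threshold itself decays away from \<open>k\<close>, and
  the trivial measure \<open>1\<close> is enough. Beyond \<open>k\<close> the threshold grows, and
  the shrinking support has to outweigh it.\<close>

lemma size_term_le:
  assumes p: "p \<in> profiles d (\<lambda>n. nat \<lfloor>1 / threshold r k n\<rfloor>) N" and w: "w \<in> partial_words d n" "n < N"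
  shows "\<exists>m\<ge>0. emeasure (lebesgue_cube d) (alive d p w) \<le> ennreal m \<and>
    (2 * threshold r k (Suc n)) powr r * m \<le> (4 * (1 / 2) ^ k * q ^ nat_dist n k) powr r"
proof -
  have "threshold r k (Suc n) = 2 powr (1 / (2 * r)) * threshold r k n"
    unfolding threshold_def powr_add[symmetric]
    by (rule arg_cong[of _ _ "(powr) 2"]) (simp add: add_divide_distrib diff_divide_distrib)
  also have "\<dots> \<le> 2 * threshold r k n"
    using r powr_mono[of "1 / (2 * r)" 1 2] threshold_pos[of r k n] by (intro mult_right_mono) auto
  finally have b: "2 * threshold r k (Suc n) \<le> 4 * threshold r k n" by simp
  show ?thesis
  proof (cases "n \<le> k")
    case True
    then obtain m where k: "k = n + m" using le_Suc_ex by blast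
    have "(2 * threshold r k (Suc n)) powr r * 1 \<le> (4 * (1 / 2) ^ k * q ^ nat_dist n k) powr r"
      using b threshold_pos[of r k "Suc n"] r unfolding k threshold_below by (auto intro!: powr_mono2)
    then show ?thesis using emeasure_alive_le_1 by (intro exI[of _ 1]) auto
  next
    case False
    then obtain m where n: "n = k + m" using le_Suc_ex[of k n] by auto
    let ?S = "nat \<lfloor>1 / threshold r k n\<rfloor>"
    have "w \<in> words d n" using w partial_words_subset by auto
    then have "emeasure (lebesgue_cube d) (alive d p w) \<le> ennreal (real ?S * (1 / 2) ^ n)"
      using emeasure_alive_le[OF p, of w n] w False by simp
    also have "\<dots> \<le> ennreal (1 / threshold r k n * (1 / 2) ^ n)"
      using threshold_pos[of r k n] by (intro ennreal_leI mult_right_mono) auto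
    finally have em: "emeasure (lebesgue_cube d) (alive d p w) \<le> ennreal (1 / threshold r k n * (1 / 2) ^ n)" .
    have "1 / threshold r k n * (1 / 2) ^ n = q ^ m * (1 / 2) ^ m"
      unfolding n threshold_above by (simp add: power_add power_divide)
    also have "\<dots> \<le> 1 * (1 / 2) ^ m" using q_bounds by (intro mult_right_mono power_le_one) auto
    also have "\<dots> = 2 powr (- real m)" by (simp add: powr_minus_divide powr_realpow power_divide)
    \<comment> \<open>This is \<open>q powr (2 * r) = 1 / 2\<close>. One factor \<open>q ^ m\<close>
      cancels the growth of the threshold, the other is the decay that remains.\<close>
    also have "\<dots> = (q ^ m * q ^ m) powr r"
      using r by (simp add: q_power powr_add[symmetric] powr_powr)
    finally have m: "1 / threshold r k n * (1 / 2) ^ n \<le> (q ^ m * q ^ m) powr r" .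
    have b': "(2 * threshold r k (Suc n)) powr r \<le> (4 * threshold r k n) powr r"
      by (rule powr_mono2[OF _ _ b]) (use r threshold_pos[of r k "Suc n"] in auto)
    have "(2 * threshold r k (Suc n)) powr r * (1 / threshold r k n * (1 / 2) ^ n)
        \<le> (4 * threshold r k n) powr r * (q ^ m * q ^ m) powr r"
      by (rule mult_mono[OF b' m]) (use threshold_pos[of r k n] in auto)
    also have "\<dots> = (4 * threshold r k n * (q ^ m * q ^ m)) powr r"
      using threshold_pos[of r k n] q_bounds by (simp add: powr_mult)
    also have "4 * threshold r k n * (q ^ m * q ^ m) = 4 * (1 / 2) ^ k * q ^ nat_dist n k"
      unfolding n threshold_above using q_bounds by simp
    finally show ?thesis using em threshold_pos[of r k n]
      by (intro exI[of _ "1 / threshold r k n * (1 / 2) ^ n"]) auto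
  qed
qed

lemma nn_integral_gap_le:
  assumes p: "p \<in> profiles (Suc e) (\<lambda>n. nat \<lfloor>1 / threshold r k n\<rfloor>) N"
  shows "(\<integral>\<^sup>+x. ennreal (gap (Suc e) (threshold r k) N p x powr r) \<partial>lebesgue_cube (Suc e))
    \<le> ennreal ((4 * (1 / 2) ^ k * (\<Sum>n<N. (real n + 1) ^ e * ((real (nat_dist n k) + 1) * q ^ nat_dist n k))) powr r)"
proof -
  let ?d = "Suc e"
  let ?I = "SIGMA n:{..<N}. partial_words ?d n"
  have I: "finite ?I" by (simp add: finite_partial_words)
  have "\<forall>i\<in>?I. \<exists>m. 0 \<le> m \<and> emeasure (lebesgue_cube ?d) (alive ?d p (snd i)) \<le> ennreal m \<and>
      (2 * threshold r k (Suc (fst i))) powr r * m \<le> (4 * (1 / 2) ^ k * q ^ nat_dist (fst i) k) powr r"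
  proof
    fix i assume "i \<in> ?I"
    then have "snd i \<in> partial_words ?d (fst i)" "fst i < N" by auto
    from size_term_le[OF p this] show "\<exists>m. 0 \<le> m \<and> emeasure (lebesgue_cube ?d) (alive ?d p (snd i)) \<le> ennreal m \<and>
      (2 * threshold r k (Suc (fst i))) powr r * m \<le> (4 * (1 / 2) ^ k * q ^ nat_dist (fst i) k) powr r" .
  qed
  from bchoice[OF this] obtain m where mm: "\<forall>i\<in>?I. 0 \<le> m i \<and> emeasure (lebesgue_cube ?d) (alive ?d p (snd i)) \<le> ennreal (m i) \<and>
      (2 * threshold r k (Suc (fst i))) powr r * m i \<le> (4 * (1 / 2) ^ k * q ^ nat_dist (fst i) k) powr r" ..
  note m = mm[THEN bspec, THEN conjunct1] mm[THEN bspec, THEN conjunct2, THEN conjunct1]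
    mm[THEN bspec, THEN conjunct2, THEN conjunct2]
  have sum_I: "(\<Sum>i\<in>?I. h i) = (\<Sum>n<N. \<Sum>w\<in>partial_words ?d n. h (n, w))" for h :: "nat \<times> bool list \<Rightarrow> real"
    by (simp add: sum.Sigma finite_partial_words)
  have "(\<integral>\<^sup>+x. ennreal (gap ?d (threshold r k) N p x powr r) \<partial>lebesgue_cube ?d)
      = (\<integral>\<^sup>+x. ennreal ((\<Sum>i\<in>?I. 2 * threshold r k (Suc (fst i)) * indicator (alive ?d p (snd i)) x) powr r) \<partial>lebesgue_cube ?d)"
    unfolding sum_I gap_def fst_conv snd_conv ..
  also have "\<dots> \<le> ennreal ((\<Sum>i\<in>?I. 4 * (1 / 2) ^ k * q ^ nat_dist (fst i) k) powr r)"
  proof (rule nn_integral_powr_sum_indicator_le[OF I r alive_sets _ _ m])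
    show "0 < 4 * (1 / 2) ^ k * q ^ nat_dist (fst i) k" for i :: "nat \<times> bool list"
      using q_bounds by simp
    show "0 \<le> 2 * threshold r k (Suc (fst i))" for i :: "nat \<times> bool list"
      using threshold_pos[of r k "Suc (fst i)"] by simp
  qed
  also have "\<dots> \<le> ennreal ((4 * (1 / 2) ^ k * (\<Sum>n<N. (real n + 1) ^ e * ((real (nat_dist n k) + 1) * q ^ nat_dist n k))) powr r)"
  proof (intro ennreal_leI powr_mono2)
    have "(\<Sum>i\<in>?I. 4 * (1 / 2) ^ k * q ^ nat_dist (fst i) k) = (\<Sum>n<N. real (card (partial_words ?d n)) * (4 * (1 / 2) ^ k * q ^ nat_dist n k))"
      unfolding sum_I by simp
    also have "\<dots> \<le> (\<Sum>n<N. (real n + 1) ^ e * (4 * (1 / 2) ^ k * ((real (nat_dist n k) + 1) * q ^ nat_dist n k)))"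
    proof (rule sum_mono, rule mult_mono)
      fix n
      show "real (card (partial_words ?d n)) \<le> (real n + 1) ^ e"
        using of_nat_mono[OF card_partial_words_le[of e n], where 'a = real] by (simp add: add.commute)
      \<comment> \<open>The factor \<open>nat_dist n k + 1\<close> is inserted only so that size and
        entropy are controlled by the same sum.\<close>
      have "1 * q ^ nat_dist n k \<le> (real (nat_dist n k) + 1) * q ^ nat_dist n k"
        using q_bounds by (intro mult_right_mono) auto
      then show "4 * (1 / 2) ^ k * q ^ nat_dist n k \<le> 4 * (1 / 2) ^ k * ((real (nat_dist n k) + 1) * q ^ nat_dist n k)"
        unfolding mult.assoc by (intro mult_left_mono) auto
    qed (use q_bounds in auto)
    also have "\<dots> = 4 * (1 / 2) ^ k * (\<Sum>n<N. (real n + 1) ^ e * ((real (nat_dist n k) + 1) * q ^ nat_dist n k))"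
      unfolding sum_distrib_left by (simp only: mult_ac)
    finally show "(\<Sum>i\<in>?I. 4 * (1 / 2) ^ k * q ^ nat_dist (fst i) k)
      \<le> 4 * (1 / 2) ^ k * (\<Sum>n<N. (real n + 1) ^ e * ((real (nat_dist n k) + 1) * q ^ nat_dist n k))" .
    show "0 \<le> (\<Sum>i\<in>?I. 4 * (1 / 2) ^ k * q ^ nat_dist (fst i) k)"
      using q_bounds by (intro sum_nonneg) auto
  qed (use r in auto)
  finally show ?thesis .
qed

end

text \<open>A bracket is stored as its lower end and its width: the width is what gets integrated,
  and the pairs for two contents combine easily into a bracket for the difference.\<close>

definition bracket_system :: "nat \<Rightarrow> real \<Rightarrow> real \<Rightarrow> (((nat \<Rightarrow> real) \<Rightarrow> real) \<times> ((nat \<Rightarrow> real) \<Rightarrow> real)) set \<Rightarrow> bool" where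
  "bracket_system d r s B \<longleftrightarrow> finite B \<and> B \<noteq> {} \<and>
     (\<forall>(l, g)\<in>B. l \<in> borel_measurable (lebesgue_cube d) \<and> g \<in> borel_measurable (lebesgue_cube d) \<and> (\<forall>x. 0 \<le> g x) \<and>
        (\<integral>\<^sup>+x. ennreal (g x powr r) \<partial>lebesgue_cube d) \<le> ennreal (s powr r)) \<and>
     (\<forall>\<nu>. subprob_content d \<nu> \<longrightarrow> (\<exists>(l, g)\<in>B. \<forall>x\<in>unit_cube d.
        l x \<le> \<nu> (lower_box d x) \<and> \<nu> (lower_box d x) \<le> l x + g x))"

lemma bracket_system_dyadic:
  assumes r: "1 \<le> r"
  shows "\<exists>C>0. \<forall>k. \<exists>B. bracket_system (Suc e) r (C * (1 / 2) ^ k * (real k + 1) ^ e) B \<and>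
    ln (real (card B)) \<le> C * 2 ^ k * (real k + 1) ^ e"
proof -
  define q where "q = 2 powr (- 1 / (2 * r))"
  note q = q_bounds[OF r q_def]
  obtain C where C: "0 < C" "\<And>k N. (\<Sum>n<N. (real n + 1) ^ e * ((real (nat_dist n k) + 1) * q ^ nat_dist n k)) \<le> C * (real k + 1) ^ e"
    using sum_poly_geometric_dist_le[OF q(1,2)] by blast
  let ?d = "Suc e"
  have "\<exists>B. bracket_system ?d r (4 * C * (1 / 2) ^ k * (real k + 1) ^ e) B \<and>
    ln (real (card B)) \<le> 4 * C * 2 ^ k * (real k + 1) ^ e" for k
  proof -
    let ?t = "threshold r k"
    \<comment> \<open>The inequality says \<open>k < (N - k) / (2 * r)\<close>, that is
      \<open>1 < ?t N\<close>. The size of \<open>N\<close> is harmless, because the sums over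
      levels are bounded uniformly in \<open>N\<close>.\<close>
    obtain N :: nat where N: "real N > real k + 2 * r * real k" using reals_Archimedean2 by blast
    then have "real k < (real N - real k) / (2 * r)" using r by (simp add: field_simps)
    then have tN: "1 < ?t N" by (simp add: threshold_def)
    have "0 \<le> real k + 2 * r * real k" using r by simp
    then have "0 < real N" using N by linarith
    then have N1: "1 \<le> N" by simp
    let ?P = "profiles ?d (\<lambda>n. nat \<lfloor>1 / ?t n\<rfloor>) N"
    let ?B = "(\<lambda>p. (low ?d ?t N p, gap ?d ?t N p)) ` ?P"
    have cover: "\<exists>(l, g)\<in>?B. \<forall>x\<in>unit_cube ?d. l x \<le> \<nu> (lower_box ?d x) \<and> \<nu> (lower_box ?d x) \<le> l x + g x"
      if "subprob_content ?d \<nu>" for \<nu>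
      using profile_cover[OF that, of ?t N] threshold_pos N1 tN by simp
    have "subprob_content ?d (\<lambda>_. 0)" by (simp add: subprob_content_def)
    from cover[OF this] have ne: "?B \<noteq> {}" by auto
    have gap: "(\<integral>\<^sup>+x. ennreal (gap ?d ?t N p x powr r) \<partial>lebesgue_cube ?d)
        \<le> ennreal ((4 * C * (1 / 2) ^ k * (real k + 1) ^ e) powr r)" if "p \<in> ?P" for p
    proof -
      have "(4 * (1 / 2) ^ k * (\<Sum>n<N. (real n + 1) ^ e * ((real (nat_dist n k) + 1) * q ^ nat_dist n k))) powr r
          \<le> (4 * (1 / 2) ^ k * (C * (real k + 1) ^ e)) powr r"
        using q r C(2) by (intro powr_mono2 mult_left_mono mult_nonneg_nonneg sum_nonneg) auto
      then have "ennreal ((4 * (1 / 2) ^ k * (\<Sum>n<N. (real n + 1) ^ e * ((real (nat_dist n k) + 1) * q ^ nat_dist n k))) powr r)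
          \<le> ennreal ((4 * (1 / 2) ^ k * (C * (real k + 1) ^ e)) powr r)"
        by (rule ennreal_leI)
      then show ?thesis using order_trans[OF nn_integral_gap_le[OF r q_def that]] by (simp only: mult_ac)
    qed
    have "0 \<le> gap ?d ?t N p x" for p x
      unfolding gap_def using threshold_pos by (intro sum_nonneg) (auto simp: less_imp_le)
    then have sys: "bracket_system ?d r (4 * C * (1 / 2) ^ k * (real k + 1) ^ e) ?B"
      unfolding bracket_system_def using ne cover gap low_measurable gap_measurable finite_profiles by auto
    have "card ?B \<le> card ?P" by (intro card_image_le finite_profiles)
    moreover have "0 < card ?B" using ne finite_profiles by (simp add: card_gt_0_iff)
    ultimately have "ln (real (card ?B)) \<le> ln (real (card ?P))" by simp
    also have "\<dots> \<le> (\<Sum>n\<le>N. 2 * (real n + 1) ^ e * (1 / ?t n * ln (1 + 2 ^ n * ?t n) + 2 ^ n * ln (1 + 1 / (2 ^ n * ?t n))))"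
      by (rule ln_card_profiles) (rule threshold_pos)
    also have "\<dots> \<le> (\<Sum>n\<le>N. 2 * (real n + 1) ^ e * (2 * 2 ^ k * ((real (nat_dist n k) + 1) * q ^ nat_dist n k)))"
      by (intro sum_mono mult_left_mono entropy_term_le[OF r q_def]) auto
    also have "\<dots> = 4 * 2 ^ k * (\<Sum>n<Suc N. (real n + 1) ^ e * ((real (nat_dist n k) + 1) * q ^ nat_dist n k))"
      unfolding sum_distrib_left lessThan_Suc_atMost by (intro sum.cong refl) (simp add: mult_ac)
    also have "\<dots> \<le> 4 * 2 ^ k * (C * (real k + 1) ^ e)" by (intro mult_left_mono C(2)) auto
    finally have "ln (real (card ?B)) \<le> 4 * C * 2 ^ k * (real k + 1) ^ e" by (simp add: mult_ac)
    then show ?thesis using sys by blast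
  qed
  then show ?thesis using C(1) by (intro exI[of _ "4 * C"]) auto
qed

lemma bracket_system_mono:
  assumes "bracket_system d r s B" "0 \<le> s" "s \<le> s'" "0 \<le> r"
  shows "bracket_system d r s' B"
proof -
  have "s powr r \<le> s' powr r" using assms by (intro powr_mono2) auto
  then have le: "ennreal (s powr r) \<le> ennreal (s' powr r)" by (rule ennreal_leI)
  have "(\<integral>\<^sup>+x. ennreal (g x powr r) \<partial>lebesgue_cube d) \<le> ennreal (s' powr r)" if "(l, g) \<in> B" for l g
    by (rule order_trans[OF _ le]) (use assms(1) that in \<open>auto simp: bracket_system_def\<close>)
  then show ?thesis using assms(1) by (auto simp: bracket_system_def)
qed

text \<open>With \<open>z = y * L ^ e\<close> and \<open>z \<le> 2 ^ k \<le> 2 * z\<close>, the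
  factor \<open>L ^ e\<close> in \<open>z\<close> cancels \<open>(k + 1) ^ e\<close> in the size up
  to a constant. In the entropy it joins another \<open>(k + 1) ^ e\<close>; this is why the
  exponent of the logarithm is \<open>2 * e\<close>.\<close>

lemma bracket_system_exists:
  assumes r: "1 \<le> r"
  shows "\<exists>C>0. \<forall>y\<ge>1. \<exists>B. bracket_system (Suc e) r (C / y) B \<and>
    ln (real (card B)) \<le> C * y * (1 + ln y) ^ (2 * e)"
proof -
  obtain C where C: "0 < C" "\<And>k. \<exists>B. bracket_system (Suc e) r (C * (1 / 2) ^ k * (real k + 1) ^ e) B \<and>
      ln (real (card B)) \<le> C * 2 ^ k * (real k + 1) ^ e"
    using bracket_system_dyadic[OF r] by blast
  \<comment> \<open>Chosen to give \<open>k + 1 \<le> c * L\<close>, using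
    \<open>log 2 z \<le> 2 * ln z\<close> and \<open>ln z = L - 1 + e * ln L\<close>.\<close>
  define c where "c = 3 + 2 * real e"
  have "\<exists>B. bracket_system (Suc e) r (2 * C * c ^ e / y) B \<and>
    ln (real (card B)) \<le> 2 * C * c ^ e * y * (1 + ln y) ^ (2 * e)" if y: "1 \<le> y" for y
  proof -
    define L where "L = 1 + ln y"
    have L: "1 \<le> L" using y by (simp add: L_def)
    define z where "z = y * L ^ e"
    have z: "1 \<le> z" using y L mult_mono[of 1 y 1 "L ^ e"] by (simp add: z_def)
    define k where "k = nat \<lceil>log 2 z\<rceil>"
    have k: "log 2 z \<le> real k" "real k \<le> log 2 z + 1" using z by (auto simp: k_def)
    have "z = 2 powr log 2 z" using z by simp
    also have "\<dots> \<le> 2 powr real k" using k by (intro powr_mono) auto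
    finally have zk: "z \<le> 2 ^ k" by (simp add: powr_realpow)
    have "2 powr real k \<le> 2 powr (log 2 z + 1)" using k by (intro powr_mono) auto
    also have "\<dots> = 2 * z" using z by (simp add: powr_add)
    finally have kz: "2 ^ k \<le> 2 * z" by (simp add: powr_realpow)
    have ln2: "1 / ln 2 \<le> (2::real)" using ln2_ge_two_thirds by (simp add: field_simps)
    have lnz: "ln z = ln y + real e * ln L" using y L by (simp add: z_def ln_mult ln_realpow)
    have "log 2 z = 1 / ln 2 * ln z" by (simp add: log_def)
    also have "\<dots> \<le> 2 * ln z" using ln2 z by (intro mult_right_mono) auto
    finally have "log 2 z \<le> 2 * (L - 1) + 2 * (real e * ln L)" using lnz by (simp add: L_def)
    moreover have "real e * ln L \<le> real e * L" using L ln_le_minus_one[of L] by (intro mult_left_mono) auto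
    ultimately have "real k + 1 \<le> 2 * (L - 1) + 2 * (real e * L) + 2" using k by simp
    also have "\<dots> \<le> c * L" using L by (simp add: c_def algebra_simps)
    finally have "real k + 1 \<le> c * L" .
    then have kc: "(real k + 1) ^ e \<le> c ^ e * L ^ e"
      unfolding power_mult_distrib[symmetric] by (intro power_mono) auto
    obtain B where B: "bracket_system (Suc e) r (C * (1 / 2) ^ k * (real k + 1) ^ e) B"
      "ln (real (card B)) \<le> C * 2 ^ k * (real k + 1) ^ e" using C(2) by blast
    have c: "0 \<le> c ^ e" by (simp add: c_def)
    have "C * (1 / 2) ^ k * (real k + 1) ^ e \<le> C * (1 / z) * (c ^ e * L ^ e)"
      using zk z kc C(1) by (intro mult_mono) (auto simp: power_divide intro!: divide_left_mono)
    also have "\<dots> = C * c ^ e / y" using L y by (simp add: z_def)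
    also have "\<dots> \<le> 2 * C * c ^ e / y" using C(1) c y by (intro divide_right_mono) auto
    finally have 1: "bracket_system (Suc e) r (2 * C * c ^ e / y) B"
      using C(1) r by (intro bracket_system_mono[OF B(1)]) auto
    have "C * 2 ^ k * (real k + 1) ^ e \<le> C * (2 * z) * (c ^ e * L ^ e)"
      using kz z kc C(1) by (intro mult_mono) auto
    also have "\<dots> = 2 * C * c ^ e * y * L ^ (2 * e)"
      by (simp add: z_def mult_2[of e] power_add)
    finally have "ln (real (card B)) \<le> 2 * C * c ^ e * y * L ^ (2 * e)" using B(2) by linarith
    with 1 show ?thesis unfolding L_def by blast
  qed
  moreover have "0 < 2 * C * c ^ e" using C(1) by (simp add: c_def add_pos_nonneg)
  ultimately show ?thesis by (intro exI[of _ "2 * C * c ^ e"] conjI allI impI)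
qed

subsection \<open>Decomposition of a function of bounded sectional variation\<close>

text \<open>The empty set is a disjoint union of infinitely many copies of itself, and a constant
  series converges only if its terms vanish.\<close>

lemma signed_measure_empty:
  assumes "signed_measure \<Omega> \<nu>"
  shows "\<nu> {} = 0"
proof -
  have "(\<lambda>i::nat. \<nu> {}) sums \<nu> (\<Union>i::nat. {})"
    using assms unfolding signed_measure_def by (auto simp: disjoint_family_on_def)
  then have "summable (\<lambda>i::nat. \<nu> {})" by (rule sums_summable)
  then have "(\<lambda>i::nat. \<nu> {}) \<longlonglongrightarrow> 0" by (rule summable_LIMSEQ_zero)
  then show ?thesis by (simp add: LIMSEQ_const_iff)
qed

lemma signed_measure_Un:
  assumes \<nu>: "signed_measure \<Omega> \<nu>" and A: "A \<in> sets \<Omega>" "B \<in> sets \<Omega>" "A \<inter> B = {}"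
  shows "\<nu> (A \<union> B) = \<nu> A + \<nu> B"
proof -
  let ?F = "binaryset A B"
  have "range ?F \<subseteq> sets \<Omega>" "disjoint_family ?F"
    using A by (auto simp: range_binaryset_eq binaryset_def disjoint_family_on_def)
  then have "(\<lambda>i. \<nu> (?F i)) sums \<nu> (\<Union>i. ?F i)"
    using \<nu> unfolding signed_measure_def by blast
  moreover have "(\<lambda>i. \<nu> (?F i)) sums (\<nu> A + \<nu> B)"
    by (rule binaryset_sums) (rule signed_measure_empty[OF \<nu>])
  ultimately show ?thesis by (simp add: UN_binaryset_eq sums_unique2)
qed

lemma abs_signed_measure_le:
  assumes \<nu>: "signed_measure \<Omega> \<nu>" and tv: "total_variation \<Omega> \<nu> \<le> ennreal K" "0 \<le> K" and B: "B \<in> sets \<Omega>"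
  shows "\<bar>\<nu> B\<bar> \<le> K"
proof (cases "B = {}")
  case True
  then show ?thesis using signed_measure_empty[OF \<nu>] tv by simp
next
  case False
  \<comment> \<open>Parts of a partition must be nonempty, so the complement is removed if
    \<open>B\<close> is the whole space.\<close>
  let ?P = "{B, space \<Omega> - B} - {{}}"
  have P: "finite ?P" "?P \<subseteq> sets \<Omega>" "partition_on (space \<Omega>) ?P"
    using B sets.sets_into_space[OF B] by (auto simp: partition_on_def disjoint_def)
  have "ennreal \<bar>\<nu> B\<bar> \<le> (\<Sum>A\<in>?P. ennreal \<bar>\<nu> A\<bar>)"
    using False by (intro member_le_sum) auto
  also have "\<dots> \<le> total_variation \<Omega> \<nu>"
    unfolding total_variation_def using P by (intro SUP_upper) auto
  finally have "ennreal \<bar>\<nu> B\<bar> \<le> ennreal K" using tv(1) by (rule order_trans)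
  then show ?thesis using tv(2) by simp
qed

text \<open>Only finite additivity is needed below, so this supremum replaces a Hahn decomposition.\<close>

definition positive_part :: "'a measure \<Rightarrow> ('a set \<Rightarrow> real) \<Rightarrow> 'a set \<Rightarrow> real" where
  "positive_part \<Omega> \<nu> A = (SUP B \<in> {B \<in> sets \<Omega>. B \<subseteq> A}. \<nu> B)"

context
  fixes \<Omega> :: "'a measure" and \<nu> :: "'a set \<Rightarrow> real" and K :: real
  assumes \<nu>: "signed_measure \<Omega> \<nu>" and K: "\<And>B. B \<in> sets \<Omega> \<Longrightarrow> \<bar>\<nu> B\<bar> \<le> K"
begin

lemma positive_part_upper:
  assumes "B \<in> sets \<Omega>" "B \<subseteq> A"
  shows "\<nu> B \<le> positive_part \<Omega> \<nu> A"
  unfolding positive_part_def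
proof (rule cSUP_upper)
  show "bdd_above (\<nu> ` {B \<in> sets \<Omega>. B \<subseteq> A})"
    using K by (intro bdd_aboveI[of _ K]) (auto simp: abs_le_iff)
qed (use assms in auto)

lemma positive_part_least:
  assumes "\<And>B. B \<in> sets \<Omega> \<Longrightarrow> B \<subseteq> A \<Longrightarrow> \<nu> B \<le> c"
  shows "positive_part \<Omega> \<nu> A \<le> c"
  unfolding positive_part_def using assms by (intro cSUP_least) auto

lemma positive_part_nonneg: "0 \<le> positive_part \<Omega> \<nu> A"
  using positive_part_upper[of "{}" A] signed_measure_empty[OF \<nu>] by simp

lemma positive_part_le: "positive_part \<Omega> \<nu> A \<le> K"
  using K by (intro positive_part_least) (auto simp: abs_le_iff)

text \<open>A subset of the union splits along \<open>A\<close> and \<open>A'\<close>, which gives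
  one inequality. For the other, subsets of \<open>A\<close> and of \<open>A'\<close> are joined,
  with one supremum taken at a time.\<close>

lemma positive_part_Un:
  assumes A: "A \<in> sets \<Omega>" "A' \<in> sets \<Omega>" "A \<inter> A' = {}"
  shows "positive_part \<Omega> \<nu> (A \<union> A') = positive_part \<Omega> \<nu> A + positive_part \<Omega> \<nu> A'"
proof (rule antisym)
  show "positive_part \<Omega> \<nu> (A \<union> A') \<le> positive_part \<Omega> \<nu> A + positive_part \<Omega> \<nu> A'"
  proof (rule positive_part_least)
    fix B assume B: "B \<in> sets \<Omega>" "B \<subseteq> A \<union> A'"
    have "\<nu> ((B \<inter> A) \<union> (B \<inter> A')) = \<nu> (B \<inter> A) + \<nu> (B \<inter> A')"
      using A B by (intro signed_measure_Un[OF \<nu>]) auto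
    moreover have "(B \<inter> A) \<union> (B \<inter> A') = B" using B by auto
    moreover have "\<nu> (B \<inter> A) \<le> positive_part \<Omega> \<nu> A" "\<nu> (B \<inter> A') \<le> positive_part \<Omega> \<nu> A'"
      using A B by (auto intro!: positive_part_upper)
    ultimately show "\<nu> B \<le> positive_part \<Omega> \<nu> A + positive_part \<Omega> \<nu> A'" by simp
  qed
  have "positive_part \<Omega> \<nu> A \<le> positive_part \<Omega> \<nu> (A \<union> A') - positive_part \<Omega> \<nu> A'"
  proof (rule positive_part_least)
    fix B assume B: "B \<in> sets \<Omega>" "B \<subseteq> A"
    have "positive_part \<Omega> \<nu> A' \<le> positive_part \<Omega> \<nu> (A \<union> A') - \<nu> B"
    proof (rule positive_part_least)
      fix B' assume B': "B' \<in> sets \<Omega>" "B' \<subseteq> A'"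
      have "\<nu> (B \<union> B') = \<nu> B + \<nu> B'" using B B' A by (intro signed_measure_Un[OF \<nu>]) auto
      moreover have "\<nu> (B \<union> B') \<le> positive_part \<Omega> \<nu> (A \<union> A')"
        using B B' by (intro positive_part_upper) auto
      ultimately show "\<nu> B' \<le> positive_part \<Omega> \<nu> (A \<union> A') - \<nu> B" by simp
    qed
    then show "\<nu> B \<le> positive_part \<Omega> \<nu> (A \<union> A') - positive_part \<Omega> \<nu> A'" by simp
  qed
  then show "positive_part \<Omega> \<nu> A + positive_part \<Omega> \<nu> A' \<le> positive_part \<Omega> \<nu> (A \<union> A')" by simp
qed

end

lemma sum_Pow_insert:
  fixes h :: "'a set \<Rightarrow> real"
  assumes "finite D" "a \<notin> D"
  shows "(\<Sum>s\<in>Pow (insert a D). h s) = (\<Sum>s\<in>Pow D. h s) + (\<Sum>s\<in>Pow D. h (insert a s))"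
proof -
  have "inj_on (insert a) (Pow D)" using assms(2) by (auto simp: inj_on_def)
  then show ?thesis
    using assms by (subst Pow_insert, subst sum.union_disjoint) (auto simp: sum.reindex)
qed

text \<open>Moebius inversion on the lattice of subsets. In the induction, the subsets with
  \<open>a\<close> yield the inversion for \<open>h \<circ> insert a\<close> minus the one for
  \<open>h\<close>, and the latter cancels the subsets without \<open>a\<close>; hence
  \<open>h\<close> is arbitrary.\<close>

lemma sum_Pow_mobius:
  fixes h :: "'a set \<Rightarrow> real"
  assumes "finite D"
  shows "(\<Sum>s\<in>Pow D. \<Sum>t\<in>Pow s. (- 1) ^ card t * h (s - t)) = h D"
  using assms
proof (induction D arbitrary: h rule: finite_induct)
  case (insert a D)
  have "(\<Sum>t\<in>Pow (insert a s). (- 1) ^ card t * h (insert a s - t))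
      = (\<Sum>t\<in>Pow s. (- 1) ^ card t * h (insert a (s - t))) - (\<Sum>t\<in>Pow s. (- 1) ^ card t * h (s - t))"
    if "s \<in> Pow D" for s
  proof -
    have s: "finite s" "a \<notin> s" using that insert finite_subset by auto
    have "(\<Sum>t\<in>Pow s. (- 1) ^ card t * h (insert a s - t)) = (\<Sum>t\<in>Pow s. (- 1) ^ card t * h (insert a (s - t)))"
    proof (intro sum.cong refl)
      fix t assume "t \<in> Pow s"
      then have "insert a s - t = insert a (s - t)" using s by auto
      then show "(- 1) ^ card t * h (insert a s - t) = (- 1) ^ card t * h (insert a (s - t))" by simp
    qed
    moreover have "(\<Sum>t\<in>Pow s. (- 1) ^ card (insert a t) * h (insert a s - insert a t))
        = - (\<Sum>t\<in>Pow s. (- 1) ^ card t * h (s - t))"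
      unfolding sum_negf[symmetric]
    proof (intro sum.cong refl)
      fix t assume "t \<in> Pow s"
      then have "insert a s - insert a t = s - t" "card (insert a t) = Suc (card t)"
        using s finite_subset by (auto intro!: card_insert_disjoint)
      then show "(- 1) ^ card (insert a t) * h (insert a s - insert a t) = - ((- 1) ^ card t * h (s - t))" by simp
    qed
    ultimately show ?thesis unfolding sum_Pow_insert[OF s] by simp
  qed
  then have "(\<Sum>s\<in>Pow D. \<Sum>t\<in>Pow (insert a s). (- 1) ^ card t * h (insert a s - t))
      = (\<Sum>s\<in>Pow D. \<Sum>t\<in>Pow s. (- 1) ^ card t * h (insert a (s - t)))
        - (\<Sum>s\<in>Pow D. \<Sum>t\<in>Pow s. (- 1) ^ card t * h (s - t))"
    by (simp add: sum_subtractf)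
  also have "(\<Sum>s\<in>Pow D. \<Sum>t\<in>Pow s. (- 1) ^ card t * h (insert a (s - t))) = h (insert a D)"
    by (rule insert.IH)
  finally show ?case unfolding sum_Pow_insert[OF insert.hyps(1,2)] by simp
qed simp

text \<open>Embeds the face of \<open>s\<close> into the cube. The images of the faces for nonempty
  \<open>s\<close>, together with the origin, partition the cube, so all section measures can be
  carried by one content on it.\<close>

definition zero_fill :: "nat \<Rightarrow> nat set \<Rightarrow> (nat \<Rightarrow> real) \<Rightarrow> nat \<Rightarrow> real" where
  "zero_fill d s y = (\<lambda>j\<in>{1..d}. if j \<in> s then y j else 0)"

lemma space_face: "space (face s) = (\<Pi>\<^sub>E j\<in>s. {0<..1})"
  by (simp add: face_def space_PiM space_restrict_space)

lemma zero_fill_measurable: "zero_fill d s \<in> face s \<rightarrow>\<^sub>M lebesgue_cube d"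
  unfolding zero_fill_def lebesgue_cube_def
proof (rule measurable_restrict)
  fix j
  show "(\<lambda>y. if j \<in> s then y j else 0) \<in> face s \<rightarrow>\<^sub>M restrict_space lborel {0..1}"
  proof (rule measurable_restrict_space2)
    show "(\<lambda>y. if j \<in> s then y j else 0) \<in> space (face s) \<rightarrow> {0..1}"
      by (force simp: space_face PiE_iff)
    show "(\<lambda>y. if j \<in> s then y j else 0) \<in> face s \<rightarrow>\<^sub>M lborel"
    proof (cases "j \<in> s")
      case True
      then have "(\<lambda>y. y j) \<in> face s \<rightarrow>\<^sub>M restrict_space borel {0<..1}"
        unfolding face_def by (rule measurable_component_singleton)
      then have "(\<lambda>y. y j) \<in> face s \<rightarrow>\<^sub>M borel" by (simp add: measurable_restrict_space2_iff)
      then show ?thesis using True by simp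
    qed simp
  qed
qed

lemma zero_fill_vimage_lower_box:
  assumes s: "s \<subseteq> {1..d}" and x: "x \<in> unit_cube d"
  shows "zero_fill d s -` lower_box d x \<inter> space (face s) = (\<Pi>\<^sub>E j\<in>s. {0<..x j})"
proof -
  have x': "0 \<le> x j" "x j \<le> 1" if "j \<in> {1..d}" for j using x that by (auto simp: unit_cube_def)
  show ?thesis
  proof (intro equalityI subsetI)
    fix y assume y: "y \<in> zero_fill d s -` lower_box d x \<inter> space (face s)"
    then have "y j \<le> x j" if "j \<in> s" for j
      using s that by (auto simp: lower_box_def zero_fill_def dest!: bspec[of _ _ j] split: if_splits)
    then show "y \<in> (\<Pi>\<^sub>E j\<in>s. {0<..x j})" using y by (auto simp: space_face PiE_iff)
  next
    fix y assume y: "y \<in> (\<Pi>\<^sub>E j\<in>s. {0<..x j})"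
    then have y': "0 < y j" "y j \<le> x j" if "j \<in> s" for j
      using that by (auto simp: PiE_iff)
    have y1: "y j \<le> 1" if "j \<in> s" for j
      using y'(2)[OF that] x'(2)[of j] that s by force
    have "y \<in> space (face s)" using y y' y1 by (auto simp: space_face PiE_iff)
    moreover have "zero_fill d s y \<in> lower_box d x"
      using y' y1 x' by (auto simp: lower_box_def unit_cube_def zero_fill_def less_imp_le)
    ultimately show "y \<in> zero_fill d s -` lower_box d x \<inter> space (face s)" by simp
  qed
qed

lemma generates_sect_lower_box:
  assumes \<nu>: "generates s (sect d s f) \<nu>" and s: "s \<subseteq> {1..d}" and x: "x \<in> unit_cube d"
  shows "\<nu> (\<Pi>\<^sub>E j\<in>s. {0<..x j}) = (\<Sum>t\<in>Pow s. (- 1) ^ card t * f (zero_fill d (s - t) x))"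
proof -
  have "(\<lambda>j\<in>s. 0::real) \<in> (\<Pi>\<^sub>E j\<in>s. {0..1})" "restrict x s \<in> (\<Pi>\<^sub>E j\<in>s. {0..1})"
    using s x by (auto simp: unit_cube_def PiE_iff)
  moreover have "\<forall>j\<in>s. (\<lambda>j\<in>s. 0) j \<le> restrict x s j" using s x by (auto simp: unit_cube_def)
  ultimately have "\<nu> (\<Pi>\<^sub>E j\<in>s. {(\<lambda>j\<in>s. 0) j<..restrict x s j}) = box_increment s (sect d s f) (\<lambda>j\<in>s. 0) (restrict x s)"
    using \<nu> unfolding generates_def by blast
  moreover have "(\<Pi>\<^sub>E j\<in>s. {(\<lambda>j\<in>s. 0) j<..restrict x s j}) = (\<Pi>\<^sub>E j\<in>s. {0<..x j})"
    by (intro PiE_cong) simp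
  moreover have "box_increment s (sect d s f) (\<lambda>j\<in>s. 0) (restrict x s) = (\<Sum>t\<in>Pow s. (- 1) ^ card t * f (zero_fill d (s - t) x))"
    unfolding box_increment_def sect_def zero_fill_def
    by (intro sum.cong refl arg_cong2[where f = "(*)"] arg_cong[where f = f]) (auto simp: restrict_def fun_eq_iff)
  ultimately show ?thesis by simp
qed

text \<open>The mass of the box from \<open>0\<close> to \<open>x\<close> in the face of
  \<open>s\<close> is an alternating sum of the values \<open>f (zero_fill d u x)\<close> with
  \<open>u \<subseteq> s\<close>. Summing over \<open>s\<close> inverts this; \<open>s = {}\<close>
  accounts for the value at the origin.\<close>

lemma sectional_decomposition:
  assumes \<nu>: "\<And>s. s \<in> Pow {1..d} - {{}} \<Longrightarrow> generates s (sect d s f) (\<nu> s)" and x: "x \<in> unit_cube d"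
  shows "f x = f (\<lambda>j\<in>{1..d}. 0) + (\<Sum>s\<in>Pow {1..d} - {{}}. \<nu> s (zero_fill d s -` lower_box d x \<inter> space (face s)))"
proof -
  have "f x = f (zero_fill d {1..d} x)"
    using x by (intro arg_cong[where f = f]) (auto simp: zero_fill_def unit_cube_def fun_eq_iff PiE_iff extensional_def)
  also have "\<dots> = (\<Sum>s\<in>Pow {1..d}. \<Sum>t\<in>Pow s. (- 1) ^ card t * f (zero_fill d (s - t) x))"
    by (rule sum_Pow_mobius[symmetric]) simp
  also have "\<dots> = f (zero_fill d {} x) + (\<Sum>s\<in>Pow {1..d} - {{}}. \<Sum>t\<in>Pow s. (- 1) ^ card t * f (zero_fill d (s - t) x))"
    by (subst sum.remove[of _ "{}"]) auto
  also have "zero_fill d {} x = (\<lambda>j\<in>{1..d}. 0)" by (simp add: zero_fill_def)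
  also have "(\<Sum>s\<in>Pow {1..d} - {{}}. \<Sum>t\<in>Pow s. (- 1) ^ card t * f (zero_fill d (s - t) x))
      = (\<Sum>s\<in>Pow {1..d} - {{}}. \<nu> s (zero_fill d s -` lower_box d x \<inter> space (face s)))"
    using generates_sect_lower_box[OF \<nu> _ x] zero_fill_vimage_lower_box[OF _ x] by (intro sum.cong refl) auto
  finally show ?thesis .
qed

text \<open>The section measures are pushed forward to the cube and normalised by \<open>c\<close>;
  \<open>a\<close> is the mass of an atom at the origin, which no face with nonempty
  \<open>s\<close> reaches.\<close>

lemma subprob_content_zero_fill:
  assumes S: "finite S" and c: "0 < c" "0 \<le> a" "a + real (card S) * K \<le> c"
    and \<mu>: "\<And>s A. s \<in> S \<Longrightarrow> A \<in> sets (face s) \<Longrightarrow> 0 \<le> \<mu> s A"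
      "\<And>s A B. s \<in> S \<Longrightarrow> A \<in> sets (face s) \<Longrightarrow> B \<in> sets (face s) \<Longrightarrow> A \<inter> B = {} \<Longrightarrow> \<mu> s (A \<union> B) = \<mu> s A + \<mu> s B"
      "\<And>s A. s \<in> S \<Longrightarrow> A \<in> sets (face s) \<Longrightarrow> \<mu> s A \<le> K"
  shows "subprob_content d (\<lambda>A. (a * indicator A (\<lambda>j\<in>{1..d}. 0) + (\<Sum>s\<in>S. \<mu> s (zero_fill d s -` A \<inter> space (face s)))) / c)"
proof -
  let ?e = "\<lambda>s A. zero_fill d s -` A \<inter> space (face s)"
  have e: "?e s A \<in> sets (face s)" if "A \<in> sets (lebesgue_cube d)" for s A
    using measurable_sets[OF zero_fill_measurable that] .
  have add: "(a * indicator (A \<union> B) z + (\<Sum>s\<in>S. \<mu> s (?e s (A \<union> B)))) / c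
      = (a * indicator A z + (\<Sum>s\<in>S. \<mu> s (?e s A))) / c + (a * indicator B z + (\<Sum>s\<in>S. \<mu> s (?e s B))) / c"
    if AB: "A \<in> sets (lebesgue_cube d)" "B \<in> sets (lebesgue_cube d)" "A \<inter> B = {}" for A B and z :: "nat \<Rightarrow> real"
  proof -
    have "\<mu> s (?e s (A \<union> B)) = \<mu> s (?e s A) + \<mu> s (?e s B)" if "s \<in> S" for s
    proof -
      have "?e s (A \<union> B) = ?e s A \<union> ?e s B" by auto
      then show ?thesis using \<mu>(2)[OF that e[OF AB(1)] e[OF AB(2)]] AB(3) by auto
    qed
    then have "(\<Sum>s\<in>S. \<mu> s (?e s (A \<union> B))) = (\<Sum>s\<in>S. \<mu> s (?e s A)) + (\<Sum>s\<in>S. \<mu> s (?e s B))"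
      by (simp add: sum.distrib)
    moreover have "indicator (A \<union> B) z = (indicator A z + indicator B z :: real)"
      using AB(3) by (auto simp: indicator_def)
    ultimately show ?thesis by (simp add: add_divide_distrib algebra_simps)
  qed
  have cube: "unit_cube d \<in> sets (lebesgue_cube d)"
    using sets.top[of "lebesgue_cube d"] by (simp add: space_lebesgue_cube)
  have "a * indicator (unit_cube d) z + (\<Sum>s\<in>S. \<mu> s (?e s (unit_cube d))) \<le> a + (\<Sum>s\<in>S. K)" for z
    using c \<mu>(3) e[OF cube] by (intro add_mono sum_mono) (auto simp: indicator_def)
  then have "(a * indicator (unit_cube d) z + (\<Sum>s\<in>S. \<mu> s (?e s (unit_cube d)))) / c \<le> 1" for z
    using c(1,3) order_trans by (fastforce simp: divide_le_eq_1_pos)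
  moreover have "0 \<le> (a * indicator A z + (\<Sum>s\<in>S. \<mu> s (?e s A))) / c" if "A \<in> sets (lebesgue_cube d)" for A z
    using c \<mu>(1) e[OF that] by (intro divide_nonneg_pos add_nonneg_nonneg sum_nonneg mult_nonneg_nonneg) auto
  ultimately show ?thesis unfolding subprob_content_def using add by blast
qed

text \<open>The constant \<open>c\<close> allows \<open>M\<close> for the atom at the origin and
  \<open>4 * M\<close> for each of at most \<open>2 ^ d\<close> sections.\<close>

lemma cadlag_class_decomposition:
  assumes M: "0 < M" and f: "f \<in> cadlag_class d M"
  defines "c \<equiv> M * (1 + 4 * 2 ^ d)"
  shows "\<exists>\<nu>\<^sub>1 \<nu>\<^sub>2. subprob_content d \<nu>\<^sub>1 \<and> subprob_content d \<nu>\<^sub>2 \<and>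
    (\<forall>x\<in>unit_cube d. f x = c * (\<nu>\<^sub>1 (lower_box d x) - \<nu>\<^sub>2 (lower_box d x)))"
proof -
  let ?S = "Pow {1..d} - {{}}" and ?z = "\<lambda>j\<in>{1..d}. 0::real"
  have S: "finite ?S" by simp
  have norm: "ennreal \<bar>f ?z\<bar> + (\<Sum>s\<in>?S. variation s (sect d s f)) \<le> ennreal M"
    using f by (simp add: cadlag_class_def sectional_variation_norm_def)
  have "ennreal \<bar>f ?z\<bar> \<le> ennreal \<bar>f ?z\<bar> + (\<Sum>s\<in>?S. variation s (sect d s f))" by simp
  then have "ennreal \<bar>f ?z\<bar> \<le> ennreal M" using norm by (rule order_trans)
  then have f0: "\<bar>f ?z\<bar> \<le> M" using M by simp
  have "\<exists>\<nu>. generates s (sect d s f) \<nu> \<and> total_variation (face s) \<nu> \<le> ennreal (2 * M)" if s: "s \<in> ?S" for s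
  proof -
    have "variation s (sect d s f) \<le> (\<Sum>s\<in>?S. variation s (sect d s f))"
      using s by (intro member_le_sum) auto
    also have "\<dots> \<le> ennreal \<bar>f ?z\<bar> + (\<Sum>s\<in>?S. variation s (sect d s f))" by simp
    also note norm
    \<comment> \<open>\<open>variation\<close> is an infimum; the strict bound produces a generating
      measure without the need to know that the infimum is attained.\<close>
    also have "ennreal M < ennreal (2 * M)" using M by (simp add: ennreal_less_iff)
    finally show ?thesis unfolding variation_def INF_less_iff by (auto intro: less_imp_le)
  qed
  then obtain \<nu> where \<nu>: "\<And>s. s \<in> ?S \<Longrightarrow> generates s (sect d s f) (\<nu> s)"
    "\<And>s. s \<in> ?S \<Longrightarrow> total_variation (face s) (\<nu> s) \<le> ennreal (2 * M)" by metis
  have sm: "signed_measure (face s) (\<nu> s)" if "s \<in> ?S" for s using \<nu>(1)[OF that] by (simp add: generates_def)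
  have bd: "\<bar>\<nu> s B\<bar> \<le> 2 * M" if "s \<in> ?S" "B \<in> sets (face s)" for s B
    using abs_signed_measure_le[OF sm[OF that(1)] \<nu>(2)[OF that(1)] _ that(2)] M by simp
  let ?p = "\<lambda>s. positive_part (face s) (\<nu> s)"
  have pp_nonneg: "0 \<le> ?p s A" and pp_le: "?p s A \<le> 2 * M" if "s \<in> ?S" for s A
    by (rule positive_part_nonneg[OF sm[OF that] bd[OF that]], assumption)
      (rule positive_part_le[OF sm[OF that] bd[OF that]])
  have pp_Un: "?p s (A \<union> B) = ?p s A + ?p s B"
    if "s \<in> ?S" "A \<in> sets (face s)" "B \<in> sets (face s)" "A \<inter> B = {}" for s A B
    by (rule positive_part_Un[OF sm[OF that(1)] bd[OF that(1)] that(2-4)])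
  have pp_upper: "\<nu> s A \<le> ?p s A" if "s \<in> ?S" "A \<in> sets (face s)" for s A
    by (rule positive_part_upper[OF sm[OF that(1)] bd[OF that(1)] that(2)]) auto
  have c: "0 < c" using M by (simp add: c_def add_pos_pos)
  have "card ?S \<le> card (Pow {1..d})" by (intro card_mono) auto
  then have "real (card ?S) \<le> 2 ^ d" by (simp add: card_Pow)
  then have "real (card ?S) * (4 * M) \<le> 2 ^ d * (4 * M)" using M by (intro mult_right_mono) auto
  then have cK: "a + real (card ?S) * (4 * M) \<le> c" if "a \<le> M" for a
    using that by (simp add: c_def algebra_simps)
  define \<nu>1 where "\<nu>1 A = (max 0 (f ?z) * indicator A ?z + (\<Sum>s\<in>?S. ?p s (zero_fill d s -` A \<inter> space (face s)))) / c" for A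
  \<comment> \<open>\<open>?p s B - \<nu> s B\<close> is the negative part. It is at most
    \<open>4 * M\<close>, since \<open>?p s B\<close> and \<open>\<bar>\<nu> s B\<bar>\<close> are
    at most \<open>2 * M\<close>.\<close>
  define \<nu>2 where "\<nu>2 A = (max 0 (- f ?z) * indicator A ?z
      + (\<Sum>s\<in>?S. (\<lambda>B. ?p s B - \<nu> s B) (zero_fill d s -` A \<inter> space (face s)))) / c" for A
  have "subprob_content d \<nu>1"
    unfolding \<nu>1_def
  proof (rule subprob_content_zero_fill[OF S c _ cK])
    show "max 0 (f ?z) \<le> M" using f0 M by auto
    show "?p s A \<le> 4 * M" if "s \<in> ?S" for s A using pp_le[OF that, of A] M by linarith
  qed (use pp_nonneg pp_Un in \<open>simp_all del: Pow_iff Diff_iff\<close>)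
  moreover have "subprob_content d \<nu>2"
    unfolding \<nu>2_def
  proof (rule subprob_content_zero_fill[OF S c _ cK])
    show "max 0 (- f ?z) \<le> M" using f0 M by auto
    show "?p s A - \<nu> s A \<le> 4 * M" if "s \<in> ?S" "A \<in> sets (face s)" for s A
      using pp_le[OF that(1), of A] bd[OF that] by linarith
    show "0 \<le> ?p s A - \<nu> s A" if "s \<in> ?S" "A \<in> sets (face s)" for s A
      using pp_upper[OF that] by simp
    show "?p s (A \<union> B) - \<nu> s (A \<union> B) = ?p s A - \<nu> s A + (?p s B - \<nu> s B)"
      if "s \<in> ?S" "A \<in> sets (face s)" "B \<in> sets (face s)" "A \<inter> B = {}" for s A B
      using pp_Un[OF that] signed_measure_Un[OF sm[OF that(1)] that(2-4)] by simp
  qed simp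
  moreover have "f x = c * (\<nu>1 (lower_box d x) - \<nu>2 (lower_box d x))" if x: "x \<in> unit_cube d" for x
  proof -
    have max_eq: "max 0 (f ?z) = f ?z + max 0 (- f ?z)" by auto
    have "?z \<in> lower_box d x" using x by (auto simp: lower_box_def unit_cube_def)
    then have "c * (\<nu>1 (lower_box d x) - \<nu>2 (lower_box d x)) =
        f ?z + (\<Sum>s\<in>?S. \<nu> s (zero_fill d s -` lower_box d x \<inter> space (face s)))"
      unfolding \<nu>1_def \<nu>2_def max_eq using c by (simp add: sum_subtractf field_simps)
    then show ?thesis by (simp only: sectional_decomposition[OF \<nu>(1) x])
  qed
  ultimately show ?thesis by blast
qed

subsection \<open>Bracketing numbers of the class\<close>

lemma ennreal_power_mono:
  assumes "x \<le> y" "0 \<le> p"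
  shows "ennreal_power x p \<le> ennreal_power y p"
proof (cases "y = \<infinity>")
  case False
  then have "y < top" by (simp add: less_top)
  then have "enn2real x \<le> enn2real y" using assms(1) by (intro enn2real_mono)
  then have "enn2real x powr p \<le> enn2real y powr p" using assms(2) by (intro powr_mono2) auto
  moreover have "x \<noteq> \<infinity>" using assms(1) False by (auto simp: top_unique)
  ultimately show ?thesis using False by (simp add: ennreal_power_def ennreal_leI)
qed (simp add: ennreal_power_def)

lemma ennreal_power_ennreal: "0 \<le> a \<Longrightarrow> ennreal_power (ennreal a) p = ennreal (a powr p)"
  by (simp add: ennreal_power_def)

lemma Lr_norm_le:
  assumes "1 \<le> r" "0 \<le> a" "(\<integral>\<^sup>+x. ennreal (\<bar>f x\<bar> powr r) \<partial>M) \<le> ennreal (a powr r)"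
  shows "Lr_norm M r f \<le> ennreal a"
proof -
  have "Lr_norm M r f \<le> ennreal_power (ennreal (a powr r)) (1 / r)"
    unfolding Lr_norm_def using assms by (intro ennreal_power_mono) auto
  also have "\<dots> = ennreal a" using assms by (simp add: ennreal_power_ennreal powr_powr)
  finally show ?thesis .
qed

lemma powr_add_le:
  fixes a b r :: real
  assumes "0 \<le> a" "0 \<le> b" "0 \<le> r"
  shows "(a + b) powr r \<le> 2 powr r * (a powr r + b powr r)"
proof -
  have "(a + b) powr r \<le> (2 * max a b) powr r" using assms by (intro powr_mono2) auto
  also have "\<dots> = 2 powr r * max a b powr r" by (rule powr_mult)
  also have "\<dots> \<le> 2 powr r * (a powr r + b powr r)" by (intro mult_left_mono) (auto simp: max_def)
  finally show ?thesis .
qed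

lemma bracketing_number_le:
  assumes I: "finite I"
    and lu: "\<And>i. i \<in> I \<Longrightarrow> l i \<in> borel_measurable P" "\<And>i. i \<in> I \<Longrightarrow> u i \<in> borel_measurable P"
      "\<And>i x. i \<in> I \<Longrightarrow> x \<in> space P \<Longrightarrow> l i x \<le> u i x"
      "\<And>i. i \<in> I \<Longrightarrow> Lr_norm P r (\<lambda>x. u i x - l i x) \<le> ennreal \<epsilon>"
    and F: "\<And>f. f \<in> F \<Longrightarrow> \<exists>i\<in>I. \<forall>x\<in>space P. l i x \<le> f x \<and> f x \<le> u i x"
  shows "bracketing_number P r \<epsilon> F \<le> enat (card I)"
proof -
  obtain h where h: "bij_betw h {0..<card I} I" using ex_bij_betw_nat_finite[OF I] by blast
  have hI: "h i \<in> I" if "i < card I" for i using h that by (auto simp: bij_betw_def)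
  have "\<exists>i<card I. \<forall>x\<in>space P. l (h i) x \<le> f x \<and> f x \<le> u (h i) x" if f: "f \<in> F" for f
  proof -
    obtain j where j: "j \<in> I" "\<forall>x\<in>space P. l j x \<le> f x \<and> f x \<le> u j x" using F[OF f] by blast
    have "j \<in> h ` {0..<card I}" using h j(1) by (simp add: bij_betw_def)
    then obtain i where "i < card I" "h i = j" by auto
    then show ?thesis using j by blast
  qed
  then show ?thesis
    unfolding bracketing_number_def using lu hI
    by (intro Inf_lower CollectI exI[of _ "card I"] exI[of _ "\<lambda>i. l (h i)"] exI[of _ "\<lambda>i. u (h i)"] conjI) auto
qed

lemma bracketing_entropy_le:
  assumes "bracketing_number P r \<epsilon> F \<le> enat n" "1 \<le> n"
  shows "bracketing_entropy P r \<epsilon> F \<le> ennreal (ln (real n))"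
proof -
  obtain m where m: "bracketing_number P r \<epsilon> F = enat m" "m \<le> n"
    using assms(1) by (cases "bracketing_number P r \<epsilon> F") auto
  \<comment> \<open>If \<open>m = 0\<close>, the convention \<open>ln 0 = 0\<close> applies, and
    \<open>1 \<le> n\<close> makes the right-hand side nonnegative.\<close>
  have "ln (real m) \<le> ln (real n)" using m assms(2) by (cases "m = 0") auto
  then show ?thesis unfolding bracketing_entropy_def m(1) by (simp add: ennreal_leI)
qed

section \<open>Entropy of the class under a dominated distribution\<close>

context
  fixes d :: nat and r M c :: real and P :: "(nat \<Rightarrow> real) measure"
  assumes r: "1 \<le> r" and M: "0 < M" and c: "0 < c" and P: "sets P = sets (lebesgue_cube d)"
    and norm: "\<And>f. f \<in> borel_measurable (lebesgue_cube d) \<Longrightarrow>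
      Lr_norm P r f \<le> ennreal c * Lr_norm (lebesgue_cube d) r f"
begin

lemma space_P: "space P = unit_cube d"
  using sets_eq_imp_space_eq[OF P] by (simp add: space_lebesgue_cube)

lemma measurable_P: "borel_measurable P = borel_measurable (lebesgue_cube d)"
  by (rule measurable_cong_sets[OF P refl])

lemma Lr_norm_P_le:
  assumes "f \<in> borel_measurable (lebesgue_cube d)" "0 \<le> a"
    and "(\<integral>\<^sup>+x. ennreal (\<bar>f x\<bar> powr r) \<partial>lebesgue_cube d) \<le> ennreal (a powr r)" "c * a \<le> \<epsilon>"
  shows "Lr_norm P r f \<le> ennreal \<epsilon>"
proof -
  have "Lr_norm P r f \<le> ennreal c * ennreal a"
    using norm[OF assms(1)] Lr_norm_le[OF r assms(2,3)] by (meson mult_left_mono order_trans zero_le)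
  also have "\<dots> = ennreal (c * a)" using c assms(2) by (simp add: ennreal_mult)
  also have "\<dots> \<le> ennreal \<epsilon>" using assms(4) by (rule ennreal_leI)
  finally show ?thesis .
qed

text \<open>Both contents take values between \<open>0\<close> and \<open>1\<close>, so the whole
  class lies in one bracket between two constants.\<close>

lemma bracketing_entropy_cadlag_class_eq_0:
  assumes \<epsilon>: "c * (2 * (M * (1 + 4 * 2 ^ d))) \<le> \<epsilon>"
  shows "bracketing_entropy P r \<epsilon> (cadlag_class d M) \<le> 0"
proof -
  let ?m = "M * (1 + 4 * 2 ^ d)"
  have m: "0 < ?m" using M by (simp add: add_pos_pos)
  have "bracketing_number P r \<epsilon> (cadlag_class d M) \<le> enat (card {()})"
  proof (rule bracketing_number_le[where l = "\<lambda>_ _. - ?m" and u = "\<lambda>_ _. ?m"])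
    show "Lr_norm P r (\<lambda>x. ?m - - ?m) \<le> ennreal \<epsilon>"
    proof (rule Lr_norm_P_le[OF _ _ _ \<epsilon>])
      interpret prob_space "lebesgue_cube d" by (rule prob_space_lebesgue_cube)
      show "(\<integral>\<^sup>+x. ennreal (\<bar>?m - - ?m\<bar> powr r) \<partial>lebesgue_cube d) \<le> ennreal ((2 * ?m) powr r)"
        using m by (simp add: emeasure_space_1)
    qed (use m in auto)
    fix f assume "f \<in> cadlag_class d M"
    then obtain \<nu>1 \<nu>2 where \<nu>: "subprob_content d \<nu>1" "subprob_content d \<nu>2"
      "\<forall>x\<in>unit_cube d. f x = ?m * (\<nu>1 (lower_box d x) - \<nu>2 (lower_box d x))"
      using cadlag_class_decomposition[OF M] by blast
    have "- ?m \<le> f x \<and> f x \<le> ?m" if "x \<in> unit_cube d" for x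
    proof -
      have "\<bar>\<nu>1 (lower_box d x) - \<nu>2 (lower_box d x)\<bar> \<le> 1"
        using content_nonneg[OF \<nu>(1) lower_box_sets, of x] content_le_1[OF \<nu>(1) lower_box_sets, of x]
          content_nonneg[OF \<nu>(2) lower_box_sets, of x] content_le_1[OF \<nu>(2) lower_box_sets, of x] by linarith
      then have "?m * \<bar>\<nu>1 (lower_box d x) - \<nu>2 (lower_box d x)\<bar> \<le> ?m * 1" using m by (intro mult_left_mono) auto
      then have "\<bar>f x\<bar> \<le> ?m" using \<nu>(3) that M by (simp add: abs_mult)
      then show ?thesis by linarith
    qed
    then show "\<exists>i\<in>{()}. \<forall>x\<in>space P. - ?m \<le> f x \<and> f x \<le> ?m" by (simp add: space_P)
  qed (use m in auto)
  then have "bracketing_entropy P r \<epsilon> (cadlag_class d M) \<le> ennreal (ln (real (card {()})))"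
    by (rule bracketing_entropy_le) simp
  then show ?thesis by simp
qed

text \<open>A bracket of \<open>\<nu>1\<close> and one of \<open>\<nu>2\<close> give a bracket of
  the difference, so the number of brackets is squared and its logarithm doubled. In the size, one
  factor \<open>2\<close> comes from \<open>powr_add_le\<close> and one from
  \<open>2 \<le> 2 powr r\<close>.\<close>

lemma bracketing_entropy_cadlag_class_le_system:
  assumes B: "bracket_system d r s B" and s: "0 \<le> s"
    and \<epsilon>: "c * (4 * (M * (1 + 4 * 2 ^ d)) * s) \<le> \<epsilon>"
  shows "bracketing_entropy P r \<epsilon> (cadlag_class d M) \<le> ennreal (2 * ln (real (card B)))"
proof -
  let ?m = "M * (1 + 4 * 2 ^ d)"
  let ?l = "\<lambda>((l1, g1), (l2, g2)) x. ?m * (l1 x - (l2 x + g2 x))"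
  let ?u = "\<lambda>((l1, g1), (l2, g2)) x. ?m * (l1 x + g1 x - l2 x)"
  have m: "0 < ?m" using M by (simp add: add_pos_pos)
  have fin: "finite B" "B \<noteq> {}" using B by (auto simp: bracket_system_def)
  have sys: "l \<in> borel_measurable (lebesgue_cube d)" "g \<in> borel_measurable (lebesgue_cube d)" "0 \<le> g x"
      "(\<integral>\<^sup>+x. ennreal (g x powr r) \<partial>lebesgue_cube d) \<le> ennreal (s powr r)" if "(l, g) \<in> B" for l g x
    using B that by (auto simp: bracket_system_def)
  have "bracketing_number P r \<epsilon> (cadlag_class d M) \<le> enat (card (B \<times> B))"
  proof (rule bracketing_number_le[where l = ?l and u = ?u])
    fix i assume "i \<in> B \<times> B"
    then obtain l1 g1 l2 g2 where i: "i = ((l1, g1), (l2, g2))" "(l1, g1) \<in> B" "(l2, g2) \<in> B" by auto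
    note [measurable] = sys(1,2)[OF i(2)] sys(1,2)[OF i(3)]
    show "?l i \<in> borel_measurable P" "?u i \<in> borel_measurable P"
      unfolding measurable_P i(1) prod.case by measurable
    show "?l i x \<le> ?u i x" for x
      using sys(3)[OF i(2), of x] sys(3)[OF i(3), of x] m unfolding i(1) prod.case
      by (intro mult_left_mono) auto
    have eq: "?u i x - ?l i x = ?m * (g1 x + g2 x)" for x unfolding i(1) prod.case by (simp add: algebra_simps)
    show "Lr_norm P r (\<lambda>x. ?u i x - ?l i x) \<le> ennreal \<epsilon>"
      unfolding eq
    proof (rule Lr_norm_P_le[OF _ _ _ \<epsilon>])
      have "(\<integral>\<^sup>+x. ennreal (\<bar>?m * (g1 x + g2 x)\<bar> powr r) \<partial>lebesgue_cube d)
          \<le> (\<integral>\<^sup>+x. ennreal ((2 * ?m) powr r) * (ennreal (g1 x powr r) + ennreal (g2 x powr r)) \<partial>lebesgue_cube d)"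
      proof (rule nn_integral_mono)
        fix x
        have g: "0 \<le> g1 x" "0 \<le> g2 x" using sys(3) i by auto
        have "\<bar>?m * (g1 x + g2 x)\<bar> powr r = ?m powr r * (g1 x + g2 x) powr r"
          using M g by (simp add: abs_mult powr_mult)
        also have "\<dots> \<le> ?m powr r * (2 powr r * (g1 x powr r + g2 x powr r))"
          using g r by (intro mult_left_mono powr_add_le) auto
        also have "\<dots> = (2 * ?m) powr r * (g1 x powr r + g2 x powr r)"
          using m by (simp only: powr_mult mult_ac)
        finally have "ennreal (\<bar>?m * (g1 x + g2 x)\<bar> powr r) \<le> ennreal ((2 * ?m) powr r * (g1 x powr r + g2 x powr r))"
          by (rule ennreal_leI)
        then show "ennreal (\<bar>?m * (g1 x + g2 x)\<bar> powr r) \<le> ennreal ((2 * ?m) powr r) * (ennreal (g1 x powr r) + ennreal (g2 x powr r))"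
          by (simp add: ennreal_mult)
      qed
      also have "\<dots> = ennreal ((2 * ?m) powr r) * ((\<integral>\<^sup>+x. ennreal (g1 x powr r) \<partial>lebesgue_cube d) + (\<integral>\<^sup>+x. ennreal (g2 x powr r) \<partial>lebesgue_cube d))"
        by (subst nn_integral_cmult, measurable) (subst nn_integral_add, measurable)
      also have "\<dots> \<le> ennreal ((2 * ?m) powr r) * (ennreal (s powr r) + ennreal (s powr r))"
        by (intro mult_left_mono add_mono sys(4)[OF i(2)] sys(4)[OF i(3)]) simp
      also have "\<dots> = ennreal ((2 * ?m) powr r * (2 * s powr r))"
        by (simp add: ennreal_mult ennreal_plus[symmetric] del: ennreal_plus)
      also have "\<dots> \<le> ennreal ((2 * ?m) powr r * (2 powr r * s powr r))"
        using r powr_mono[of 1 r 2] by (intro ennreal_leI mult_left_mono mult_right_mono) auto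
      also have "(2 * ?m) powr r * (2 powr r * s powr r) = (4 * ?m * s) powr r"
      proof -
        have "(2 * ?m) powr r * (2 powr r * s powr r) = ((2 * ?m) * (2 * s)) powr r"
          using m s by (simp only: powr_mult)
        also have "(2 * ?m) * (2 * s) = 4 * ?m * s" by simp
        finally show ?thesis .
      qed
      finally show "(\<integral>\<^sup>+x. ennreal (\<bar>?m * (g1 x + g2 x)\<bar> powr r) \<partial>lebesgue_cube d) \<le> ennreal ((4 * ?m * s) powr r)" .
    qed (use m s in auto)
  next
    fix f assume "f \<in> cadlag_class d M"
    then obtain \<nu>1 \<nu>2 where \<nu>: "subprob_content d \<nu>1" "subprob_content d \<nu>2"
      "\<forall>x\<in>unit_cube d. f x = ?m * (\<nu>1 (lower_box d x) - \<nu>2 (lower_box d x))"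
      using cadlag_class_decomposition[OF M] by blast
    have "\<exists>(l, g)\<in>B. \<forall>x\<in>unit_cube d. l x \<le> \<nu> (lower_box d x) \<and> \<nu> (lower_box d x) \<le> l x + g x"
      if "subprob_content d \<nu>" for \<nu>
      using B that by (simp add: bracket_system_def)
    from this[OF \<nu>(1)] this[OF \<nu>(2)] obtain l1 g1 l2 g2 where B12: "(l1, g1) \<in> B" "(l2, g2) \<in> B"
      and b: "\<And>x. x \<in> unit_cube d \<Longrightarrow> l1 x \<le> \<nu>1 (lower_box d x) \<and> \<nu>1 (lower_box d x) \<le> l1 x + g1 x"
        "\<And>x. x \<in> unit_cube d \<Longrightarrow> l2 x \<le> \<nu>2 (lower_box d x) \<and> \<nu>2 (lower_box d x) \<le> l2 x + g2 x"
      by fast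
    have "?m * (l1 x - (l2 x + g2 x)) \<le> f x \<and> f x \<le> ?m * (l1 x + g1 x - l2 x)" if x: "x \<in> unit_cube d" for x
    proof -
      have "?m * (l1 x - (l2 x + g2 x)) \<le> ?m * (\<nu>1 (lower_box d x) - \<nu>2 (lower_box d x))"
        "?m * (\<nu>1 (lower_box d x) - \<nu>2 (lower_box d x)) \<le> ?m * (l1 x + g1 x - l2 x)"
        using m b[OF x] by (auto intro!: mult_left_mono)
      then show ?thesis using \<nu>(3) x by simp
    qed
    then show "\<exists>i\<in>B \<times> B. \<forall>x\<in>space P. ?l i x \<le> f x \<and> f x \<le> ?u i x"
      using B12 by (intro bexI[of _ "((l1, g1), (l2, g2))"]) (simp_all add: space_P)
  qed (use fin in auto)
  moreover have card: "1 \<le> card B" using fin by (simp add: Suc_leI card_gt_0_iff)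
  ultimately have "bracketing_entropy P r \<epsilon> (cadlag_class d M) \<le> ennreal (ln (real (card (B \<times> B))))"
    by (intro bracketing_entropy_le) (auto simp: card_cartesian_product)
  also have "ln (real (card (B \<times> B))) = 2 * ln (real (card B))"
    using card by (simp add: card_cartesian_product ln_mult)
  finally show ?thesis .
qed

end

text \<open>With \<open>1 + \<bar>ln (\<epsilon> / M)\<bar>\<close> in place of the bare logarithm
  the bound holds for every \<open>\<epsilon> > 0\<close>, also at \<open>\<epsilon> = M\<close>.
  This is the form that can be integrated over \<open>\<epsilon>\<close>.\<close>

lemma bracketing_entropy_cadlag_class_le:
  assumes r: "1 \<le> r"
  shows "\<exists>G :: real \<Rightarrow> real. (\<forall>c>0. 0 \<le> G c) \<and> (\<forall>c>0. \<forall>M>0. \<forall>\<epsilon>>0. \<forall>P.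
    sets P = sets (lebesgue_cube (Suc e)) \<longrightarrow>
    (\<forall>f\<in>borel_measurable (lebesgue_cube (Suc e)). Lr_norm P r f \<le> ennreal c * Lr_norm (lebesgue_cube (Suc e)) r f) \<longrightarrow>
    bracketing_entropy P r \<epsilon> (cadlag_class (Suc e) M) \<le> ennreal (G c * (M / \<epsilon> * (1 + \<bar>ln (\<epsilon> / M)\<bar>) ^ (2 * e))))"
proof -
  let ?d = "Suc e"
  obtain C0 where C0: "0 < C0" "\<And>y. 1 \<le> y \<Longrightarrow> \<exists>B. bracket_system ?d r (C0 / y) B \<and>
      ln (real (card B)) \<le> C0 * y * (1 + ln y) ^ (2 * e)"
    using bracket_system_exists[OF r] by blast
  \<comment> \<open>\<open>1 \<le> C\<close> serves the case of large \<open>\<epsilon>\<close>: it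
    makes the single bracket no larger than \<open>D * c * M\<close>.\<close>
  define C where "C = max 1 C0"
  define D where "D = 4 * C * (1 + 4 * 2 ^ ?d)"
  have C: "1 \<le> C" "C0 \<le> C" by (auto simp: C_def)
  have D: "0 < D" using C by (simp add: D_def add_pos_pos)
  define G where "G c = 2 * C * (D * c) * (1 + \<bar>ln (D * c)\<bar>) ^ (2 * e)" for c
  have "bracketing_entropy P r \<epsilon> (cadlag_class ?d M) \<le> ennreal (G c * (M / \<epsilon> * (1 + \<bar>ln (\<epsilon> / M)\<bar>) ^ (2 * e)))"
    if c: "0 < c" and M: "0 < M" and \<epsilon>: "0 < \<epsilon>" and P: "sets P = sets (lebesgue_cube ?d)"
      and norm: "\<forall>f\<in>borel_measurable (lebesgue_cube ?d). Lr_norm P r f \<le> ennreal c * Lr_norm (lebesgue_cube ?d) r f"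
    for c M \<epsilon> P
  proof (cases "1 \<le> D * c * (M / \<epsilon>)")
    case True
    \<comment> \<open>Chosen so that the size bound, with \<open>C\<close> in place of
      \<open>C0\<close>, is exactly \<open>\<epsilon>\<close>.\<close>
    define y where "y = D * c * (M / \<epsilon>)"
    have y: "1 \<le> y" using True by (simp add: y_def)
    obtain B where B: "bracket_system ?d r (C0 / y) B" "ln (real (card B)) \<le> C0 * y * (1 + ln y) ^ (2 * e)"
      using C0(2)[OF y] by blast
    have size: "c * (4 * (M * (1 + 4 * 2 ^ ?d)) * (C0 / y)) \<le> \<epsilon>"
    proof -
      have "c * (4 * (M * (1 + 4 * 2 ^ ?d)) * (C0 / y)) = (c * M * (1 + 4 * 2 ^ ?d) * 4 / y) * C0" by simp
      also have "\<dots> \<le> (c * M * (1 + 4 * 2 ^ ?d) * 4 / y) * C"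
        using c M y C by (intro mult_left_mono) auto
      also have "\<dots> = D * c * M / y" by (simp add: D_def)
      also have "\<dots> = \<epsilon>" using D c M \<epsilon> by (simp add: y_def)
      finally show ?thesis .
    qed
    have "bracketing_entropy P r \<epsilon> (cadlag_class ?d M) \<le> ennreal (2 * ln (real (card B)))"
      using C0(1) y norm by (intro bracketing_entropy_cadlag_class_le_system[OF r M c P _ B(1) _ size]) auto
    also have "\<dots> \<le> ennreal (G c * (M / \<epsilon> * (1 + \<bar>ln (\<epsilon> / M)\<bar>) ^ (2 * e)))"
    proof (rule ennreal_leI)
      have "ln y = ln (D * c) - ln (\<epsilon> / M)" using D c M \<epsilon> by (simp add: y_def ln_mult ln_div)
      then have "1 + ln y \<le> 1 + \<bar>ln (D * c)\<bar> + \<bar>ln (\<epsilon> / M)\<bar>" by linarith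
      also have "\<dots> \<le> (1 + \<bar>ln (D * c)\<bar>) * (1 + \<bar>ln (\<epsilon> / M)\<bar>)" by (simp add: algebra_simps)
      finally have "(1 + ln y) ^ (2 * e) \<le> (1 + \<bar>ln (D * c)\<bar>) ^ (2 * e) * (1 + \<bar>ln (\<epsilon> / M)\<bar>) ^ (2 * e)"
        unfolding power_mult_distrib[symmetric] using y by (intro power_mono) auto
      then have "C0 * y * (1 + ln y) ^ (2 * e) \<le> C * y * ((1 + \<bar>ln (D * c)\<bar>) ^ (2 * e) * (1 + \<bar>ln (\<epsilon> / M)\<bar>) ^ (2 * e))"
        using C C0(1) y by (intro mult_mono) auto
      then have "2 * ln (real (card B)) \<le> 2 * (C * y * ((1 + \<bar>ln (D * c)\<bar>) ^ (2 * e) * (1 + \<bar>ln (\<epsilon> / M)\<bar>) ^ (2 * e)))"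
        using B(2) by linarith
      also have "\<dots> = G c * (M / \<epsilon> * (1 + \<bar>ln (\<epsilon> / M)\<bar>) ^ (2 * e))"
        by (simp only: G_def y_def mult_ac)
      finally show "2 * ln (real (card B)) \<le> G c * (M / \<epsilon> * (1 + \<bar>ln (\<epsilon> / M)\<bar>) ^ (2 * e))" .
    qed
    finally show ?thesis .
  next
    case False
    then have "D * c * M \<le> \<epsilon>" using \<epsilon> by (simp add: field_simps)
    moreover have "c * (2 * (M * (1 + 4 * 2 ^ ?d))) * 1 \<le> c * (2 * (M * (1 + 4 * 2 ^ ?d))) * (2 * C)"
      using c M C by (intro mult_left_mono) auto
    then have "c * (2 * (M * (1 + 4 * 2 ^ ?d))) \<le> D * c * M" by (simp add: D_def mult_ac)
    ultimately have size: "c * (2 * (M * (1 + 4 * 2 ^ ?d))) \<le> \<epsilon>" by linarith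
    have "bracketing_entropy P r \<epsilon> (cadlag_class ?d M) \<le> 0"
      using norm by (intro bracketing_entropy_cadlag_class_eq_0[OF r M c P _ size]) auto
    then show ?thesis by simp
  qed
  moreover have "0 \<le> G c" if "0 < c" for c using C D that by (simp add: G_def)
  ultimately show ?thesis by blast
qed

section \<open>The entropy integral\<close>

text \<open>Any exponent below \<open>1 / 2\<close> would keep the entropy integrand integrable;
  \<open>1 / 4\<close> is one such choice. It is shared among the \<open>e\<close> factors, and
  \<open>e + 1\<close> in the denominator of \<open>?a\<close> keeps \<open>?a\<close> positive for
  \<open>e = 0\<close>.\<close>

lemma one_plus_ln_power_le:
  fixes y :: real
  assumes y: "1 \<le> y"
  shows "(1 + ln y) ^ e \<le> (1 + 4 * (real e + 1)) ^ e * y powr (1 / 4)"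
proof -
  let ?a = "1 / (4 * (real e + 1))"
  have a: "0 < ?a" by simp
  have "ln y \<le> y powr ?a / ?a" by (rule ln_powr_bound[OF y a])
  moreover have "1 \<le> y powr ?a" using y a by (intro ge_one_powr_ge_zero) auto
  ultimately have "1 + ln y \<le> (1 + 4 * (real e + 1)) * y powr ?a" by (simp add: algebra_simps)
  then have "(1 + ln y) ^ e \<le> ((1 + 4 * (real e + 1)) * y powr ?a) ^ e"
    using y by (intro power_mono) auto
  also have "\<dots> = (1 + 4 * (real e + 1)) ^ e * y powr (real e * ?a)"
    using y by (simp add: power_mult_distrib powr_power mult.commute)
  also have "\<dots> \<le> (1 + 4 * (real e + 1)) ^ e * y powr (1 / 4)"
    using y by (intro mult_left_mono powr_mono) (auto simp: field_simps)
  finally show ?thesis .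
qed

lemma nn_integral_powr_three_quarters:
  assumes \<delta>: "0 < \<delta>"
  shows "(\<integral>\<^sup>+\<epsilon>. ennreal (\<epsilon> powr (- 3 / 4)) * indicator {0<..\<delta>} \<epsilon> \<partial>lborel) \<le> ennreal (4 * \<delta> powr (1 / 4))"
proof -
  have "((\<lambda>x. x powr (- 3 / 4)) has_integral (\<delta> powr (- 3 / 4 + 1) / (- 3 / 4 + 1))) {0..\<delta>}"
    using \<delta> by (intro has_integral_powr_from_0) auto
  then have "((\<lambda>x. if x \<in> {0..\<delta>} then x powr (- 3 / 4) else 0) has_integral (4 * \<delta> powr (1 / 4))) UNIV"
    by (subst has_integral_restrict_UNIV) (simp add: mult.commute)
  then have "(\<integral>\<^sup>+x. ennreal (if x \<in> {0..\<delta>} then x powr (- 3 / 4) else 0) \<partial>lborel) = ennreal (4 * \<delta> powr (1 / 4))"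
    by (intro nn_integral_has_integral_lborel) auto
  moreover have "(\<integral>\<^sup>+\<epsilon>. ennreal (\<epsilon> powr (- 3 / 4)) * indicator {0<..\<delta>} \<epsilon> \<partial>lborel)
      \<le> (\<integral>\<^sup>+x. ennreal (if x \<in> {0..\<delta>} then x powr (- 3 / 4) else 0) \<partial>lborel)"
    by (intro nn_integral_mono) (auto simp: indicator_def)
  ultimately show ?thesis by simp
qed

text \<open>The logarithmic factor at \<open>\<epsilon>\<close> is at most the one at \<open>\<delta>\<close> times \<open>(1 + ln (\<delta> / \<epsilon>)) ^ e\<close>,
  hence times a multiple of \<open>(\<delta> / \<epsilon>) powr (1 / 4)\<close>, which keeps the integrand integrable at \<open>0\<close>.\<close>

lemma bracketing_integral_le:
  assumes G: "0 \<le> G" and M: "0 < M" and \<delta>: "0 < \<delta>"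
    and entropy: "\<And>\<epsilon>. 0 < \<epsilon> \<Longrightarrow> bracketing_entropy P r \<epsilon> F \<le> ennreal (G * (M / \<epsilon> * (1 + \<bar>ln (\<epsilon> / M)\<bar>) ^ (2 * e)))"
  shows "bracketing_integral P r \<delta> F
    \<le> ennreal (4 * (1 + 4 * (real e + 1)) ^ e * sqrt G * (sqrt M * \<delta> powr (1 / 2) * (1 + \<bar>ln (\<delta> / M)\<bar>) ^ e))"
proof -
  define A where "A = (1 + 4 * (real e + 1)) ^ e"
  define L where "L = 1 + \<bar>ln (\<delta> / M)\<bar>"
  \<comment> \<open>This \<open>\<delta> powr (1 / 4)\<close> stems from
    \<open>(\<delta> / \<epsilon>) powr (1 / 4)\<close>. The integral of
    \<open>\<epsilon> powr (- 3 / 4)\<close> supplies a second one, and together they form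
    \<open>\<delta> powr (1 / 2)\<close>.\<close>
  define c where "c = A * sqrt G * sqrt M * L ^ e * \<delta> powr (1 / 4)"
  have A: "0 \<le> A" by (simp add: A_def)
  have L: "0 \<le> L" by (simp add: L_def)
  have c: "0 \<le> c" using G M A L by (simp add: c_def)
  have "ennreal_power (bracketing_entropy P r \<epsilon> F) (1 / 2) \<le> ennreal (c * \<epsilon> powr (- 3 / 4))"
    if \<epsilon>: "0 < \<epsilon>" "\<epsilon> \<le> \<delta>" for \<epsilon>
  proof -
    let ?l = "1 + \<bar>ln (\<epsilon> / M)\<bar>" and ?y = "\<delta> / \<epsilon>"
    have y: "1 \<le> ?y" using \<epsilon> by simp
    have "ln (\<epsilon> / M) = ln (\<delta> / M) - ln ?y" using \<epsilon> \<delta> M by (simp add: ln_div)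
    then have "\<bar>ln (\<epsilon> / M)\<bar> \<le> \<bar>ln (\<delta> / M)\<bar> + ln ?y"
      using ln_ge_zero[OF y] by linarith
    also have "1 + \<dots> \<le> L * (1 + ln ?y)"
      using ln_ge_zero[OF y] by (simp add: L_def algebra_simps)
    finally have "?l \<le> L * (1 + ln ?y)" by simp
    then have "?l ^ e \<le> (L * (1 + ln ?y)) ^ e" by (intro power_mono) auto
    also have "\<dots> = L ^ e * (1 + ln ?y) ^ e" by (rule power_mult_distrib)
    also have "\<dots> \<le> L ^ e * (A * ?y powr (1 / 4))"
      unfolding A_def using L by (intro mult_left_mono one_plus_ln_power_le[OF y]) auto
    finally have l: "?l ^ e \<le> L ^ e * (A * ?y powr (1 / 4))" .
    have sqrt_l: "sqrt (?l ^ (2 * e)) = ?l ^ e"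
      unfolding power_even_eq by (rule real_sqrt_unique) auto
    have "ennreal_power (bracketing_entropy P r \<epsilon> F) (1 / 2)
        \<le> ennreal_power (ennreal (G * (M / \<epsilon> * ?l ^ (2 * e)))) (1 / 2)"
      using \<epsilon> by (intro ennreal_power_mono entropy) auto
    also have "\<dots> = ennreal (sqrt (G * (M / \<epsilon> * ?l ^ (2 * e))))"
      using G M \<epsilon> by (subst ennreal_power_ennreal) (auto simp: powr_half_sqrt)
    also have "sqrt (G * (M / \<epsilon> * ?l ^ (2 * e))) = sqrt G * sqrt M * \<epsilon> powr (- 1 / 2) * ?l ^ e"
      using \<epsilon> by (simp add: sqrt_l real_sqrt_mult real_sqrt_divide powr_minus_divide powr_half_sqrt)
    also have "ennreal (sqrt G * sqrt M * \<epsilon> powr (- 1 / 2) * ?l ^ e) \<le> ennreal (sqrt G * sqrt M * \<epsilon> powr (- 1 / 2) * (L ^ e * (A * ?y powr (1 / 4))))"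
      using G M by (intro ennreal_leI mult_left_mono l) auto
    also have "sqrt G * sqrt M * \<epsilon> powr (- 1 / 2) * (L ^ e * (A * ?y powr (1 / 4)))
        = c * (\<epsilon> powr (- 1 / 2) / \<epsilon> powr (1 / 4))"
      using \<epsilon> \<delta> by (simp add: c_def powr_divide)
    also have "\<epsilon> powr (- 1 / 2) / \<epsilon> powr (1 / 4) = \<epsilon> powr (- 3 / 4)"
      unfolding powr_diff[symmetric] by simp
    finally show ?thesis .
  qed
  then have "bracketing_integral P r \<delta> F
      \<le> (\<integral>\<^sup>+\<epsilon>. ennreal c * (ennreal (\<epsilon> powr (- 3 / 4)) * indicator {0<..\<delta>} \<epsilon>) \<partial>lborel)"
    unfolding bracketing_integral_def using c
    by (intro nn_integral_mono) (auto simp: indicator_def ennreal_mult)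
  also have "\<dots> = ennreal c * (\<integral>\<^sup>+\<epsilon>. ennreal (\<epsilon> powr (- 3 / 4)) * indicator {0<..\<delta>} \<epsilon> \<partial>lborel)"
    by (rule nn_integral_cmult) measurable
  also have "\<dots> \<le> ennreal c * ennreal (4 * \<delta> powr (1 / 4))"
    by (intro mult_left_mono nn_integral_powr_three_quarters \<delta>) auto
  also have "\<dots> = ennreal (c * (4 * \<delta> powr (1 / 4)))" using c by (simp add: ennreal_mult)
  also have "c * (4 * \<delta> powr (1 / 4)) = 4 * A * sqrt G * (sqrt M * (\<delta> powr (1 / 4) * \<delta> powr (1 / 4)) * L ^ e)"
    by (simp add: c_def)
  also have "\<delta> powr (1 / 4) * \<delta> powr (1 / 4) = \<delta> powr (1 / 2)"
    unfolding powr_add[symmetric] by simp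
  finally show ?thesis by (simp only: A_def L_def)
qed

text \<open>Since \<open>1 \<le> x / \<eta>\<close>, the summand \<open>1\<close> is absorbed. This
  turns \<open>1 + \<bar>ln (\<epsilon> / M)\<bar>\<close> into the bare logarithm and makes the
  constants depend on \<open>\<eta>\<close>.\<close>

lemma one_plus_power_le:
  fixes \<eta> x :: real
  assumes "0 < \<eta>" "\<eta> \<le> x"
  shows "(1 + x) ^ n \<le> (1 + 1 / \<eta>) ^ n * x ^ n"
proof -
  have "1 + x \<le> (1 + 1 / \<eta>) * x" using assms by (simp add: field_simps)
  then show ?thesis unfolding power_mult_distrib[symmetric] using assms by (intro power_mono) auto
qed

(* At \<epsilon> = M the logarithmic factor vanishes, although the class contains the constants M and -M
   and so is not a single bracket of size M. Hence no constant is uniform up to \<epsilon> = M; the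
   constants K1, K2 are uniform on each region \<eta> \<le> |ln (\<epsilon> / M)|. *)

theorem proposition2:
  shows "\<exists>C :: real \<Rightarrow> nat \<Rightarrow> real. (\<forall>r\<ge>1. \<forall>d\<ge>2. 0 < C r d) \<and>
    (\<forall>\<eta>>0. \<exists>K1 K2 :: nat \<Rightarrow> real \<Rightarrow> real \<Rightarrow> real.
      \<forall>d\<ge>2. \<forall>M>0. \<forall>(P :: (nat \<Rightarrow> real) measure) (c :: real \<Rightarrow> real).
        prob_space P \<longrightarrow> sets P = sets (lebesgue_cube d) \<longrightarrow>
        (\<forall>r\<ge>1. 0 < c r \<and> (\<forall>f\<in>borel_measurable (lebesgue_cube d).
           Lr_norm P r f \<le> ennreal (c r) * Lr_norm (lebesgue_cube d) r f)) \<longrightarrow>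
        (\<forall>r\<ge>1.
          (\<forall>\<epsilon>. 0 < \<epsilon> \<and> \<epsilon> < 1 \<and> \<eta> \<le> \<bar>ln (\<epsilon> / M)\<bar> \<longrightarrow>
             bracketing_entropy P r \<epsilon> (cadlag_class d M)
               \<le> ennreal (K1 d r (c r) * (C r d * M * inverse \<epsilon> * \<bar>ln (\<epsilon> / M)\<bar> ^ (2 * (d - 1))))) \<and>
          (\<forall>\<delta>. 0 < \<delta> \<and> \<delta> < 1 \<and> \<eta> \<le> \<bar>ln (\<delta> / M)\<bar> \<longrightarrow>
             bracketing_integral P r \<delta> (cadlag_class d M)
               \<le> ennreal (K2 d r (c r) * (sqrt (C r d) * sqrt M * \<delta> powr (1 / 2) * \<bar>ln (\<delta> / M)\<bar> ^ (d - 1))))))"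
proof -
  define Q where "Q e r G \<longleftrightarrow> (\<forall>c>0. 0 \<le> G c) \<and> (\<forall>c>0. \<forall>M>0. \<forall>\<epsilon>>0. \<forall>P.
    sets P = sets (lebesgue_cube (Suc e)) \<longrightarrow>
    (\<forall>f\<in>borel_measurable (lebesgue_cube (Suc e)). Lr_norm P r f \<le> ennreal c * Lr_norm (lebesgue_cube (Suc e)) r f) \<longrightarrow>
    bracketing_entropy P r \<epsilon> (cadlag_class (Suc e) M) \<le> ennreal (G c * (M / \<epsilon> * (1 + \<bar>ln (\<epsilon> / M)\<bar>) ^ (2 * e))))"
    for e r and G :: "real \<Rightarrow> real"
  \<comment> \<open>Choosing \<open>G\<close> from \<open>e\<close> and \<open>r\<close> alone
    ensures that \<open>K1\<close> and \<open>K2\<close> do not vary with \<open>M\<close>,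
    \<open>P\<close>, \<open>\<epsilon>\<close> or \<open>\<delta>\<close>.\<close>
  define G where "G e r = (SOME G. Q e r G)" for e r
  have ex: "\<exists>G. Q e r G" if "1 \<le> r" for e r
    using bracketing_entropy_cadlag_class_le[OF that, of e] unfolding Q_def .
  have Q: "Q e r (G e r)" if "1 \<le> r" for e r
    unfolding G_def by (rule someI_ex[OF ex[OF that]])
  define K1 where "K1 \<eta> d r c = G (d - 1) r c * (1 + 1 / \<eta>) ^ (2 * (d - 1))" for \<eta> :: real and d :: nat and r c :: real
  define K2 where "K2 \<eta> d r c = 4 * (1 + 4 * (real (d - 1) + 1)) ^ (d - 1) * sqrt (G (d - 1) r c) * (1 + 1 / \<eta>) ^ (d - 1)"
    for \<eta> :: real and d :: nat and r c :: real
  have main: "(0 < \<epsilon> \<and> \<epsilon> < 1 \<and> \<eta> \<le> \<bar>ln (\<epsilon> / M)\<bar> \<longrightarrow>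
       bracketing_entropy P r \<epsilon> (cadlag_class d M)
         \<le> ennreal (K1 \<eta> d r (c r) * (1 * M * inverse \<epsilon> * \<bar>ln (\<epsilon> / M)\<bar> ^ (2 * (d - 1))))) \<and>
     (0 < \<delta> \<and> \<delta> < 1 \<and> \<eta> \<le> \<bar>ln (\<delta> / M)\<bar> \<longrightarrow>
       bracketing_integral P r \<delta> (cadlag_class d M)
         \<le> ennreal (K2 \<eta> d r (c r) * (sqrt 1 * sqrt M * \<delta> powr (1 / 2) * \<bar>ln (\<delta> / M)\<bar> ^ (d - 1))))"
    if \<eta>: "0 < \<eta>" and d: "2 \<le> d" and M: "0 < M" and P: "sets P = sets (lebesgue_cube d)"
      and c: "\<forall>r\<ge>1. 0 < c r \<and> (\<forall>f\<in>borel_measurable (lebesgue_cube d).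
           Lr_norm P r f \<le> ennreal (c r) * Lr_norm (lebesgue_cube d) r f)" and r: "1 \<le> r"
    for \<eta> d M P r \<epsilon> \<delta> and c :: "real \<Rightarrow> real"
  proof -
    obtain e where e: "d = Suc e" using d by (cases d) auto
    have cr: "0 < c r" and norm: "\<And>f. f \<in> borel_measurable (lebesgue_cube d) \<Longrightarrow>
        Lr_norm P r f \<le> ennreal (c r) * Lr_norm (lebesgue_cube d) r f"
      using c r by auto
    have G: "0 \<le> G e r (c r)"
      by (rule Q[OF r, unfolded Q_def, THEN conjunct1, rule_format, OF cr])
    have ent: "bracketing_entropy P r \<epsilon> (cadlag_class d M)
        \<le> ennreal (G e r (c r) * (M / \<epsilon> * (1 + \<bar>ln (\<epsilon> / M)\<bar>) ^ (2 * e)))" if "0 < \<epsilon>" for \<epsilon>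
      unfolding e
      by (rule Q[OF r, unfolded Q_def, THEN conjunct2, rule_format, OF cr M that P[unfolded e] norm[unfolded e]])
    have "bracketing_entropy P r \<epsilon> (cadlag_class d M)
         \<le> ennreal (K1 \<eta> d r (c r) * (1 * M * inverse \<epsilon> * \<bar>ln (\<epsilon> / M)\<bar> ^ (2 * (d - 1))))"
      if \<epsilon>: "0 < \<epsilon>" "\<eta> \<le> \<bar>ln (\<epsilon> / M)\<bar>"
    proof -
      have "G e r (c r) * (M / \<epsilon> * (1 + \<bar>ln (\<epsilon> / M)\<bar>) ^ (2 * e))
          \<le> G e r (c r) * (M / \<epsilon> * ((1 + 1 / \<eta>) ^ (2 * e) * \<bar>ln (\<epsilon> / M)\<bar> ^ (2 * e)))"
        using G M \<epsilon> by (intro mult_left_mono one_plus_power_le[OF \<eta>]) auto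
      also have "\<dots> = K1 \<eta> d r (c r) * (1 * M * inverse \<epsilon> * \<bar>ln (\<epsilon> / M)\<bar> ^ (2 * (d - 1)))"
        by (simp add: K1_def e divide_inverse)
      finally show ?thesis by (intro order_trans[OF ent[OF \<epsilon>(1)]] ennreal_leI)
    qed
    moreover have "bracketing_integral P r \<delta> (cadlag_class d M)
         \<le> ennreal (K2 \<eta> d r (c r) * (sqrt 1 * sqrt M * \<delta> powr (1 / 2) * \<bar>ln (\<delta> / M)\<bar> ^ (d - 1)))"
      if \<delta>: "0 < \<delta>" "\<eta> \<le> \<bar>ln (\<delta> / M)\<bar>"
    proof -
      have "4 * (1 + 4 * (real e + 1)) ^ e * sqrt (G e r (c r)) * (sqrt M * \<delta> powr (1 / 2) * (1 + \<bar>ln (\<delta> / M)\<bar>) ^ e)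
          \<le> 4 * (1 + 4 * (real e + 1)) ^ e * sqrt (G e r (c r)) * (sqrt M * \<delta> powr (1 / 2) * ((1 + 1 / \<eta>) ^ e * \<bar>ln (\<delta> / M)\<bar> ^ e))"
        using G M \<delta> by (intro mult_left_mono one_plus_power_le[OF \<eta>]) auto
      also have "\<dots> = K2 \<eta> d r (c r) * (sqrt 1 * sqrt M * \<delta> powr (1 / 2) * \<bar>ln (\<delta> / M)\<bar> ^ (d - 1))"
        by (simp add: K2_def e)
      finally show ?thesis
        by (intro order_trans[OF bracketing_integral_le[OF G M \<delta>(1) ent]] ennreal_leI)
    qed
    ultimately show ?thesis by blast
  qed
  show ?thesis
  \<comment> \<open>\<open>C\<close> is constantly \<open>1\<close>: the factors that depend on
    \<open>r\<close> and \<open>d\<close> are contained in \<open>K1\<close> and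
    \<open>K2\<close>.\<close>
  proof (rule exI[of _ "\<lambda>_ _. 1"], intro conjI allI impI)
    fix \<eta> :: real assume \<eta>: "0 < \<eta>"
    show "\<exists>K1 K2 :: nat \<Rightarrow> real \<Rightarrow> real \<Rightarrow> real.
      \<forall>d\<ge>2. \<forall>M>0. \<forall>(P :: (nat \<Rightarrow> real) measure) (c :: real \<Rightarrow> real).
        prob_space P \<longrightarrow> sets P = sets (lebesgue_cube d) \<longrightarrow>
        (\<forall>r\<ge>1. 0 < c r \<and> (\<forall>f\<in>borel_measurable (lebesgue_cube d).
           Lr_norm P r f \<le> ennreal (c r) * Lr_norm (lebesgue_cube d) r f)) \<longrightarrow>
        (\<forall>r\<ge>1.
          (\<forall>\<epsilon>. 0 < \<epsilon> \<and> \<epsilon> < 1 \<and> \<eta> \<le> \<bar>ln (\<epsilon> / M)\<bar> \<longrightarrow>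
             bracketing_entropy P r \<epsilon> (cadlag_class d M)
               \<le> ennreal (K1 d r (c r) * (1 * M * inverse \<epsilon> * \<bar>ln (\<epsilon> / M)\<bar> ^ (2 * (d - 1))))) \<and>
          (\<forall>\<delta>. 0 < \<delta> \<and> \<delta> < 1 \<and> \<eta> \<le> \<bar>ln (\<delta> / M)\<bar> \<longrightarrow>
             bracketing_integral P r \<delta> (cadlag_class d M)
               \<le> ennreal (K2 d r (c r) * (sqrt 1 * sqrt M * \<delta> powr (1 / 2) * \<bar>ln (\<delta> / M)\<bar> ^ (d - 1)))))"
    proof (rule exI[of _ "K1 \<eta>"], rule exI[of _ "K2 \<eta>"], intro allI impI)
      fix d :: nat and M :: real and P :: "(nat \<Rightarrow> real) measure" and c :: "real \<Rightarrow> real" and r :: real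
      assume a: "2 \<le> d" "0 < M" "sets P = sets (lebesgue_cube d)"
        "\<forall>r\<ge>1. 0 < c r \<and> (\<forall>f\<in>borel_measurable (lebesgue_cube d).
           Lr_norm P r f \<le> ennreal (c r) * Lr_norm (lebesgue_cube d) r f)" "1 \<le> r"
      show "(\<forall>\<epsilon>. 0 < \<epsilon> \<and> \<epsilon> < 1 \<and> \<eta> \<le> \<bar>ln (\<epsilon> / M)\<bar> \<longrightarrow>
             bracketing_entropy P r \<epsilon> (cadlag_class d M)
               \<le> ennreal (K1 \<eta> d r (c r) * (1 * M * inverse \<epsilon> * \<bar>ln (\<epsilon> / M)\<bar> ^ (2 * (d - 1))))) \<and>
          (\<forall>\<delta>. 0 < \<delta> \<and> \<delta> < 1 \<and> \<eta> \<le> \<bar>ln (\<delta> / M)\<bar> \<longrightarrow>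
             bracketing_integral P r \<delta> (cadlag_class d M)
               \<le> ennreal (K2 \<eta> d r (c r) * (sqrt 1 * sqrt M * \<delta> powr (1 / 2) * \<bar>ln (\<delta> / M)\<bar> ^ (d - 1))))"
        using main[OF \<eta> a] by blast
    qed
  qed simp
qed

end
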